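(* Let $\mathfrak{g}$ be a non-compact real simple Lie algebra without complex structure and let $\mathfrak{g}_{\mathbb{C}}$ be its complexification. Let $\mathcal{O}$ be a complex nilpotent orbit in $\mathfrak{g}_{\mathbb{C}}$ with $\mathcal{O}\cap\mathfrak{g}\neq\emptyset$. Then the following three conditions on $\mathcal{O}$ are equivalent: (i) $\mathcal{O}$ is minimal in $(\mathcal{N}_{\mathfrak{g}}/G_{\mathbb{C}})\setminus\{[0]\}$ with respect to the closure ordering. (ii) The dimension of $\mathcal{O}$ attains its minimum in $(\mathcal{N}_{\mathfrak{g}}/G_{\mathbb{C}})\setminus\{[0]\}$ (that is, $\mathcal{O}$ belongs to this set and has the smallest dimension among its members). (iii) $\mathcal{O}\supset \mathfrak{g}_\lambda\setminus\{0\}$, where $\lambda$ is the highest root of $\Sigma^+(\mathfrak{g},\mathfrak{a})$ and $\mathfrak{g}_\lambda$ is the root space of $\lambda$ (the dimension of $\mathfrak{g}_\lambda$ need not be one). Furthermore, there exists exactly one such orbit $\mathcal{O}$ in $(\mathcal{N}_{\mathfrak{g}}/G_{\mathbb{C}})\setminus\{[0]\}$.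
   Context: "Without complex structure" means that $\mathfrak{g}_{\mathbb{C}}$ is a complex simple Lie algebra. $G_{\mathbb{C}}:=\mathrm{Int}(\mathfrak{g}_{\mathbb{C}})$ is the group of inner automorphisms of $\mathfrak{g}_{\mathbb{C}}$ (connected Lie group with Lie algebra $\mathrm{ad}\,\mathfrak{g}_{\mathbb{C}}$). $\mathcal{N}$ is the cone of nilpotent elements of $\mathfrak{g}_{\mathbb{C}}$; a complex nilpotent orbit is a $G_{\mathbb{C}}$-orbit in $\mathcal{N}$, and $\mathcal{N}/G_{\mathbb{C}}$ is the finite set of these. $\mathcal{N}_{\mathfrak{g}}/G_{\mathbb{C}}$ denotes the set of complex nilpotent orbits that meet $\mathfrak{g}$. The closure ordering is $\mathcal{O}_1\le\mathcal{O}_2$ iff $\mathcal{O}_1\subset\overline{\mathcal{O}_2}$; $[0]$ is the zero orbit. $\mathfrak{g}=\mathfrak{k}+\mathfrak{p}$ is a Cartan decomposition, $\mathfrak{a}$ is a maximal abelian subspace of $\mathfrak{p}$, $\Sigma(\mathfrak{g},\mathfrak{a})$ is the restricted root system, and $\Sigma^+(\mathfrak{g},\mathfrak{a})$ is a positive system of it. *)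

theory Defs
  imports "HOL-Analysis.Analysis"
begin

section \<open>Lie algebras\<close>

locale lie_algebra = vector_space scale
  for scale :: "'k::field \<Rightarrow> 'v::ab_group_add \<Rightarrow> 'v" +
  fixes br :: "'v \<Rightarrow> 'v \<Rightarrow> 'v"
  assumes br_add_left: "br (x + y) z = br x z + br y z"
    and br_add_right: "br x (y + z) = br x y + br x z"
    and br_scale_left: "br (scale c x) y = scale c (br x y)"
    and br_scale_right: "br x (scale c y) = scale c (br x y)"
    and br_self: "br x x = 0"
    and jacobi: "br x (br y z) + br y (br z x) + br z (br x y) = 0"

locale simple_lie_algebra = lie_algebra +
  assumes nonabelian: "\<exists>x y. br x y \<noteq> 0"
    and ideal_trivial: "subspace I \<Longrightarrow> (\<forall>x. \<forall>y\<in>I. br x y \<in> I) \<Longrightarrow> I = {0} \<or> I = UNIV"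

definition exp_op :: "('v::real_normed_vector \<Rightarrow> 'v) \<Rightarrow> 'v \<Rightarrow> 'v" where
  "exp_op T v = (\<Sum>n. (T ^^ n) v /\<^sub>R fact n)"

text \<open>The connected Lie group with Lie algebra \<open>ad\<close> is the group generated by all
  \<open>exp (ad x)\<close>; inverses need no separate clause, since \<open>exp (ad (- x))\<close> inverts
  \<open>exp (ad x)\<close>.\<close>

inductive_set Int_group :: "('v::real_normed_vector \<Rightarrow> 'v \<Rightarrow> 'v) \<Rightarrow> ('v \<Rightarrow> 'v) set"
  for br :: "'v \<Rightarrow> 'v \<Rightarrow> 'v" where
  Int_id: "id \<in> Int_group br"
| Int_step: "g \<in> Int_group br \<Longrightarrow> exp_op (br x) \<circ> g \<in> Int_group br"

definition Int_orbit :: "('v::real_normed_vector \<Rightarrow> 'v \<Rightarrow> 'v) \<Rightarrow> 'v \<Rightarrow> 'v set" where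
  "Int_orbit br x = {g x |g. g \<in> Int_group br}"

definition nilpotent_cone :: "('v::zero \<Rightarrow> 'v \<Rightarrow> 'v) \<Rightarrow> 'v set" where
  "nilpotent_cone br = {x. \<exists>n. \<forall>y. (br x ^^ n) y = 0}"


section \<open>Complexification\<close>

text \<open>The complexification of \<open>'a\<close> is \<open>'a \<times> 'a\<close>, the pair \<open>(x, y)\<close> standing for
  \<open>x + \<i> y\<close>; its topology is the product topology.\<close>

definition cscale :: "complex \<Rightarrow> 'a::real_vector \<times> 'a \<Rightarrow> 'a \<times> 'a" where
  "cscale c v = (Re c *\<^sub>R fst v - Im c *\<^sub>R snd v, Re c *\<^sub>R snd v + Im c *\<^sub>R fst v)"

definition cbr :: "('a::real_vector \<Rightarrow> 'a \<Rightarrow> 'a) \<Rightarrow> 'a \<times> 'a \<Rightarrow> 'a \<times> 'a \<Rightarrow> 'a \<times> 'a" where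
  "cbr br v w = (br (fst v) (fst w) - br (snd v) (snd w), br (fst v) (snd w) + br (snd v) (fst w))"

definition of_real_form :: "'a::real_vector \<Rightarrow> 'a \<times> 'a" where
  "of_real_form x = (x, 0)"

global_interpretation cvec: vector_space cscale
  by unfold_locales (auto simp: cscale_def algebra_simps)

lemma lie_algebra_cbr:
  assumes "lie_algebra scaleR br"
  shows "lie_algebra cscale (cbr br)"
proof -
  interpret L: lie_algebra scaleR br by (fact assms)
  have add: "br (x + y) z = br x z + br y z" "br x (y + z) = br x y + br x z" for x y z
    by (fact L.br_add_left L.br_add_right)+
  have sc: "br (c *\<^sub>R x) y = c *\<^sub>R br x y" "br x (c *\<^sub>R y) = c *\<^sub>R br x y" for c x y
    by (fact L.br_scale_left L.br_scale_right)+
  have diff: "br (x - y) z = br x z - br y z" "br x (y - z) = br x y - br x z" for x y z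
    using add(1)[of x "- y" z] add(2)[of x y "- z"]
      sc(1)[where c = "- 1" and x = y and y = z] sc(2)[where c = "- 1" and x = x and y = z]
    by simp_all
  have anti: "br x y + br y x = 0" for x y
  proof -
    have "br (x + y) (x + y) = br x y + br y x"
      by (simp only: add) (simp add: L.br_self)
    then show ?thesis
      by (simp only: L.br_self)
  qed
  define J where "J x y z = br x (br y z) + br y (br z x) + br z (br x y)" for x y z
  have J: "J x y z = 0" for x y z
    unfolding J_def by (fact L.jacobi)
  show ?thesis
  proof (unfold_locales, goal_cases)
    case (5 x)
    show ?case
      using anti[of "fst x" "snd x"] by (simp add: cbr_def L.br_self zero_prod_def)
  next
    case (6 x y z)
    have "cbr br x (cbr br y z) + cbr br y (cbr br z x) + cbr br z (cbr br x y) =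
        (J (fst x) (fst y) (fst z) - J (fst x) (snd y) (snd z)
          - J (snd x) (fst y) (snd z) - J (snd x) (snd y) (fst z),
         J (snd x) (fst y) (fst z) + J (fst x) (snd y) (fst z)
          + J (fst x) (fst y) (snd z) - J (snd x) (snd y) (snd z))"
      by (simp add: cbr_def J_def add diff algebra_simps)
    then show ?case
      by (simp add: J zero_prod_def)
  qed (simp_all add: cbr_def cscale_def add diff sc algebra_simps)
qed


section \<open>Dimension of complex submanifolds\<close>

definition holomorphic_map_on :: "('a::real_normed_vector \<times> 'a \<Rightarrow> 'a \<times> 'a) \<Rightarrow> ('a \<times> 'a) set \<Rightarrow> bool" where
  "holomorphic_map_on f U \<longleftrightarrow>
    (\<forall>x\<in>U. \<exists>D. (f has_derivative D) (at x) \<and> (\<forall>c v. D (cscale c v) = cscale c (D v)))"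

definition complex_submanifold :: "('a::real_normed_vector \<times> 'a) set \<Rightarrow> nat \<Rightarrow> bool" where
  "complex_submanifold S d \<longleftrightarrow>
    (\<forall>x\<in>S. \<exists>U W f g E. open U \<and> x \<in> U \<and> open W \<and> homeomorphism U W f g \<and>
       holomorphic_map_on f U \<and> holomorphic_map_on g W \<and>
       cvec.subspace E \<and> cvec.dim E = d \<and> f ` (S \<inter> U) = E \<inter> W)"

definition complex_dimension :: "('a::real_normed_vector \<times> 'a) set \<Rightarrow> nat" where
  "complex_dimension S = (THE d. complex_submanifold S d)"


section \<open>Complex nilpotent orbits meeting the real form\<close>

definition nilpotent_orbits :: "('v::real_normed_vector \<Rightarrow> 'v \<Rightarrow> 'v) \<Rightarrow> 'v set set" where
  "nilpotent_orbits br = Int_orbit br ` nilpotent_cone br"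

definition real_nilpotent_orbits ::
    "('a::real_normed_vector \<Rightarrow> 'a \<Rightarrow> 'a) \<Rightarrow> ('a \<times> 'a) set set" where
  "real_nilpotent_orbits br =
    {orb \<in> nilpotent_orbits (cbr br). orb \<inter> range of_real_form \<noteq> {}}"

definition closure_minimal :: "'v::topological_space set set \<Rightarrow> 'v set \<Rightarrow> bool" where
  "closure_minimal S orb \<longleftrightarrow>
    orb \<in> S \<and> (\<forall>orb'\<in>S. orb' \<subseteq> closure orb \<longrightarrow> orb' = orb)"

definition dimension_minimal :: "('a::real_normed_vector \<times> 'a) set set \<Rightarrow> ('a \<times> 'a) set \<Rightarrow> bool" where
  "dimension_minimal S orb \<longleftrightarrow>
    orb \<in> S \<and> (\<forall>orb'\<in>S. complex_dimension orb \<le> complex_dimension orb')"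


section \<open>Cartan decompositions and restricted roots\<close>

definition killing :: "('a::euclidean_space \<Rightarrow> 'a \<Rightarrow> 'a) \<Rightarrow> 'a \<Rightarrow> 'a \<Rightarrow> real" where
  "killing br x y = (\<Sum>b\<in>Basis. br x (br y b) \<bullet> b)"

text \<open>Compactness in the sense of semisimple Lie algebras.\<close>

definition compact_type :: "('a::euclidean_space \<Rightarrow> 'a \<Rightarrow> 'a) \<Rightarrow> bool" where
  "compact_type br \<longleftrightarrow> (\<forall>x. x \<noteq> 0 \<longrightarrow> killing br x x < 0)"

definition cartan_involution :: "('a::euclidean_space \<Rightarrow> 'a \<Rightarrow> 'a) \<Rightarrow> ('a \<Rightarrow> 'a) \<Rightarrow> bool" where
  "cartan_involution br \<theta> \<longleftrightarrow>
    linear \<theta> \<and> (\<forall>x y. \<theta> (br x y) = br (\<theta> x) (\<theta> y)) \<and> (\<forall>x. \<theta> (\<theta> x) = x) \<and>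
    (\<forall>x. x \<noteq> 0 \<longrightarrow> - killing br x (\<theta> x) > 0)"

definition cartan_decomposition ::
    "('a::euclidean_space \<Rightarrow> 'a \<Rightarrow> 'a) \<Rightarrow> 'a set \<Rightarrow> 'a set \<Rightarrow> bool" where
  "cartan_decomposition br k p \<longleftrightarrow>
    (\<exists>\<theta>. cartan_involution br \<theta> \<and> k = {x. \<theta> x = x} \<and> p = {x. \<theta> x = - x})"

definition abelian_subspace_in :: "('a::real_vector \<Rightarrow> 'a \<Rightarrow> 'a) \<Rightarrow> 'a set \<Rightarrow> 'a set \<Rightarrow> bool" where
  "abelian_subspace_in br p a \<longleftrightarrow> subspace a \<and> a \<subseteq> p \<and> (\<forall>x\<in>a. \<forall>y\<in>a. br x y = 0)"

definition maximal_abelian_in :: "('a::real_vector \<Rightarrow> 'a \<Rightarrow> 'a) \<Rightarrow> 'a set \<Rightarrow> 'a set \<Rightarrow> bool" where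
  "maximal_abelian_in br p a \<longleftrightarrow>
    abelian_subspace_in br p a \<and> (\<forall>a'. abelian_subspace_in br p a' \<and> a \<subseteq> a' \<longrightarrow> a' = a)"

text \<open>Functionals on the subspace \<open>a\<close> are extended by \<open>0\<close> outside \<open>a\<close> (so not linearly), which
  makes equality of functions coincide with equality on \<open>a\<close>.\<close>

definition dual_on :: "'a::real_vector set \<Rightarrow> ('a \<Rightarrow> real) set" where
  "dual_on a = {\<xi>. (\<forall>x\<in>a. \<forall>y\<in>a. \<xi> (x + y) = \<xi> x + \<xi> y) \<and>
    (\<forall>c. \<forall>x\<in>a. \<xi> (c *\<^sub>R x) = c * \<xi> x) \<and> (\<forall>x. x \<notin> a \<longrightarrow> \<xi> x = 0)}"

definition root_space ::
    "('a::real_vector \<Rightarrow> 'a \<Rightarrow> 'a) \<Rightarrow> 'a set \<Rightarrow> ('a \<Rightarrow> real) \<Rightarrow> 'a set" where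
  "root_space br a \<xi> = {x. \<forall>h\<in>a. br h x = \<xi> h *\<^sub>R x}"

definition restricted_roots ::
    "('a::real_vector \<Rightarrow> 'a \<Rightarrow> 'a) \<Rightarrow> 'a set \<Rightarrow> ('a \<Rightarrow> real) set" where
  "restricted_roots br a = {\<xi> \<in> dual_on a. \<xi> \<noteq> (\<lambda>_. 0) \<and> root_space br a \<xi> \<noteq> {0}}"

definition positive_system :: "('a \<Rightarrow> real) set \<Rightarrow> ('a \<Rightarrow> real) set \<Rightarrow> bool" where
  "positive_system R P \<longleftrightarrow>
    P \<subseteq> R \<and> (\<forall>\<xi>\<in>R. \<xi> \<in> P \<longleftrightarrow> (\<lambda>h. - \<xi> h) \<notin> P) \<and>
    (\<forall>\<xi>\<in>P. \<forall>\<eta>\<in>P. (\<lambda>h. \<xi> h + \<eta> h) \<in> R \<longrightarrow> (\<lambda>h. \<xi> h + \<eta> h) \<in> P)"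

text \<open>The greatest positive root for the order in which \<open>\<eta> \<le> \<xi>\<close> iff \<open>\<xi> - \<eta>\<close> is a sum of
  positive roots.\<close>

definition highest_root :: "('a \<Rightarrow> real) set \<Rightarrow> 'a \<Rightarrow> real" where
  "highest_root P = (THE \<xi>. \<xi> \<in> P \<and>
    (\<forall>\<eta>\<in>P. \<exists>m :: ('a \<Rightarrow> real) \<Rightarrow> nat. \<forall>h. \<xi> h - \<eta> h = (\<Sum>\<alpha>\<in>P. real (m \<alpha>) * \<alpha> h)))"

end

theory Submission
  imports Defs
begin

text \<open>
  Let \<open>\<lambda>\<close> be the highest restricted root. The nonzero elements of \<open>g\<^sub>\<lambda>\<close> lie in a single complex orbit
  \<open>M\<close>: scalings come from the coroot of \<open>\<lambda>\<close> (with complex coefficients, so that signs are included), and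
  \<open>ad [\<theta> x, z]\<close> rotates \<open>x\<close> into any orthogonal \<open>z\<close> of the same length. Every nonzero orbit meeting \<open>g\<close>
  has \<open>M\<close> in its closure: by simplicity a real conjugate of a real point has a nonzero \<open>\<lambda>\<close>-component, and
  contracting with the coroot of \<open>\<lambda>\<close>, on which \<open>\<lambda>\<close> is strictly larger than all other weights, isolates
  it.

  It remains to compare dimensions. For a real nilpotent \<open>x\<close> invariance of the Killing form gives
  \<open>h \<in> [x, g]\<close> with \<open>[h, x] = 2 x\<close>, and \<open>ad h - 2\<close> is injective on \<open>g / [g, x]\<close>. If \<open>x + z\<close> is in the orbit
  of \<open>x\<close>, with \<open>z\<close> small in a complement of \<open>[g, x]\<close>, then \<open>2 z - [h, z] = 2 (x + z) - [h, x + z]\<close> is tangent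
  to the orbit, which is impossible unless \<open>z = 0\<close>. With the inverse function theorem this
  shows that the orbit is a submanifold of dimension \<open>rank (ad x)\<close>, and that an orbit having \<open>x\<close> in its
  closure and the same rank is the orbit of \<open>x\<close>.
\<close>

section \<open>Exponentials of linear operators\<close>

text \<open>Dimension is defined by holomorphic charts and closure by the topology, so two facts
  familiar from algebraic groups (orbits are locally closed, the boundary of an orbit has smaller
  dimension) must come from local analysis. One statement at a point x replaces both: a point y near
  x with y in [y, g] and rank (ad y) \<le> rank (ad x) is on the orbit of x. The rank bound makes
  [g, x + z] a small perturbation of [g, x], so the part of 2 z - [h, z] transverse to [g, x] is of
  second order in z, while injectivity of ad h - 2 on g / [g, x] bounds it below to first order. The
  condition y in [y, g] makes 2 y tangent, and it holds along the whole orbit of x. The coroot flow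
  expands the highest component like exp (t \<lambda>(H)), so isolating it requires rescaling; this
  stays in the orbit because [h, x] = 2 x exponentiates to all positive multiples of x. For a
  nonzero root vector x, [x, \<theta> x] is a negative multiple of the coroot. This and positivity
  of the form -B(x, \<theta> y) give sums and differences of roots, the strict maximum of \<lambda>
  on its own coroot and the rotations of the highest root space.\<close>

typedef (overloaded) ('a::euclidean_space) endo = "UNIV :: ('a \<Rightarrow>\<^sub>L 'a) set"
  morphisms endo_blinfun Endo by simp

setup_lifting type_definition_endo

instantiation endo :: (euclidean_space) real_normed_vector
begin

lift_definition zero_endo :: "'a endo" is 0 .
lift_definition plus_endo :: "'a endo \<Rightarrow> 'a endo \<Rightarrow> 'a endo" is "(+)" .
lift_definition minus_endo :: "'a endo \<Rightarrow> 'a endo \<Rightarrow> 'a endo" is "(-)" .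
lift_definition uminus_endo :: "'a endo \<Rightarrow> 'a endo" is uminus .
lift_definition scaleR_endo :: "real \<Rightarrow> 'a endo \<Rightarrow> 'a endo" is scaleR .
lift_definition norm_endo :: "'a endo \<Rightarrow> real" is norm .

definition dist_endo :: "'a endo \<Rightarrow> 'a endo \<Rightarrow> real" where
  "dist_endo A B = norm (A - B)"
definition sgn_endo :: "'a endo \<Rightarrow> 'a endo" where
  "sgn_endo A = scaleR (inverse (norm A)) A"
definition [code del]:
  "(uniformity :: ('a endo \<times> 'a endo) filter) = (INF e\<in>{0 <..}. principal {(x, y). dist x y < e})"
definition [code del]:
  "open (U :: 'a endo set) \<longleftrightarrow> (\<forall>x\<in>U. \<forall>\<^sub>F (x', y) in uniformity. x' = x \<longrightarrow> y \<in> U)"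

instance
proof
  fix A B C :: "'a endo" and r s :: real and U :: "'a endo set"
  show "A + B + C = A + (B + C)" by transfer simp
  show "A + B = B + A" by transfer simp
  show "0 + A = A" by transfer simp
  show "- A + A = 0" by transfer simp
  show "A - B = A + - B" by transfer simp
  show "r *\<^sub>R (A + B) = r *\<^sub>R A + r *\<^sub>R B" by transfer (simp add: scaleR_add_right)
  show "(r + s) *\<^sub>R A = r *\<^sub>R A + s *\<^sub>R A" by transfer (simp add: scaleR_add_left)
  show "r *\<^sub>R s *\<^sub>R A = (r * s) *\<^sub>R A" by transfer simp
  show "1 *\<^sub>R A = A" by transfer simp
  show "norm A = 0 \<longleftrightarrow> A = 0" by transfer simp
  show "norm (A + B) \<le> norm A + norm B" by transfer (rule norm_triangle_ineq)
  show "norm (r *\<^sub>R A) = \<bar>r\<bar> * norm A" by transfer simp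
  show "dist A B = norm (A - B)" by (simp add: dist_endo_def)
  show "sgn A = scaleR (inverse (norm A)) A" by (simp add: sgn_endo_def)
qed (simp_all add: uniformity_endo_def open_endo_def)

end

text \<open>With composition as the ring product, operators such as ad x become elements of a Banach
  algebra, where \<open>exp\<close> and its derivative can be used.\<close>

instantiation endo :: (euclidean_space) real_normed_algebra_1
begin

lift_definition one_endo :: "'a endo" is id_blinfun .
lift_definition times_endo :: "'a endo \<Rightarrow> 'a endo \<Rightarrow> 'a endo" is blinfun_compose .

instance
proof
  fix A B C :: "'a endo" and r :: real
  show "A * B * C = A * (B * C)" by transfer (simp add: blinfun_eqI)
  show "1 * A = A" by transfer (simp add: blinfun_eqI)
  show "A * 1 = A" by transfer (simp add: blinfun_eqI)
  show "(A + B) * C = A * C + B * C"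
    by transfer (simp add: blinfun_eqI blinfun.add_left)
  show "A * (B + C) = A * B + A * C"
    by transfer (simp add: blinfun_eqI blinfun.add_left blinfun.add_right)
  show "r *\<^sub>R A * B = r *\<^sub>R (A * B)"
    by transfer (simp add: blinfun_eqI blinfun.scaleR_left)
  show "A * r *\<^sub>R B = r *\<^sub>R (A * B)"
    by transfer (simp add: blinfun_eqI blinfun.scaleR_left blinfun.scaleR_right)
  show "norm (A * B) \<le> norm A * norm B" by transfer (rule norm_blinfun_compose)
  show "norm (1 :: 'a endo) = 1" by transfer simp
  show "(0 :: 'a endo) \<noteq> 1"
    by transfer (metis norm_blinfun_id norm_zero zero_neq_one)
qed

end

instance endo :: (euclidean_space) banach
proof
  fix X :: "nat \<Rightarrow> 'a endo"
  assume "Cauchy X"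
  then have "Cauchy (\<lambda>n. endo_blinfun (X n))"
    by (simp add: Cauchy_def dist_norm norm_endo.rep_eq minus_endo.rep_eq)
  then obtain L where "(\<lambda>n. endo_blinfun (X n)) \<longlonglongrightarrow> L"
    using Cauchy_convergent convergentD by blast
  then have "X \<longlonglongrightarrow> Endo L"
    by (simp add: lim_sequentially dist_norm norm_endo.rep_eq minus_endo.rep_eq Endo_inverse)
  then show "convergent X" by (rule convergentI)
qed

definition endo_apply :: "'a::euclidean_space endo \<Rightarrow> 'a \<Rightarrow> 'a" where
  "endo_apply A = blinfun_apply (endo_blinfun A)"

lemma bounded_bilinear_endo_apply: "bounded_bilinear endo_apply"
proof
  fix A B :: "'a endo" and v w :: 'a and r :: real
  show "endo_apply (A + B) v = endo_apply A v + endo_apply B v"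
    by (simp add: endo_apply_def plus_endo.rep_eq blinfun.add_left)
  show "endo_apply A (v + w) = endo_apply A v + endo_apply A w"
    by (simp add: endo_apply_def blinfun.add_right)
  show "endo_apply (r *\<^sub>R A) v = r *\<^sub>R endo_apply A v"
    by (simp add: endo_apply_def scaleR_endo.rep_eq blinfun.scaleR_left)
  show "endo_apply A (r *\<^sub>R v) = r *\<^sub>R endo_apply A v"
    by (simp add: endo_apply_def blinfun.scaleR_right)
  show "\<exists>K. \<forall>A v. norm (endo_apply A v :: 'a) \<le> norm A * norm v * K"
    by (rule exI[of _ 1]) (simp add: endo_apply_def norm_endo.rep_eq norm_blinfun)
qed

global_interpretation endo_apply: bounded_bilinear endo_apply
  by (rule bounded_bilinear_endo_apply)

lemma endo_apply_1 [simp]: "endo_apply 1 v = v"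
  by (simp add: endo_apply_def one_endo.rep_eq)

lemma endo_apply_mult [simp]: "endo_apply (A * B) v = endo_apply A (endo_apply B v)"
  by (simp add: endo_apply_def times_endo.rep_eq)

lemma endo_apply_power: "endo_apply (A ^ n) v = (endo_apply A ^^ n) v"
  by (induction n) simp_all

lemma endo_eqI: "(\<And>v. endo_apply A v = endo_apply B v) \<Longrightarrow> A = B"
  by (metis blinfun_eqI endo_apply_def endo_blinfun_inject)

definition endo_of :: "('a::euclidean_space \<Rightarrow> 'a) \<Rightarrow> 'a endo" where
  "endo_of f = Endo (Blinfun f)"

lemma endo_apply_endo_of [simp]: "linear f \<Longrightarrow> endo_apply (endo_of f) v = f v"
  by (simp add: endo_apply_def endo_of_def Endo_inverse bounded_linear_Blinfun_apply linear_conv_bounded_linear)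

lemma exp_op_eq_exp:
  fixes T :: "'a::euclidean_space \<Rightarrow> 'a"
  assumes "linear T"
  shows "exp_op T v = endo_apply (exp (endo_of T)) v"
proof -
  have "endo_apply (exp (endo_of T)) v = (\<Sum>n. endo_apply (endo_of T ^ n /\<^sub>R fact n) v)"
    unfolding exp_def
    by (simp add: bounded_linear.suminf[OF endo_apply.bounded_linear_left summable_exp_generic])
  also have "\<dots> = exp_op T v"
  proof -
    have "endo_apply (endo_of T) = T" using assms by auto
    then show ?thesis by (simp add: exp_op_def endo_apply.scaleR_left endo_apply_power)
  qed
  finally show ?thesis by simp
qed

lemma sums_exp_op:
  fixes T :: "'a::euclidean_space \<Rightarrow> 'a"
  assumes "linear T"
  shows "(\<lambda>n. (T ^^ n) v /\<^sub>R fact n) sums exp_op T v"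
proof -
  have "(\<lambda>n. endo_apply (endo_of T ^ n /\<^sub>R fact n) v) sums endo_apply (exp (endo_of T)) v"
    unfolding exp_def
    using bounded_linear.sums[OF endo_apply.bounded_linear_left summable_sums[OF summable_exp_generic]] .
  moreover have "endo_apply (endo_of T) = T" using assms by auto
  ultimately show ?thesis
    using assms by (simp add: exp_op_eq_exp endo_apply.scaleR_left endo_apply_power)
qed

lemma linear_exp_op:
  fixes T :: "'a::euclidean_space \<Rightarrow> 'a"
  assumes "linear T"
  shows "linear (exp_op T)"
proof -
  have "exp_op T = endo_apply (exp (endo_of T))"
    using exp_op_eq_exp[OF assms] by blast
  then show ?thesis by (simp add: bounded_linear.linear[OF endo_apply.bounded_linear_right])
qed

lemma endo_of_uminus: "linear T \<Longrightarrow> endo_of (\<lambda>x. - T x) = - endo_of T"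
  by (rule endo_eqI) (simp add: endo_apply.minus_left linear_compose_neg)

lemma endo_of_scaleR: "linear T \<Longrightarrow> endo_of (\<lambda>x. r *\<^sub>R T x) = r *\<^sub>R endo_of T"
  by (rule endo_eqI) (simp add: endo_apply.scaleR_left linear_compose_scale_right)

lemma exp_op_uminus_cancel:
  fixes T :: "'a::euclidean_space \<Rightarrow> 'a"
  assumes "linear T"
  shows "exp_op T (exp_op (\<lambda>x. - T x) v) = v"
  using assms
  by (simp add: exp_op_eq_exp linear_compose_neg endo_of_uminus exp_minus_inverse flip: endo_apply_mult)

lemma exp_op_vector_derivative:
  fixes T :: "'a::euclidean_space \<Rightarrow> 'a"
  assumes "linear T"
  shows "((\<lambda>t. exp_op (\<lambda>x. t *\<^sub>R T x) v) has_vector_derivative T (exp_op (\<lambda>x. t *\<^sub>R T x) v)) (at t)"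
proof -
  have eq: "exp_op (\<lambda>x. s *\<^sub>R T x) v = endo_apply (exp (s *\<^sub>R endo_of T)) v" for s
    using assms by (simp add: exp_op_eq_exp linear_compose_scale_right endo_of_scaleR)
  have "((\<lambda>t. exp (t *\<^sub>R endo_of T)) has_vector_derivative endo_of T * exp (t *\<^sub>R endo_of T)) (at t)"
    by (rule exp_scaleR_has_vector_derivative_left)
  from bounded_linear.has_vector_derivative[OF endo_apply.bounded_linear_left this]
  show ?thesis using assms by (simp add: eq)
qed

text \<open>Used twice: with \<open>f\<close> a complex scalar multiplication, for complex linearity
  of the group, and with \<open>f\<close> the embedding of the real form, for lifting real
  automorphisms.\<close>

lemma exp_op_intertwine:
  fixes T :: "'a::euclidean_space \<Rightarrow> 'a" and S :: "'b::euclidean_space \<Rightarrow> 'b"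
  assumes f: "bounded_linear f" and "linear T" and "linear S" and eq: "\<And>x. f (T x) = S (f x)"
  shows "f (exp_op T v) = exp_op S (f v)"
proof -
  have "f ((T ^^ n) v) = (S ^^ n) (f v)" for n
    by (induction n) (simp_all add: eq)
  then have "(\<lambda>n. f ((T ^^ n) v /\<^sub>R fact n)) = (\<lambda>n. (S ^^ n) (f v) /\<^sub>R fact n)"
    using f by (simp add: linear_simps)
  with bounded_linear.sums[OF f sums_exp_op[OF \<open>linear T\<close>, of v]]
    sums_exp_op[OF \<open>linear S\<close>, of "f v"]
  show ?thesis by (metis sums_unique2)
qed

lemma exp_op_zero [simp]: "exp_op (\<lambda>x. 0) v = (v :: 'a::euclidean_space)"
proof -
  have "endo_of (\<lambda>x. 0) = (0 :: 'a endo)"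
    by (intro endo_eqI) (simp add: endo_apply.zero_left linear_zero)
  then show ?thesis by (simp add: exp_op_eq_exp linear_zero)
qed

lemma exp_op_eigenvector:
  fixes T :: "'a::euclidean_space \<Rightarrow> 'a"
  assumes "linear T" and "T v = c *\<^sub>R v"
  shows "exp_op T v = exp c *\<^sub>R v"
proof -
  have "(T ^^ n) v = c ^ n *\<^sub>R v" for n
    by (induction n) (use assms in \<open>auto simp: linear_cmul mult.commute\<close>)
  then have "(\<lambda>n. (c ^ n /\<^sub>R fact n) *\<^sub>R v) sums exp_op T v"
    using sums_exp_op[OF \<open>linear T\<close>, of v] by (simp add: ac_simps)
  moreover have "(\<lambda>n. (c ^ n /\<^sub>R fact n) *\<^sub>R v) sums (exp c *\<^sub>R v)"
    by (rule bounded_linear.sums[OF bounded_linear_scaleR_left exp_converges])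
  ultimately show ?thesis by (rule sums_unique2)
qed


section \<open>The derivative of the exponential in a noncommutative Banach algebra\<close>

primrec power_deriv :: "nat \<Rightarrow> 'a::real_normed_algebra_1 \<Rightarrow> 'a \<Rightarrow>\<^sub>L 'a" where
  "power_deriv 0 A = 0"
| "power_deriv (Suc n) A = (blinfun_mult_right A o\<^sub>L power_deriv n A) + blinfun_mult_left (A ^ n)"

text \<open>Without commutativity the derivative of A^n in direction H is the sum of all A^i H
  A^(n-1-i); the recursion of \<open>power_deriv\<close> is the product rule for A times A^n and
  avoids writing this sum.\<close>

lemma has_derivative_power_deriv: "((\<lambda>A. A ^ n) has_derivative power_deriv n A) (at A within S)"
proof (induction n)
  case (Suc n)
  show ?case
    unfolding power_Suc
    by (rule has_derivative_eq_rhs[OF has_derivative_mult[OF has_derivative_ident Suc]])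
      (simp add: fun_eq_iff blinfun.add_left)
qed (simp add: has_derivative_const zero_blinfun.rep_eq)

lemma norm_power_deriv_le:
  assumes "norm A \<le> R"
  shows "norm (power_deriv n A) \<le> real n * R ^ (n - 1)"
proof (induction n)
  case (Suc n)
  have R: "0 \<le> R" using assms norm_ge_zero order_trans by blast
  have mr: "norm (blinfun_mult_right A) \<le> R"
    using assms
    by (intro norm_blinfun_bound[OF R]) (auto intro!: order_trans[OF norm_mult_ineq] mult_right_mono)
  have ml: "norm (blinfun_mult_left (A ^ n)) \<le> R ^ n"
  proof (rule norm_blinfun_bound)
    fix x
    have "norm (x * A ^ n) \<le> norm x * norm A ^ n"
      by (intro order_trans[OF norm_mult_ineq] mult_left_mono norm_power_ineq) auto
    also have "\<dots> \<le> norm x * R ^ n"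
      using assms by (intro mult_left_mono power_mono) auto
    finally show "norm (blinfun_mult_left (A ^ n) x) \<le> R ^ n * norm x" by (simp add: mult.commute)
  qed (use R in simp)
  have "norm (power_deriv (Suc n) A) \<le> norm (blinfun_mult_right A) * norm (power_deriv n A) + R ^ n"
    using norm_triangle_le[OF add_mono[OF norm_blinfun_compose ml]] by simp
  also have "\<dots> \<le> R * (real n * R ^ (n - 1)) + R ^ n"
    using Suc mr R by (intro add_mono mult_mono) auto
  also have "\<dots> = real (Suc n) * R ^ (Suc n - 1)"
    by (cases n) (auto simp: algebra_simps)
  finally show ?case .
qed simp

definition exp_deriv :: "'a::{real_normed_algebra_1,banach} \<Rightarrow> 'a \<Rightarrow>\<^sub>L 'a" where
  "exp_deriv A = (\<Sum>n. power_deriv n A /\<^sub>R fact n)"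

text \<open>The bound \<open>M\<close> is the termwise derivative of the exponential series at R;
  shifting its index by one gives back R^n / n!, which is summable.\<close>

lemma
  fixes R :: real
  defines "M \<equiv> \<lambda>n. real n * R ^ (n - 1) / fact n"
  shows summable_power_deriv_bound: "summable M"
    and norm_power_deriv_fact_le: "norm A \<le> R \<Longrightarrow> norm (power_deriv n A /\<^sub>R fact n) \<le> M n"
proof -
  have "M (Suc n) = inverse (fact n) * R ^ n" for n
  proof -
    have "fact (Suc n) = real (Suc n) * fact n" by simp
    then show ?thesis unfolding M_def by (simp only: diff_Suc_1) (simp add: field_simps del: of_nat_Suc)
  qed
  then show "summable M"
    using summable_exp[of R] by (subst summable_Suc_iff[symmetric]) simp
  show "norm (power_deriv n A /\<^sub>R fact n) \<le> M n" if "norm A \<le> R"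
    using norm_power_deriv_le[OF that, of n] by (simp add: M_def field_simps)
qed

lemma exp_deriv_sums: "(\<lambda>n. power_deriv n A /\<^sub>R fact n) sums exp_deriv A"
  unfolding exp_deriv_def
  by (rule summable_sums, rule summable_comparison_test'[OF summable_power_deriv_bound])
    (rule norm_power_deriv_fact_le[OF order_refl])

lemma uniform_limit_exp_deriv:
  "uniform_limit (cball (0 :: 'a::{real_normed_algebra_1,banach}) R)
     (\<lambda>n A. \<Sum>i<n. power_deriv i A /\<^sub>R fact i) exp_deriv sequentially"
  unfolding exp_deriv_def
  by (rule Weierstrass_m_test[OF _ summable_power_deriv_bound[of R]])
    (use norm_power_deriv_fact_le in auto)

lemma continuous_on_power_deriv: "continuous_on S (power_deriv n)"
  by (induction n)
    (auto intro!: continuous_intros bounded_linear.continuous_on[OF bounded_linear_blinfun_mult_right]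
      bounded_linear.continuous_on[OF bounded_linear_blinfun_mult_left])

text \<open>The inverse function theorem will be applied to a map built from \<open>exp\<close>, and
  it asks for a continuous derivative.\<close>

lemma continuous_on_exp_deriv:
  "continuous_on S (exp_deriv :: 'a::{real_normed_algebra_1,banach} \<Rightarrow> _)"
proof -
  have "isCont (exp_deriv :: 'a \<Rightarrow> _) A" for A
  proof -
    have "continuous_on (cball 0 (norm A + 1)) (exp_deriv :: 'a \<Rightarrow> _)"
      by (rule uniform_limit_theorem[OF always_eventually uniform_limit_exp_deriv])
        (auto intro!: continuous_intros continuous_on_power_deriv)
    then have "continuous_on (ball 0 (norm A + 1)) (exp_deriv :: 'a \<Rightarrow> _)"
      by (rule continuous_on_subset) auto
    then show ?thesis by (simp add: continuous_on_eq_continuous_at)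
  qed
  then show ?thesis by (simp add: continuous_at_imp_continuous_on)
qed

lemma has_derivative_exp_banach_algebra:
  fixes A :: "'a::{real_normed_algebra_1,banach}"
  shows "(exp has_derivative exp_deriv A) (at A)"
proof -
  define S where "S = ball (0 :: 'a) (norm A + 1)"
  have "\<exists>g. \<forall>x\<in>S. (\<lambda>n. x ^ n /\<^sub>R fact n) sums g x \<and> (g has_derivative exp_deriv x) (at x within S)"
  proof (rule has_derivative_series[where x = A and l = "exp A" and f' = "\<lambda>n x. blinfun_apply (power_deriv n x /\<^sub>R fact n)"])
    show "convex S" by (simp add: S_def)
    show "((\<lambda>x. x ^ n /\<^sub>R fact n) has_derivative (\<lambda>h. (power_deriv n x /\<^sub>R fact n) h)) (at x within S)"
      if "x \<in> S" for n x
      using has_derivative_scaleR_right[OF has_derivative_power_deriv, of "inverse (fact n)"]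
      by (simp add: blinfun.scaleR_left)
    show "\<forall>\<^sub>F n in sequentially. \<forall>x\<in>S. \<forall>h.
        norm ((\<Sum>i<n. (power_deriv i x /\<^sub>R fact i) h) - exp_deriv x h) \<le> e * norm h" if "e > 0" for e
    proof (rule eventually_mono[OF uniform_limitD[OF uniform_limit_exp_deriv[of "norm A + 1"] that]])
      fix n
      assume elim: "\<forall>x\<in>cball (0 :: 'a) (norm A + 1). dist (\<Sum>i<n. power_deriv i x /\<^sub>R fact i) (exp_deriv x) < e"
      show "\<forall>x\<in>S. \<forall>h. norm ((\<Sum>i<n. (power_deriv i x /\<^sub>R fact i) h) - exp_deriv x h) \<le> e * norm h"
      proof (intro ballI allI)
        fix x :: 'a and h
        assume "x \<in> S"
        have "(\<Sum>i<n. (power_deriv i x /\<^sub>R fact i) h) - exp_deriv x h =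
            ((\<Sum>i<n. power_deriv i x /\<^sub>R fact i) - exp_deriv x) h"
          by (simp add: blinfun.sum_left blinfun.diff_left)
        also have "norm \<dots> \<le> norm ((\<Sum>i<n. power_deriv i x /\<^sub>R fact i) - exp_deriv x) * norm h"
          by (rule norm_blinfun)
        also have "\<dots> \<le> e * norm h"
          using less_imp_le[OF bspec[OF elim, of x]] \<open>x \<in> S\<close>
          by (intro mult_right_mono) (simp_all add: S_def dist_norm)
        finally show "norm ((\<Sum>i<n. (power_deriv i x /\<^sub>R fact i) h) - exp_deriv x h) \<le> e * norm h" .
      qed
    qed
    show "A \<in> S" by (simp add: S_def)
    show "(\<lambda>n. A ^ n /\<^sub>R fact n) sums exp A" by (rule exp_converges)
  qed
  then obtain g where g: "\<And>x. x \<in> S \<Longrightarrow> (\<lambda>n. x ^ n /\<^sub>R fact n) sums g x"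
    and g': "\<And>x. x \<in> S \<Longrightarrow> (g has_derivative exp_deriv x) (at x within S)" by blast
  have "A \<in> S" "open S" by (simp_all add: S_def)
  have "g x = exp x" if "x \<in> S" for x
    by (rule sums_unique2[OF g[OF that] exp_converges])
  moreover have "(g has_derivative exp_deriv A) (at A)"
    using g'[OF \<open>A \<in> S\<close>] by (simp add: at_within_open[OF \<open>A \<in> S\<close> \<open>open S\<close>])
  ultimately show ?thesis
    using has_derivative_transform_within_open[OF _ \<open>open S\<close> \<open>A \<in> S\<close>] by blast
qed

text \<open>At 0 only the term n = 1 survives: the constant term has derivative 0, and for n at
  least 2 every summand keeps a factor 0.\<close>

lemma exp_deriv_0: "exp_deriv 0 H = (H :: 'a::{real_normed_algebra_1,banach})"
proof -
  have "power_deriv n (0::'a) /\<^sub>R fact n = (if n = 1 then id_blinfun else 0)" for n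
  proof -
    have "power_deriv (Suc 0) (0::'a) = id_blinfun" "power_deriv (Suc (Suc m)) (0::'a) = 0" for m
      by (auto intro!: blinfun_eqI simp: blinfun.add_left)
    then show ?thesis
      by (cases n; cases "n - 1") (simp_all del: power_deriv.simps(2))
  qed
  then have "(\<lambda>n. if n = 1 then id_blinfun else 0) sums exp_deriv (0::'a)"
    using exp_deriv_sums[of "0::'a"] by simp
  then have "exp_deriv (0::'a) = id_blinfun"
    by (rule sums_unique2[OF _ sums_single[of 1 "\<lambda>_. id_blinfun"]])
  then show ?thesis by simp
qed

text \<open>Intended for \<open>J\<close> a complex scalar, which commutes with every ad u: the real
  derivative of \<open>exp\<close> along such directions is then complex linear, and this makes the
  orbit charts holomorphic.\<close>

lemma exp_deriv_mult_left:
  fixes A J H :: "'a::{real_normed_algebra_1,banach}"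
  assumes comm: "A * J = J * A"
  shows "exp_deriv A (J * H) = J * exp_deriv A H"
proof -
  have AJ: "A * (J * x) = J * (A * x)" for x
    using comm by (simp only: mult.assoc[symmetric])
  have "power_deriv n A (J * H) = J * power_deriv n A H" for n
    by (induction n) (simp_all add: AJ blinfun.add_left distrib_left mult.assoc)
  then have eq: "(\<lambda>n. (power_deriv n A /\<^sub>R fact n) (J * H)) = (\<lambda>n. J * (power_deriv n A /\<^sub>R fact n) H)"
    by (simp add: blinfun.scaleR_left)
  have sums: "(\<lambda>n. (power_deriv n A /\<^sub>R fact n) K) sums exp_deriv A K" for K
    using bounded_linear.sums[OF blinfun.bounded_linear_left exp_deriv_sums] .
  show ?thesis
    by (rule sums_unique2[OF sums[of "J * H", unfolded eq] sums_mult[OF sums]])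
qed

section \<open>Lie algebras on Euclidean spaces\<close>

text \<open>One locale serves both the real algebra and its complexification regarded over the
  reals; bilinearity is stated as boundedness so that the analytic rules for products apply to the
  bracket.\<close>

locale euclidean_lie_algebra =
  fixes br :: "'v::euclidean_space \<Rightarrow> 'v \<Rightarrow> 'v"
  assumes bounded_bilinear_br: "bounded_bilinear br"
    and br_self: "br x x = 0"
    and jacobi: "br x (br y z) + br y (br z x) + br z (br x y) = 0"

lemma lie_algebra_imp_euclidean_lie_algebra:
  assumes "lie_algebra scaleR (br :: 'v::euclidean_space \<Rightarrow> 'v \<Rightarrow> 'v)"
  shows "euclidean_lie_algebra br"
proof -
  interpret L: lie_algebra scaleR br by (fact assms)
  have "bilinear br"
    by (auto simp: bilinear_def intro!: linearI L.br_add_left L.br_add_right L.br_scale_left L.br_scale_right)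
  then show ?thesis
    using L.br_self L.jacobi
    by (intro euclidean_lie_algebra.intro) (simp_all add: bilinear_conv_bounded_bilinear)
qed

context euclidean_lie_algebra
begin

sublocale br: bounded_bilinear br
  by (rule bounded_bilinear_br)

lemma linear_br: "linear (br x)"
  by (rule bounded_linear.linear[OF br.bounded_linear_right])

lemma linear_br_left: "linear (\<lambda>x. br x y)"
  by (rule bounded_linear.linear[OF br.bounded_linear_left])

lemma br_antisym: "br y x = - br x y"
proof -
  have "br (x + y) (x + y) = br x y + br y x"
    by (simp only: br.add_left br.add_right) (simp add: br_self)
  then have "br x y + br y x = 0" by (simp add: br_self)
  then show ?thesis by (simp add: eq_neg_iff_add_eq_0 add.commute)
qed

lemma br_br: "br x (br y z) = br (br x y) z + br y (br x z)"
proof -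
  have "br y (br z x) = - br y (br x z)" "br z (br x y) = - br (br x y) z"
    using br_antisym[of x z] br_antisym[of "br x y" z] by (simp_all add: br.minus_right)
  with jacobi[of x y z] show ?thesis by (simp add: algebra_simps)
qed

text \<open>By the Leibniz rule the curve exp(-tD) [exp(tD) x, exp(tD) y] has derivative zero, so
  its values at t = 0 and t = 1 agree. No rearrangement of double series is involved.\<close>

lemma exp_op_derivation:
  assumes D: "linear D" and leibniz: "\<And>x y. D (br x y) = br (D x) y + br x (D y)"
  shows "exp_op D (br x y) = br (exp_op D x) (exp_op D y)"
proof -
  define A where "A = endo_of D"
  have A: "endo_apply A v = D v" for v using D by (simp add: A_def)
  define \<phi> where "\<phi> t = endo_apply (exp (t *\<^sub>R (- A)))
      (br (endo_apply (exp (t *\<^sub>R A)) x) (endo_apply (exp (t *\<^sub>R A)) y))" for t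
  have E: "((\<lambda>t. endo_apply (exp (t *\<^sub>R A)) v) has_vector_derivative D (endo_apply (exp (t *\<^sub>R A)) v)) (at t)"
    for v t
    using bounded_linear.has_vector_derivative[OF endo_apply.bounded_linear_left
        exp_scaleR_has_vector_derivative_left[of A t]] by (simp add: A)
  have "(\<phi> has_vector_derivative 0) (at t)" for t
  proof -
    let ?X = "endo_apply (exp (t *\<^sub>R A)) x" and ?Y = "endo_apply (exp (t *\<^sub>R A)) y"
    have 1: "((\<lambda>t. exp (t *\<^sub>R (- A))) has_vector_derivative exp (t *\<^sub>R (- A)) * (- A)) (at t)"
      by (rule exp_scaleR_has_vector_derivative_right)
    have 2: "((\<lambda>t. br (endo_apply (exp (t *\<^sub>R A)) x) (endo_apply (exp (t *\<^sub>R A)) y))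
        has_vector_derivative br ?X (D ?Y) + br (D ?X) ?Y) (at t)"
      using br.has_vector_derivative[OF E[of x t] E[of y t]] .
    have 3: "endo_apply (exp (t *\<^sub>R (- A))) (br ?X (D ?Y) + br (D ?X) ?Y)
        + endo_apply (exp (t *\<^sub>R (- A)) * (- A)) (br ?X ?Y) = 0"
      by (simp only: endo_apply_mult endo_apply.minus_left A leibniz endo_apply.minus_right) (simp add: add.commute)
    from endo_apply.has_vector_derivative[OF 1 2, unfolded 3]
    show ?thesis unfolding \<phi>_def .
  qed
  then have "(\<phi> has_derivative (\<lambda>h. 0)) (at t within UNIV)" for t
    by (simp add: has_vector_derivative_def)
  from has_derivative_zero_unique[OF convex_UNIV this] have "\<phi> 1 = \<phi> 0"
    by simp
  then have "endo_apply (exp (- A)) (br (exp_op D x) (exp_op D y)) = br x y"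
    using D by (simp add: \<phi>_def exp_op_eq_exp A_def)
  then have "endo_apply (exp A * exp (- A)) (br (exp_op D x) (exp_op D y)) = endo_apply (exp A) (br x y)"
    by simp
  then have "br (exp_op D x) (exp_op D y) = endo_apply (exp A) (br x y)"
    by (simp only: exp_minus_inverse endo_apply_1)
  then show ?thesis by (simp only: exp_op_eq_exp[OF D] A_def)
qed

lemma exp_ad_br: "exp_op (br u) (br x y) = br (exp_op (br u) x) (exp_op (br u) y)"
  by (rule exp_op_derivation[OF linear_br br_br])

lemma br_uminus_fun: "br (- x) = (\<lambda>v. - br x v)"
  by (simp add: br.minus_left fun_eq_iff)

lemma exp_ad_uminus: "exp_op (br x) (exp_op (br (- x)) v) = v"
  unfolding br_uminus_fun by (rule exp_op_uminus_cancel[OF linear_br])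

lemma exp_ad_uminus': "exp_op (br (- x)) (exp_op (br x) v) = v"
  using exp_ad_uminus[of "- x" v] by simp

lemma linear_Int_group: "g \<in> Int_group br \<Longrightarrow> linear g"
proof (induction rule: Int_group.induct)
  case (Int_step g x)
  show ?case by (rule linear_compose[OF Int_step.IH linear_exp_op[OF linear_br]])
qed (simp add: linear_iff)

lemma Int_group_br: "g \<in> Int_group br \<Longrightarrow> g (br x y) = br (g x) (g y)"
  by (induction rule: Int_group.induct) (simp_all add: exp_ad_br)

lemma exp_ad_in_Int_group: "exp_op (br x) \<in> Int_group br"
  using Int_step[OF Int_id, of br x] by simp

lemma Int_group_compose: "g \<in> Int_group br \<Longrightarrow> h \<in> Int_group br \<Longrightarrow> g \<circ> h \<in> Int_group br"
  by (induction rule: Int_group.induct) (simp_all add: comp_assoc Int_step)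

text \<open>The inductive definition only multiplies generators on the left, so the inverse is built
  by composing with exp(ad(-x)) on the right.\<close>

lemma Int_group_inverse:
  assumes "g \<in> Int_group br"
  obtains g' where "g' \<in> Int_group br" "\<And>x. g (g' x) = x" "\<And>x. g' (g x) = x"
proof -
  have "\<exists>g'\<in>Int_group br. (\<forall>x. g (g' x) = x) \<and> (\<forall>x. g' (g x) = x)"
    using assms
  proof (induction rule: Int_group.induct)
    case Int_id
    show ?case by (intro bexI[of _ id]) (simp_all add: Int_group.Int_id)
  next
    case (Int_step g x)
    then obtain g' where "g' \<in> Int_group br" "\<And>x. g (g' x) = x" "\<And>x. g' (g x) = x" by blast
    then show ?case
      by (intro bexI[of _ "g' \<circ> exp_op (br (- x))"])
        (simp_all add: Int_group_compose exp_ad_in_Int_group exp_ad_uminus exp_ad_uminus')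
  qed
  then show ?thesis using that by blast
qed

lemma Int_orbit_refl: "x \<in> Int_orbit br x"
proof -
  have "x = id x" by simp
  then show ?thesis unfolding Int_orbit_def using Int_id[of br] by blast
qed

lemma Int_orbit_group: "y \<in> Int_orbit br x \<Longrightarrow> g \<in> Int_group br \<Longrightarrow> g y \<in> Int_orbit br x"
proof -
  assume "y \<in> Int_orbit br x" and g: "g \<in> Int_group br"
  then obtain h where h: "h \<in> Int_group br" "y = h x" unfolding Int_orbit_def by blast
  have "g y = (g \<circ> h) x" using h by simp
  with Int_group_compose[OF g h(1)] show ?thesis unfolding Int_orbit_def by blast
qed

lemma Int_orbit_exp: "y \<in> Int_orbit br x \<Longrightarrow> exp_op (br u) y \<in> Int_orbit br x"
  by (rule Int_orbit_group[OF _ exp_ad_in_Int_group])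

lemma Int_orbit_sym: "y \<in> Int_orbit br x \<Longrightarrow> x \<in> Int_orbit br y"
proof -
  assume "y \<in> Int_orbit br x"
  then obtain g where g: "g \<in> Int_group br" "y = g x" by (auto simp: Int_orbit_def)
  obtain g' where "g' \<in> Int_group br" "g' (g x) = x" using Int_group_inverse[OF g(1)] by metis
  then have "x = g' y" "g' \<in> Int_group br" using g by simp_all
  then show ?thesis unfolding Int_orbit_def by blast
qed

lemma Int_orbit_trans: "z \<in> Int_orbit br y \<Longrightarrow> y \<in> Int_orbit br x \<Longrightarrow> z \<in> Int_orbit br x"
proof -
  assume "z \<in> Int_orbit br y" and y: "y \<in> Int_orbit br x"
  then obtain g where "g \<in> Int_group br" "z = g y" unfolding Int_orbit_def by blast
  with Int_orbit_group[OF y] show ?thesis by simp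
qed

lemma Int_orbit_eq: "y \<in> Int_orbit br x \<Longrightarrow> Int_orbit br y = Int_orbit br x"
  by (auto intro: Int_orbit_trans[of _ y x] Int_orbit_trans[OF _ Int_orbit_sym[of y x]])

lemma Int_orbit_eqI: "z \<in> Int_orbit br x \<Longrightarrow> z \<in> Int_orbit br y \<Longrightarrow> Int_orbit br x = Int_orbit br y"
  using Int_orbit_eq[of z x] Int_orbit_eq[of z y] by simp

text \<open>Since g is an automorphism it carries [x, g] to [g x, g], that is, tangent spaces of the
  orbit to tangent spaces. Hence the rank of ad is constant on orbits.\<close>

lemma range_br_Int_group:
  assumes "g \<in> Int_group br"
  shows "range (br (g x)) = g ` range (br x)"
proof -
  obtain g' where "g' \<in> Int_group br" "\<And>x. g (g' x) = x" using Int_group_inverse[OF assms] by metis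
  then have eq: "br (g x) y = g (br x (g' y))" for y :: 'v
    using Int_group_br[OF assms] by simp
  show ?thesis
  proof
    show "range (br (g x)) \<subseteq> g ` range (br x)" by (auto simp: eq)
    show "g ` range (br x) \<subseteq> range (br (g x))" using Int_group_br[OF assms] by auto
  qed
qed

lemma closure_Int_orbit_group:
  assumes "y \<in> closure (Int_orbit br x)" and "g \<in> Int_group br"
  shows "g y \<in> closure (Int_orbit br x)"
proof -
  have "continuous_on (closure (Int_orbit br x)) g"
    using linear_Int_group[OF assms(2)] by (rule linear_continuous_on_compose[OF continuous_on_id, simplified])
  then have "g ` closure (Int_orbit br x) \<subseteq> closure (Int_orbit br x)"
    by (rule image_closure_subset) (auto intro: Int_orbit_group[OF _ assms(2)] closure_subset[THEN subsetD])
  with assms(1) show ?thesis by blast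
qed

lemma Int_orbit_0: "Int_orbit br 0 = {0}"
proof -
  have "g 0 = 0" if "g \<in> Int_group br" for g using linear_0[OF linear_Int_group[OF that]] .
  then have "Int_orbit br 0 \<subseteq> {0}" unfolding Int_orbit_def by blast
  with Int_orbit_refl[of 0] show ?thesis by blast
qed

end

section \<open>Complexification and the dimension of complex submanifolds\<close>

lemma subspace_projection:
  fixes S :: "'a::euclidean_space set"
  assumes "subspace S"
  obtains P where "linear P" "\<And>x. P x \<in> S" "\<And>x. x \<in> S \<Longrightarrow> P x = x"
proof -
  have "linear (\<lambda>x::'a. x)" by (simp add: linear_iff)
  then obtain P where "range P \<subseteq> S" "linear P" "\<forall>x\<in>S. P x = x"
    using linear_exists_left_inverse_on[of "\<lambda>x::'a. x" S] assms by (auto simp: inj_on_def)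
  then show ?thesis using that[of P] by (auto simp: image_subset_iff)
qed

text \<open>For a linear projection \<open>P\<close> onto \<open>S\<close>, the map id - P kills the
  curve near 0 and therefore also its velocity.\<close>

lemma vector_derivative_in_subspace:
  fixes \<phi> :: "real \<Rightarrow> 'a::euclidean_space"
  assumes "subspace S" and deriv: "(\<phi> has_vector_derivative v) (at 0)"
    and ev: "eventually (\<lambda>t. \<phi> t \<in> S) (nhds 0)"
  shows "v \<in> S"
proof -
  obtain P where P: "linear P" "\<And>x. P x \<in> S" "\<And>x. x \<in> S \<Longrightarrow> P x = x"
    using subspace_projection[OF \<open>subspace S\<close>] by metis
  have "((\<lambda>t. \<phi> t - P (\<phi> t)) has_vector_derivative v - P v) (at 0)"
    using P(1) by (intro has_vector_derivative_diff deriv bounded_linear.has_vector_derivative[OF _ deriv])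
      (simp add: linear_conv_bounded_linear)
  moreover have "eventually (\<lambda>t. 0 = \<phi> t - P (\<phi> t)) (nhds 0)"
    using ev by eventually_elim (simp add: P)
  then have "((\<lambda>t. \<phi> t - P (\<phi> t)) has_vector_derivative 0) (at 0)"
    using has_vector_derivative_const[of 0 "at 0"]
    by (subst has_vector_derivative_cong_ev[where g = "\<lambda>_. 0"])
      (auto elim!: eventually_mono dest: eventually_nhds_x_imp_x)
  ultimately have "v - P v = 0" by (rule vector_derivative_unique_at)
  then show ?thesis using P(2)[of v] by simp
qed

section \<open>Complex-linear maps between complexifications\<close>

definition complex_linear :: "('a::real_vector \<times> 'a \<Rightarrow> 'b::real_vector \<times> 'b) \<Rightarrow> bool" where
  "complex_linear f \<longleftrightarrow> (\<forall>v w. f (v + w) = f v + f w) \<and> (\<forall>c v. f (cscale c v) = cscale c (f v))"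

lemma complex_linearI:
  "(\<And>v w. f (v + w) = f v + f w) \<Longrightarrow> (\<And>c v. f (cscale c v) = cscale c (f v)) \<Longrightarrow> complex_linear f"
  unfolding complex_linear_def by blast

lemma complex_linear_add: "complex_linear f \<Longrightarrow> f (v + w) = f v + f w"
  unfolding complex_linear_def by blast

lemma complex_linear_scale: "complex_linear f \<Longrightarrow> f (cscale c v) = cscale c (f v)"
  unfolding complex_linear_def by blast

lemma complex_linear_iff: "complex_linear f \<longleftrightarrow> Vector_Spaces.linear cscale cscale f"
  unfolding complex_linear_def Vector_Spaces.linear_iff
  by (intro iffI conjI cvec.vector_space_axioms) blast+

lemma cscale_of_real: "cscale (of_real r) v = r *\<^sub>R v"
  by (simp add: cscale_def prod_eq_iff)

lemma complex_linear_imp_linear: "complex_linear f \<Longrightarrow> linear f"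
  by (rule linearI) (simp_all add: complex_linear_add complex_linear_scale flip: cscale_of_real)

lemma complex_linear_compose: "complex_linear f \<Longrightarrow> complex_linear g \<Longrightarrow> complex_linear (\<lambda>x. f (g x))"
  by (rule complex_linearI) (simp_all add: complex_linear_add complex_linear_scale)

lemma linear_cscale: "linear (cscale c)"
  by (rule linearI) (simp_all add: cvec.scale_right_distrib cscale_def algebra_simps)

lemma bounded_linear_cscale: "bounded_linear (cscale c :: 'a::euclidean_space \<times> 'a \<Rightarrow> _)"
  by (rule linear_conv_bounded_linear[THEN iffD1, OF linear_cscale])

lemma complex_subspace_imp_subspace: "cvec.subspace S \<Longrightarrow> subspace S"
  unfolding cvec.subspace_def subspace_def by (simp flip: cscale_of_real)

global_interpretation clin: vector_space_pair cscale cscale ..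

lemma complex_subspace_image: "complex_linear f \<Longrightarrow> cvec.subspace S \<Longrightarrow> cvec.subspace (f ` S)"
  unfolding complex_linear_iff by (rule clin.linear_subspace_image)

lemma complex_basis_coordinates:
  "v = (\<Sum>b\<in>Basis. cscale (Complex (fst v \<bullet> b) (snd v \<bullet> b)) (of_real_form b))"
  for v :: "'a::euclidean_space \<times> 'a"
  by (simp add: prod_eq_iff fst_sum snd_sum cscale_def of_real_form_def euclidean_representation)

lemma inj_of_real_form: "inj of_real_form"
  by (simp add: inj_def of_real_form_def)

global_interpretation cfin: finite_dimensional_vector_space cscale "of_real_form ` (Basis :: 'a::euclidean_space set)"
proof
  show "finite (of_real_form ` (Basis :: 'a set))" by simp
  show "cvec.independent (of_real_form ` (Basis :: 'a set))"
  proof (rule cvec.independent_if_scalars_zero)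
    fix f :: "'a \<times> 'a \<Rightarrow> complex" and x :: "'a \<times> 'a"
    assume 0: "(\<Sum>x\<in>of_real_form ` Basis. cscale (f x) x) = 0" and "x \<in> of_real_form ` Basis"
    then obtain b where b: "b \<in> Basis" "x = of_real_form b" by blast
    have "(\<Sum>b\<in>(Basis :: 'a set). cscale (f (of_real_form b)) (of_real_form b)) = 0"
      using 0 by (subst (asm) sum.reindex) (auto intro: inj_on_subset[OF inj_of_real_form])
    then have "(\<Sum>b\<in>(Basis :: 'a set). Re (f (of_real_form b)) *\<^sub>R b) = 0"
      "(\<Sum>b\<in>(Basis :: 'a set). Im (f (of_real_form b)) *\<^sub>R b) = 0"
      by (simp_all add: prod_eq_iff fst_sum snd_sum cscale_def of_real_form_def)
    then have "(\<Sum>b\<in>(Basis :: 'a set). Re (f (of_real_form b)) *\<^sub>R b) \<bullet> b = 0"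
      "(\<Sum>b\<in>(Basis :: 'a set). Im (f (of_real_form b)) *\<^sub>R b) \<bullet> b = 0"
      by simp_all
    then show "f x = 0" using b by (simp add: complex_eq_iff)
  qed simp
  show "cvec.span (of_real_form ` (Basis :: 'a set)) = UNIV"
  proof -
    have "v \<in> cvec.span (of_real_form ` Basis)" for v :: "'a \<times> 'a"
      by (subst complex_basis_coordinates) (intro cvec.span_sum cvec.span_scale cvec.span_base imageI)
    then show ?thesis by blast
  qed
qed

global_interpretation cpair: finite_dimensional_vector_space_pair
  cscale "of_real_form ` (Basis :: 'a::euclidean_space set)"
  cscale "of_real_form ` (Basis :: 'b::euclidean_space set)" ..

lemma complex_dim_image:
  fixes f :: "'a::euclidean_space \<times> 'a \<Rightarrow> 'b::euclidean_space \<times> 'b"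
  assumes "complex_linear f" "cvec.subspace S" "\<And>x. x \<in> S \<Longrightarrow> f x = 0 \<Longrightarrow> x = 0"
  shows "cvec.dim (f ` S) = cvec.dim S"
proof (rule cpair.dim_image_eq)
  show "Vector_Spaces.linear cscale cscale f" using assms(1) by (simp add: complex_linear_iff)
  have "linear f" using assms(1) by (rule complex_linear_imp_linear)
  then have "inj_on f S"
    using assms complex_subspace_imp_subspace[OF assms(2)]
    by (simp add: linear_inj_on_iff_eq_0)
  then show "inj_on f (cvec.span S)"
    using assms(2) by (simp add: cvec.span_eq_iff[THEN iffD2])
qed

lemma has_derivative_inverse_left:
  assumes "(f has_derivative F) (at x)" "(g has_derivative G) (at (f x))" "open U" "x \<in> U"
    and "\<And>y. y \<in> U \<Longrightarrow> g (f y) = y"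
  shows "G (F v) = v"
proof -
  have "((\<lambda>y. g (f y)) has_derivative (\<lambda>v. G (F v))) (at x)"
    using diff_chain_at[OF assms(1,2)] by (simp add: o_def)
  moreover have "((\<lambda>y. g (f y)) has_derivative (\<lambda>v. v)) (at x)"
    by (rule has_derivative_transform_within_open[OF has_derivative_ident assms(3,4)])
      (simp add: assms(5))
  ultimately have "(\<lambda>v. G (F v)) = (\<lambda>v. v)" by (rule has_derivative_unique)
  then show ?thesis by (rule fun_cong)
qed

text \<open>The derivative of the transition map between two charts at a common point is a
  complex-linear injection of one model space \<open>E\<close> into the other. By symmetry the
  dimension is well defined, which the \<open>THE\<close> in \<open>complex_dimension\<close>
  requires.\<close>

lemma complex_submanifold_dim_le:
  fixes S :: "('a::euclidean_space \<times> 'a) set"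
  assumes "complex_submanifold S d" "complex_submanifold S d'" "x \<in> S"
  shows "d \<le> d'"
proof -
  obtain U W f g E where c: "open U" "x \<in> U" "open W" "homeomorphism U W f g"
    "holomorphic_map_on f U" "holomorphic_map_on g W"
    "cvec.subspace E" "cvec.dim E = d" "f ` (S \<inter> U) = E \<inter> W"
    using assms(1,3) unfolding complex_submanifold_def by meson
  obtain U' W' f' g' E' where c': "open U'" "x \<in> U'" "open W'" "homeomorphism U' W' f' g'"
    "holomorphic_map_on f' U'" "holomorphic_map_on g' W'"
    "cvec.subspace E'" "cvec.dim E' = d'" "f' ` (S \<inter> U') = E' \<inter> W'"
    using assms(2,3) unfolding complex_submanifold_def by meson
  note hom = homeomorphism_apply1[OF c(4)] homeomorphism_apply2[OF c(4)]
    homeomorphism_image1[OF c(4)] homeomorphism_image2[OF c(4)]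
  note hom' = homeomorphism_apply1[OF c'(4)] homeomorphism_apply2[OF c'(4)]
    homeomorphism_image1[OF c'(4)] homeomorphism_image2[OF c'(4)]
  have fx: "f x \<in> W" "g (f x) = x" using hom c(2) by auto
  have f'x: "f' x \<in> W'" using hom' c'(2) by auto
  obtain F where F: "(f has_derivative F) (at x)"
    using c(2,5) unfolding holomorphic_map_on_def by blast
  obtain G where G: "(g has_derivative G) (at (f x))" "\<And>c v. G (cscale c v) = cscale c (G v)"
    using fx c(6) unfolding holomorphic_map_on_def by blast
  obtain F' where F': "(f' has_derivative F') (at x)" "\<And>c v. F' (cscale c v) = cscale c (F' v)"
    using c'(2,5) unfolding holomorphic_map_on_def by blast
  obtain G' where G': "(g' has_derivative G') (at (f' x))"
    using f'x c'(6) unfolding holomorphic_map_on_def by blast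
  have inv1: "F (G v) = v" for v
    by (rule has_derivative_inverse_left[OF G(1) _ \<open>open W\<close> fx(1)]) (use F fx hom in auto)
  have inv2: "G' (F' v) = v" for v
    by (rule has_derivative_inverse_left[OF F'(1) G' \<open>open U'\<close> c'(2)]) (use hom' in auto)
  have lin: "linear F" "linear G" "linear F'" "linear G'"
    using F G(1) F'(1) G' by (auto dest: has_derivative_linear)
  have T: "complex_linear (\<lambda>v. F' (G v))"
    using lin G(2) F'(2) by (intro complex_linearI) (simp_all add: linear_add)
  \<comment> \<open>The straight line through \<open>f x\<close> in direction e stays in the model
    space, so \<open>g\<close> maps it into \<open>S\<close> and \<open>f'\<close> then maps it into
    \<open>E'\<close>; its velocity there is \<open>F' (G e)\<close>.\<close>
  have "F' (G e) \<in> E'" if e: "e \<in> E" for e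
  proof (rule vector_derivative_in_subspace[OF complex_subspace_imp_subspace[OF c'(7)]])
    define \<gamma> where "\<gamma> t = f x + t *\<^sub>R e" for t :: real
    have \<gamma>: "(\<gamma> has_vector_derivative e) (at 0)"
      unfolding \<gamma>_def by (auto intro!: derivative_eq_intros)
    have "(g has_derivative G) (at (\<gamma> 0))" "(f' has_derivative F') (at (g (\<gamma> 0)))"
      using G(1) F'(1) fx by (simp_all add: \<gamma>_def)
    then have "((\<lambda>t. g (\<gamma> t)) has_derivative (\<lambda>h. G (h *\<^sub>R e))) (at 0)"
      using diff_chain_at[OF \<gamma>[unfolded has_vector_derivative_def]] by (simp add: o_def)
    from diff_chain_at[OF this \<open>(f' has_derivative F') (at (g (\<gamma> 0)))\<close>]
    show d: "((\<lambda>t. f' (g (\<gamma> t))) has_vector_derivative F' (G e)) (at 0)"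
      using lin by (simp add: has_vector_derivative_def o_def linear_cmul)
    have "isCont \<gamma> 0" "isCont (\<lambda>t. g (\<gamma> t)) 0"
      using \<gamma> \<open>((\<lambda>t. g (\<gamma> t)) has_derivative _) (at 0)\<close> has_derivative_continuous
      by (auto simp: has_vector_derivative_def)
    moreover have \<gamma>0: "\<gamma> 0 \<in> W" "g (\<gamma> 0) \<in> U'" using fx c'(2) by (simp_all add: \<gamma>_def)
    ultimately have "eventually (\<lambda>t. \<gamma> t \<in> W) (at 0)" "eventually (\<lambda>t. g (\<gamma> t) \<in> U') (at 0)"
      using topological_tendstoD[OF _ \<open>open W\<close> \<gamma>0(1)] topological_tendstoD[OF _ \<open>open U'\<close> \<gamma>0(2)]
      unfolding isCont_def by blast+
    with \<gamma>0 have "eventually (\<lambda>t. \<gamma> t \<in> W \<and> g (\<gamma> t) \<in> U') (nhds 0)"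
      by (simp add: eventually_nhds_conv_at eventually_conj_iff)
    then show "eventually (\<lambda>t. f' (g (\<gamma> t)) \<in> E') (nhds 0)"
    proof eventually_elim
      case (elim t)
      have fE: "f x \<in> E" using c(2,9) \<open>x \<in> S\<close> by blast
      have "\<gamma> t \<in> E"
        using e fE complex_subspace_imp_subspace[OF c(7)] unfolding \<gamma>_def
        by (intro subspace_add subspace_scale)
      with elim have "\<gamma> t \<in> f ` (S \<inter> U)" using c(9) by blast
      then obtain s where "s \<in> S" "s \<in> U" "\<gamma> t = f s" by blast
      then have "g (\<gamma> t) \<in> S" using hom by simp
      with elim show ?case using c'(9) by blast
    qed
  qed
  then have "(\<lambda>v. F' (G v)) ` E \<subseteq> E'" by blast
  then have "cvec.dim ((\<lambda>v. F' (G v)) ` E) \<le> cvec.dim E'" by (rule cfin.dim_subset)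
  moreover have "cvec.dim ((\<lambda>v. F' (G v)) ` E) = cvec.dim E"
  proof (rule complex_dim_image[OF T c(7)])
    fix v assume "F' (G v) = 0"
    then have "F (G' (F' (G v))) = 0" using lin by (simp add: linear_0)
    then show "v = 0" by (simp add: inv1 inv2)
  qed
  ultimately show ?thesis using c(8) c'(8) by simp
qed

text \<open>Nonemptiness matters because the empty set is vacuously a submanifold of every
  dimension.\<close>

lemma complex_dimension_eq:
  fixes S :: "('a::euclidean_space \<times> 'a) set"
  assumes "complex_submanifold S d" "S \<noteq> {}"
  shows "complex_dimension S = d"
proof -
  obtain x where "x \<in> S" using assms(2) by blast
  then have "d' = d" if "complex_submanifold S d'" for d'
    using complex_submanifold_dim_le[OF assms(1) that] complex_submanifold_dim_le[OF that assms(1)]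
    by fastforce
  with assms(1) show ?thesis
    unfolding complex_dimension_def by (rule the_equality)
qed

locale complexified_lie_algebra = euclidean_lie_algebra br
  for br :: "'a::euclidean_space \<Rightarrow> 'a \<Rightarrow> 'a"
begin

lemma cbr_cscale_left: "cbr br (cscale c v) w = cscale c (cbr br v w)"
  by (simp add: cbr_def cscale_def br.scaleR_left br.diff_left br.add_left algebra_simps)

lemma cbr_cscale_right: "cbr br v (cscale c w) = cscale c (cbr br v w)"
  by (simp add: cbr_def cscale_def br.scaleR_right br.diff_right br.add_right algebra_simps)

sublocale C: euclidean_lie_algebra "cbr br"
proof (rule euclidean_lie_algebra.intro)
  have "bilinear (cbr br)"
    unfolding bilinear_def
    by (auto intro!: linearI simp: cbr_def br.scaleR_left br.scaleR_right br.add_left br.add_right algebra_simps)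
  then show "bounded_bilinear (cbr br)" by (simp add: bilinear_conv_bounded_bilinear)
  have "lie_algebra scaleR br"
    using jacobi by unfold_locales (simp_all add: br.add_left br.add_right br.scaleR_left br.scaleR_right
        br_self scaleR_add_left scaleR_add_right)
  then interpret complexification: lie_algebra cscale "cbr br" by (rule lie_algebra_cbr)
  show "cbr br x x = 0" for x by (fact complexification.br_self)
  show "cbr br x (cbr br y z) + cbr br y (cbr br z x) + cbr br z (cbr br x y) = 0" for x y z
    by (fact complexification.jacobi)
qed

lemma complex_linear_cbr: "complex_linear (cbr br v)"
  by (rule complex_linearI) (simp_all add: C.br.add_right cbr_cscale_right)

lemma complex_linear_cbr_left: "complex_linear (\<lambda>v. cbr br v w)"
  by (rule complex_linearI) (simp_all add: C.br.add_left cbr_cscale_left)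

lemma exp_op_cscale: "exp_op (cbr br u) (cscale c v) = cscale c (exp_op (cbr br u) v)"
  by (rule exp_op_intertwine[OF bounded_linear_cscale C.linear_br C.linear_br, symmetric])
    (simp add: cbr_cscale_right)

lemma complex_linear_Int_group: "g \<in> Int_group (cbr br) \<Longrightarrow> complex_linear g"
proof (induction rule: Int_group.induct)
  case (Int_step g x)
  have "complex_linear (exp_op (cbr br x))"
    by (rule complex_linearI) (simp_all add: exp_op_cscale linear_add[OF linear_exp_op[OF C.linear_br]])
  from complex_linear_compose[OF this Int_step.IH] show ?case by (simp add: o_def)
qed (simp add: complex_linearI)

lemma exp_op_eigenvector_complex:
  assumes "cbr br u v = cscale c v"
  shows "exp_op (cbr br u) v = cscale (exp c) v"
proof -
  have "(cbr br u ^^ n) v = cscale (c ^ n) v" for n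
    by (induction n) (simp_all add: assms cbr_cscale_right mult.commute)
  then have "(\<lambda>n. cscale (c ^ n /\<^sub>R fact n) v) sums exp_op (cbr br u) v"
    using sums_exp_op[OF C.linear_br, of u v]
    by (simp add: scaleR_conv_of_real flip: cscale_of_real)
  moreover have "bounded_linear (\<lambda>c. cscale c v)"
    by (rule linear_conv_bounded_linear[THEN iffD1]) (auto intro!: linearI simp: cscale_def algebra_simps)
  from bounded_linear.sums[OF this exp_converges]
  have "(\<lambda>n. cscale (c ^ n /\<^sub>R fact n) v) sums cscale (exp c) v" .
  ultimately show ?thesis by (rule sums_unique2)
qed

lemma cbr_of_real_form: "cbr br (of_real_form x) (of_real_form y) = of_real_form (br x y)"
  by (simp add: cbr_def of_real_form_def br.zero_left br.zero_right)

lemma cbr_of_real_form_left: "cbr br (of_real_form x) v = (br x (fst v), br x (snd v))"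
  by (simp add: cbr_def of_real_form_def br.zero_left)

lemma bounded_linear_of_real_form: "bounded_linear of_real_form"
  unfolding of_real_form_def by (intro bounded_linear_Pair bounded_linear_ident bounded_linear_zero)

lemma exp_op_of_real_form: "exp_op (cbr br (of_real_form u)) (of_real_form y) = of_real_form (exp_op (br u) y)"
  by (rule exp_op_intertwine[OF bounded_linear_of_real_form linear_br C.linear_br, symmetric])
    (simp add: cbr_of_real_form)

lemma Int_group_of_real_form:
  assumes "g \<in> Int_group br"
  shows "\<exists>g'\<in>Int_group (cbr br). \<forall>y. g' (of_real_form y) = of_real_form (g y)"
  using assms
proof (induction rule: Int_group.induct)
  case Int_id
  show ?case by (rule bexI[OF _ Int_group.Int_id]) simp
next
  case (Int_step g x)
  then obtain g' where "g' \<in> Int_group (cbr br)" "\<forall>y. g' (of_real_form y) = of_real_form (g y)" by blast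
  then show ?case
    by (intro bexI[OF _ Int_group.Int_step[of g' _ "of_real_form x"]]) (simp_all add: exp_op_of_real_form)
qed

end

section \<open>Transversal slices and orbits as submanifolds\<close>

context complexified_lie_algebra
begin

abbreviation (input) "adC \<equiv> cbr br"

lemma complex_subspace_range: "cvec.subspace (range (adC x))"
  by (rule complex_subspace_image[OF complex_linear_cbr cvec.subspace_UNIV])

lemma range_cbr_dim_Int_group:
  assumes "g \<in> Int_group adC"
  shows "cvec.dim (range (adC (g x))) = cvec.dim (range (adC x))"
  unfolding C.range_br_Int_group[OF assms]
proof (rule complex_dim_image[OF complex_linear_Int_group[OF assms] complex_subspace_range])
  fix v assume "g v = 0"
  moreover obtain g' where "g' \<in> Int_group adC" "g' (g v) = v" using C.Int_group_inverse[OF assms] by metis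
  ultimately show "v = 0" using linear_0[OF C.linear_Int_group] by metis
qed

lemma cbr_in_range: "adC v x \<in> range (adC x)"
proof -
  have "adC v x = adC x (- v)" using C.br_antisym[of x v] by (simp add: C.br.minus_right)
  then show ?thesis by blast
qed

text \<open>The section \<sigma> is linear on the whole space, though it is prescribed only on
  [x, g]. Thus w \<mapsto> [\<sigma> w, x] is a projection onto [x, g], and its kernel will be the
  complement in which the slice lives.\<close>

lemma ad_right_inverse:
  obtains \<sigma> where "complex_linear \<sigma>" "\<And>r. r \<in> range (adC x) \<Longrightarrow> adC (\<sigma> r) x = r"
proof -
  obtain \<sigma> where \<sigma>: "Vector_Spaces.linear cscale cscale \<sigma>" "\<forall>r\<in>range (\<lambda>v. adC v x). adC (\<sigma> r) x = r"
    using clin.linear_exists_right_inverse_on[of "\<lambda>v. adC v x" UNIV] complex_linear_cbr_left[of x]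
    by (auto simp: complex_linear_iff)
  have "range (adC x) \<subseteq> range (\<lambda>v. adC v x)"
  proof
    fix r assume "r \<in> range (adC x)"
    then obtain v where "r = adC x v" by blast
    then have "r = adC (- v) x" using C.br_antisym[of v x] by (simp add: C.br.minus_left)
    then show "r \<in> range (\<lambda>v. adC v x)" by blast
  qed
  with \<sigma>(2) have "adC (\<sigma> r) x = r" if "r \<in> range (adC x)" for r using that by blast
  with \<sigma>(1) show ?thesis using that[of \<sigma>] unfolding complex_linear_iff by blast
qed

text \<open>Here [x + z, \<sigma> r] = [z, \<sigma> r] - r, a perturbation of -r; for small z the
  map r \<mapsto> [x + z, \<sigma> r] therefore stays injective on [x, g], with a uniform
  bound.\<close>

lemma perturbed_right_inverse:
  assumes \<sigma>: "linear \<sigma>" "\<And>r. r \<in> range (adC x) \<Longrightarrow> adC (\<sigma> r) x = r"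
  obtains \<delta> where "\<delta> > 0"
    "\<And>z r. norm z < \<delta> \<Longrightarrow> r \<in> range (adC x) \<Longrightarrow> norm r \<le> 2 * norm (adC (x + z) (\<sigma> r))"
proof -
  obtain K where K: "K > 0" "\<And>a b. norm (adC a b) \<le> norm a * norm b * K"
    using C.br.pos_bounded by blast
  obtain S where S: "S > 0" "\<And>w. norm (\<sigma> w) \<le> norm w * S"
    using bounded_linear.pos_bounded[OF \<sigma>(1)[unfolded linear_conv_bounded_linear]] by blast
  \<comment> \<open>K bounds the bracket and S bounds \<sigma>, so for norm z below 1 / (2 K S) the
    perturbation costs at most half of the norm of r.\<close>
  have "norm r \<le> 2 * norm (adC (x + z) (\<sigma> r))"
    if z: "norm z < 1 / (2 * K * S)" and r: "r \<in> range (adC x)" for z r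
  proof -
    have "norm (adC z (\<sigma> r)) \<le> norm z * norm (\<sigma> r) * K" by (rule K(2))
    also have "\<dots> \<le> norm z * (norm r * S) * K"
      using S(2)[of r] K(1) by (intro mult_right_mono mult_left_mono) auto
    also have "\<dots> = norm r * (norm z * (K * S))" by (simp add: ac_simps)
    also have "\<dots> \<le> norm r * (1/2)"
      using z K(1) S(1) by (intro mult_left_mono) (simp_all add: field_simps)
    finally have "2 * norm (adC z (\<sigma> r)) \<le> norm r" by simp
    moreover have "adC (x + z) (\<sigma> r) = adC z (\<sigma> r) - r"
      using \<sigma>(2)[OF r] C.br_antisym[of x "\<sigma> r"] by (simp add: C.br.add_left)
    then have "norm r \<le> norm (adC z (\<sigma> r)) + norm (adC (x + z) (\<sigma> r))"
      using norm_triangle_ineq4[of "adC z (\<sigma> r)" "adC (x + z) (\<sigma> r)"] by simp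
    ultimately show ?thesis by simp
  qed
  moreover have "1 / (2 * K * S) > 0" using K(1) S(1) by simp
  ultimately show ?thesis using that by blast
qed

lemma dim_perturbed_right_inverse:
  assumes \<sigma>: "complex_linear \<sigma>"
    and lower: "\<And>r. r \<in> range (adC x) \<Longrightarrow> norm r \<le> 2 * norm (adC y (\<sigma> r))"
  defines "\<tau> \<equiv> \<lambda>r. adC y (\<sigma> r)"
  shows "cvec.subspace (\<tau> ` range (adC x))" "cvec.dim (\<tau> ` range (adC x)) = cvec.dim (range (adC x))"
    "\<tau> ` range (adC x) \<subseteq> range (adC y)"
proof -
  have "complex_linear \<tau>"
    unfolding \<tau>_def by (rule complex_linear_compose[OF complex_linear_cbr \<sigma>(1)])
  then show "cvec.subspace (\<tau> ` range (adC x))"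
    by (rule complex_subspace_image[OF _ complex_subspace_range])
  show "cvec.dim (\<tau> ` range (adC x)) = cvec.dim (range (adC x))"
  proof (rule complex_dim_image[OF \<open>complex_linear \<tau>\<close> complex_subspace_range])
    show "r = 0" if "r \<in> range (adC x)" "\<tau> r = 0" for r
      using lower[OF that(1)] that(2) by (simp add: \<tau>_def)
  qed
  show "\<tau> ` range (adC x) \<subseteq> range (adC y)" by (auto simp: \<tau>_def)
qed

text \<open>Rank is lower semicontinuous: some point of the orbit lies close enough to x for its
  ad-range to contain an isomorphic copy of [x, g]. Constancy of the rank on the orbit transfers
  this to y.\<close>

lemma rank_le_of_closure:
  assumes "x \<in> closure (Int_orbit adC y)"
  shows "cvec.dim (range (adC x)) \<le> cvec.dim (range (adC y))"
proof -
  obtain \<sigma> where \<sigma>: "complex_linear \<sigma>" "\<And>r. r \<in> range (adC x) \<Longrightarrow> adC (\<sigma> r) x = r"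
    using ad_right_inverse[of x] by metis
  obtain \<delta> where \<delta>: "\<delta> > 0"
    "\<And>z r. norm z < \<delta> \<Longrightarrow> r \<in> range (adC x) \<Longrightarrow> norm r \<le> 2 * norm (adC (x + z) (\<sigma> r))"
    using perturbed_right_inverse[OF complex_linear_imp_linear[OF \<sigma>(1)] \<sigma>(2)] by metis
  obtain y' where y': "y' \<in> Int_orbit adC y" "dist y' x < \<delta>"
    using assms \<delta>(1) unfolding closure_approachable by blast
  have "norm r \<le> 2 * norm (adC y' (\<sigma> r))" if "r \<in> range (adC x)" for r
    using \<delta>(2)[of "y' - x" r] that y'(2) by (simp add: dist_norm)
  from dim_perturbed_right_inverse(2,3)[OF \<sigma>(1) this]
  have "cvec.dim (range (adC x)) \<le> cvec.dim (range (adC y'))" by (metis cfin.dim_subset)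
  moreover obtain g where "g \<in> Int_group adC" "y' = g y" using y'(1) unfolding Int_orbit_def by blast
  ultimately show ?thesis using range_cbr_dim_Int_group by simp
qed

text \<open>A first-order lower bound against a second-order upper bound. On the slice, the
  transverse part of 2 z - [h, z] is at least \<open>e * norm z\<close> by regularity; if x + z
  satisfied both hypotheses it would be O(norm z squared).\<close>

lemma transversal_slice:
  assumes hx: "adC h x = 2 *\<^sub>R x"
    and regular: "\<And>z. adC h z - 2 *\<^sub>R z \<in> range (adC x) \<Longrightarrow> z \<in> range (adC x)"
    and \<sigma>: "complex_linear \<sigma>" "\<And>r. r \<in> range (adC x) \<Longrightarrow> adC (\<sigma> r) x = r"
  obtains \<epsilon> where "\<epsilon> > 0" "\<And>z. adC (\<sigma> z) x = 0 \<Longrightarrow> norm z < \<epsilon> \<Longrightarrow> x + z \<in> range (adC (x + z)) \<Longrightarrow>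
    cvec.dim (range (adC (x + z))) \<le> cvec.dim (range (adC x)) \<Longrightarrow> z = 0"
proof -
  define R where "R = range (adC x)"
  define P where "P w = adC (\<sigma> w) x" for w
  define Q where "Q w = w - P w" for w
  have PR: "P w \<in> R" for w
    unfolding P_def R_def by (rule cbr_in_range)
  have P_id: "P r = r" if "r \<in> R" for r using \<sigma>(2) that by (simp add: P_def R_def)
  have lin\<sigma>: "linear \<sigma>" by (rule complex_linear_imp_linear[OF \<sigma>(1)])
  have linP: "linear P" unfolding P_def using linear_compose[OF lin\<sigma> C.linear_br_left] by (simp add: o_def)
  have linQ: "linear Q" unfolding Q_def by (rule linear_compose_sub[OF _ linP]) (simp add: linear_iff)
  have QR: "z \<in> R" if "Q z = 0" for z using PR[of z] that by (simp add: Q_def)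
  define N where "N = {z. P z = 0}"
  \<comment> \<open>\<open>Q\<close> projects onto the complement \<open>N\<close> along [x, g], so
    on \<open>N\<close> the map \<open>T\<close> represents 2 - ad h on the quotient by [x, g].
    Regularity makes it injective there, hence bounded below.\<close>
  define T where "T z = Q (2 *\<^sub>R z - adC h z)" for z
  have linT: "linear T"
    unfolding T_def
    by (rule linearI) (simp_all add: C.br.add_right C.br.scaleR_right algebra_simps
        flip: linear_add[OF linQ] linear_cmul[OF linQ])
  have "subspace N" unfolding N_def by (rule linear_subspace_kernel[OF linP])
  moreover have "\<forall>z\<in>N. T z = 0 \<longrightarrow> z = 0"
  proof (intro ballI impI)
    fix z assume "z \<in> N" "T z = 0"
    then have "2 *\<^sub>R z - adC h z \<in> R" using QR by (simp add: T_def)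
    then have "- (2 *\<^sub>R z - adC h z) \<in> R"
      unfolding R_def by (intro subspace_neg complex_subspace_imp_subspace complex_subspace_range)
    then have "z \<in> R" using regular[of z] by (simp add: R_def)
    with P_id \<open>z \<in> N\<close> show "z = 0" by (simp add: N_def)
  qed
  ultimately obtain e where e: "e > 0" "\<And>z. z \<in> N \<Longrightarrow> e * norm z \<le> norm (T z)"
    using injective_imp_isometric[OF closed_subspace _ _, of N T] linT
    by (auto simp: linear_conv_bounded_linear)
  obtain K where K: "K > 0" "\<And>a b. norm (adC a b) \<le> norm a * norm b * K"
    using C.br.pos_bounded by blast
  obtain S where S: "S > 0" "\<And>w. norm (\<sigma> w) \<le> norm w * S"
    using bounded_linear.pos_bounded[OF lin\<sigma>[unfolded linear_conv_bounded_linear]] by blast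
  obtain L where L: "L > 0" "\<And>w. norm (Q w) \<le> norm w * L"
    using bounded_linear.pos_bounded[OF linQ[unfolded linear_conv_bounded_linear]] by blast
  define M where "M = 2 + norm h * K"
  have M: "M > 0" using K(1) by (simp add: M_def add_pos_nonneg)
  obtain \<delta> where \<delta>: "\<delta> > 0"
    "\<And>z r. norm z < \<delta> \<Longrightarrow> r \<in> range (adC x) \<Longrightarrow> norm r \<le> 2 * norm (adC (x + z) (\<sigma> r))"
    using perturbed_right_inverse[OF lin\<sigma> \<sigma>(2)] by metis
  \<comment> \<open>The first bound keeps \<tau> injective; the second is what makes the final
    quadratic estimate 2 L K S M (norm z)^2 fall below e norm z.\<close>
  define \<epsilon> where "\<epsilon> = min \<delta> (e / (2 * L * K * S * M))"
  have "z = 0" if z: "P z = 0" "norm z < \<epsilon>" and mem: "x + z \<in> range (adC (x + z))"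
    and dim: "cvec.dim (range (adC (x + z))) \<le> cvec.dim R" for z
  proof (rule ccontr)
    assume "z \<noteq> 0"
    have z1: "norm z < \<delta>" and z2: "norm z * (2 * L * K * S * M) < e"
      using z(2) K(1) S(1) L(1) M by (auto simp: \<epsilon>_def field_simps)
    define \<tau> where "\<tau> r = adC (x + z) (\<sigma> r)" for r
    have \<tau>: "\<tau> r = adC z (\<sigma> r) - r" if "r \<in> R" for r
      using P_id[OF that] C.br_antisym[of x "\<sigma> r"] by (simp add: \<tau>_def P_def C.br.add_left)
    have B: "norm (adC z (\<sigma> r)) \<le> norm z * norm r * (S * K)" for r
    proof -
      have "norm (adC z (\<sigma> r)) \<le> norm z * norm (\<sigma> r) * K" by (rule K(2))
      also have "\<dots> \<le> norm z * (norm r * S) * K"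
        using S(2)[of r] K(1) by (intro mult_right_mono mult_left_mono) auto
      finally show ?thesis by (simp add: ac_simps)
    qed
    have lower: "norm r \<le> 2 * norm (\<tau> r)" if "r \<in> R" for r
      using \<delta>(2)[OF z1] that by (simp add: R_def \<tau>_def)
    have \<tau>_fun: "(\<lambda>r. adC (x + z) (\<sigma> r)) = \<tau>" by (simp add: \<tau>_def fun_eq_iff)
    note \<tau>_dim = dim_perturbed_right_inverse[of \<sigma> x "x + z", OF \<sigma>(1), unfolded \<tau>_fun, folded R_def]
    \<comment> \<open>This is where the rank hypothesis enters: the perturbed copy of [x, g] already
      has the maximal dimension allowed for [x + z, g], so it is all of it.\<close>
    have \<tau>R: "\<tau> ` R = range (adC (x + z))"
    proof (rule cfin.subspace_dim_equal[OF _ complex_subspace_range])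
      show "cvec.subspace (\<tau> ` R)" using lower by (intro \<tau>_dim(1)) (simp add: \<tau>_def)
      show "\<tau> ` R \<subseteq> range (adC (x + z))" using lower by (intro \<tau>_dim(3)) (simp add: \<tau>_def)
      show "cvec.dim (range (adC (x + z))) \<le> cvec.dim (\<tau> ` R)"
        using dim \<tau>_dim(2) lower by (simp add: \<tau>_def)
    qed
    \<comment> \<open>Because [h, x] = 2 x, the terms in x cancel and w also equals 2 (x + z) -
      [h, x + z], which is tangent to the orbit at x + z.\<close>
    define w where "w = 2 *\<^sub>R z - adC h z"
    have "w = 2 *\<^sub>R (x + z) - adC h (x + z)"
      using hx by (simp add: w_def C.br.add_right scaleR_add_right)
    also have "\<dots> \<in> range (adC (x + z))"
    proof -
      have "adC h (x + z) = adC (x + z) (- h)"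
        using C.br_antisym[of h "x + z"] by (simp add: C.br.minus_right)
      then show ?thesis
        using mem by (intro subspace_diff subspace_scale complex_subspace_imp_subspace complex_subspace_range) auto
    qed
    finally obtain r where r: "r \<in> R" "w = \<tau> r" using \<tau>R by blast
    have "norm w \<le> 2 * norm z + norm h * norm z * K"
      using norm_triangle_ineq4[of "2 *\<^sub>R z" "adC h z"] K(2)[of h z] by (simp add: w_def)
    then have "norm w \<le> M * norm z" by (simp add: M_def algebra_simps)
    with lower[OF r(1)] r(2) have rz: "norm r \<le> 2 * M * norm z" by simp
    \<comment> \<open>With w = [z, \<sigma> r] - r, the projection removes r and leaves only
      [z, \<sigma> r], where both factors are of order norm z.\<close>
    have "Q r = 0" using P_id[OF r(1)] by (simp add: Q_def)
    then have "Q w = Q (adC z (\<sigma> r))"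
      using r \<tau>[OF r(1)] linear_diff[OF linQ] by simp
    then have "T z = Q (adC z (\<sigma> r))" by (simp add: T_def w_def)
    then have "norm (T z) \<le> norm z * norm r * (S * K) * L"
      using order_trans[OF L(2) mult_right_mono[OF B[of r]]] L(1) by simp
    also have "\<dots> \<le> norm z * (2 * M * norm z) * (S * K) * L"
      using rz S(1) K(1) L(1) by (intro mult_right_mono mult_left_mono) auto
    also have "\<dots> = norm z * (norm z * (2 * L * K * S * M))" by (simp add: ac_simps)
    also have "\<dots> < norm z * e" using z2 \<open>z \<noteq> 0\<close> by simp
    finally show False using e(2)[of z] z(1) by (simp add: N_def mult.commute)
  qed
  moreover have "\<epsilon> > 0" using e(1) K(1) S(1) L(1) M \<delta>(1) by (simp add: \<epsilon>_def)
  ultimately show ?thesis using that[of \<epsilon>] by (simp add: P_def R_def)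
qed

section \<open>Holomorphic charts adapted to an orbit\<close>

lemma endo_of_ad_complex:
  "linear (\<lambda>u. endo_of (adC u))"
  "endo_of (adC (cscale c u)) = endo_of (cscale c) * endo_of (adC u)"
  "endo_of (adC u) * endo_of (cscale c) = endo_of (cscale c) * endo_of (adC u)"
proof -
  note [simp] = C.linear_br linear_cscale
  show "linear (\<lambda>u. endo_of (adC u))"
    by (intro linearI endo_eqI) (simp_all add: endo_apply.add_left endo_apply.scaleR_left C.br.add_left C.br.scaleR_left)
  show "endo_of (adC (cscale c u)) = endo_of (cscale c) * endo_of (adC u)"
    by (rule endo_eqI) (simp add: cbr_cscale_left)
  show "endo_of (adC u) * endo_of (cscale c) = endo_of (cscale c) * endo_of (adC u)"
    by (rule endo_eqI) (simp add: cbr_cscale_right)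
qed

text \<open>With P w = [\<sigma> w, x] this is exp(ad \<sigma>(P w)) applied to x + (w - P w): the
  part of w in [x, g] moves along the orbit, the rest displaces x inside the slice. Its derivative
  at 0 is P + (id - P), the identity.\<close>

definition slice_map :: "('a \<times> 'a \<Rightarrow> 'a \<times> 'a) \<Rightarrow> 'a \<times> 'a \<Rightarrow> 'a \<times> 'a \<Rightarrow> 'a \<times> 'a" where
  "slice_map \<sigma> x w = exp_op (adC (\<sigma> (adC (\<sigma> w) x))) (x + (w - adC (\<sigma> w) x))"

lemma slice_map_derivative:
  assumes \<sigma>: "complex_linear \<sigma>" "\<And>r. r \<in> range (adC x) \<Longrightarrow> adC (\<sigma> r) x = r"
  obtains F' where "\<And>w. (slice_map \<sigma> x has_derivative blinfun_apply (F' w)) (at w)"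
    "continuous_on UNIV F'" "F' 0 = id_blinfun"
    "\<And>w c h. blinfun_apply (F' w) (cscale c h) = cscale c (blinfun_apply (F' w) h)"
proof -
  define P where "P w = adC (\<sigma> w) x" for w
  define Q where "Q w = w - P w" for w
  define A where "A w = endo_of (adC (\<sigma> (P w)))" for w
  have cP: "complex_linear P" unfolding P_def by (rule complex_linear_compose[OF complex_linear_cbr_left \<sigma>(1)])
  have cQ: "complex_linear Q" unfolding Q_def
    by (rule complex_linearI) (simp_all add: complex_linear_add[OF cP] complex_linear_scale[OF cP] cvec.scale_right_diff_distrib)
  have "linear (\<lambda>w. \<sigma> (P w))"
    by (rule complex_linear_imp_linear[OF complex_linear_compose[OF \<sigma>(1) cP]])
  then have "linear A"
    unfolding A_def by (rule linear_compose[OF _ endo_of_ad_complex(1), unfolded o_def])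
  then have bA: "bounded_linear A" by (simp add: linear_conv_bounded_linear)
  have bQ: "bounded_linear Q" using complex_linear_imp_linear[OF cQ] by (simp add: linear_conv_bounded_linear)
  have slice: "slice_map \<sigma> x = (\<lambda>w. endo_apply (exp (A w)) (x + Q w))"
    by (simp add: fun_eq_iff slice_map_def P_def Q_def A_def exp_op_eq_exp C.linear_br)
  define D where "D w h = endo_apply (exp (A w)) (Q h) + endo_apply (exp_deriv (A w) (A h)) (x + Q w)" for w h
  have D: "(slice_map \<sigma> x has_derivative D w) (at w)" for w
  proof -
    have 1: "((\<lambda>w. exp (A w)) has_derivative (\<lambda>h. exp_deriv (A w) (A h))) (at w)"
      using diff_chain_at[OF bounded_linear_imp_has_derivative[OF bA] has_derivative_exp_banach_algebra]
      by (simp add: o_def)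
    have 2: "((\<lambda>w. x + Q w) has_derivative Q) (at w)"
      using has_derivative_add[OF has_derivative_const bounded_linear_imp_has_derivative[OF bQ]] by simp
    from endo_apply.FDERIV[OF 1 2] show ?thesis unfolding slice D_def .
  qed
  have bD: "bounded_linear (D w)" for w by (rule has_derivative_bounded_linear[OF D])
  define F' where "F' w = Blinfun (D w)" for w
  have F': "blinfun_apply (F' w) = D w" for w
    by (simp add: F'_def bounded_linear_Blinfun_apply[OF bD])
  have expcont: "continuous_on UNIV (exp :: ('a \<times> 'a) endo \<Rightarrow> _)"
    by (intro continuous_at_imp_continuous_on ballI has_derivative_continuous[OF has_derivative_exp_banach_algebra])
  have contA: "continuous_on UNIV A" "continuous_on UNIV Q"
    using bA bQ by (auto intro: linear_continuous_on)
  have "continuous_on UNIV (\<lambda>w. D w i)" for i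
    unfolding D_def
    by (intro continuous_on_add endo_apply.continuous_on blinfun.continuous_on continuous_on_const contA
        continuous_on_compose2[OF expcont contA(1)] continuous_on_compose2[OF continuous_on_exp_deriv contA(1)]) auto
  then have "isCont F' w" for w
    unfolding continuous_on_eq_continuous_at[OF open_UNIV]
    by (intro continuous_blinfun_componentwiseI1) (simp only: F', blast)
  then have 2: "continuous_on UNIV F'" by (intro continuous_at_imp_continuous_on ballI)
  have 3: "F' 0 = id_blinfun"
  proof (rule blinfun_eqI)
    fix h
    have "P h \<in> range (adC x)" unfolding P_def by (rule cbr_in_range)
    then have PP: "P (P h) = P h" using \<sigma>(2) by (simp add: P_def)
    have "A 0 = 0" "Q 0 = 0"
      using linear_0[OF \<open>linear A\<close>] linear_0[OF bounded_linear.linear[OF bQ]] .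
    then have "D 0 h = Q h + endo_apply (A h) x" by (simp add: D_def exp_deriv_0)
    also have "endo_apply (A h) x = P (P h)" by (simp add: A_def P_def C.linear_br)
    finally show "blinfun_apply (F' 0) h = blinfun_apply id_blinfun h" by (simp add: F' PP Q_def)
  qed
  have 4: "blinfun_apply (F' w) (cscale c h) = cscale c (blinfun_apply (F' w) h)" for w c h
  proof -
    have Ac: "A (cscale c h) = endo_of (cscale c) * A h"
      by (simp add: A_def complex_linear_scale[OF cP] complex_linear_scale[OF \<sigma>(1)] endo_of_ad_complex(2))
    have "exp_deriv (A w) (A (cscale c h)) = endo_of (cscale c) * exp_deriv (A w) (A h)"
      unfolding Ac by (rule exp_deriv_mult_left) (simp only: A_def endo_of_ad_complex(3))
    moreover have "endo_apply (exp (A w)) (Q (cscale c h)) = cscale c (endo_apply (exp (A w)) (Q h))"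
      using exp_op_cscale by (simp add: A_def complex_linear_scale[OF cQ] exp_op_eq_exp[OF C.linear_br])
    ultimately show ?thesis
      by (simp add: F' D_def cvec.scale_right_distrib linear_cscale)
  qed
  show ?thesis by (rule that[OF D[folded F'] 2 3 4])
qed

text \<open>The inverse function theorem yields a real derivative; as the inverse of a
  complex-linear bijection it is complex linear again.\<close>

lemma holomorphic_inverse:
  assumes "(g has_derivative G) (at y)" "G = inv F" "bij F" "\<And>c h. F (cscale c h) = cscale c (F h)"
  shows "\<exists>D. (g has_derivative D) (at y) \<and> (\<forall>c v. D (cscale c v) = cscale c (D v))"
proof (intro exI conjI allI)
  show "(g has_derivative G) (at y)" by fact
  show "G (cscale c v) = cscale c (G v)" for c v
  proof -
    have "F (cscale c (G v)) = cscale c v"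
      using assms by (simp add: bij_is_surj surj_f_inv_f)
    then show ?thesis using assms(2,3) by (metis bij_is_inj inv_f_f)
  qed
qed

text \<open>The last conclusion speaks of membership in the own ad-range and of rank instead of
  membership in the orbit. Points of the orbit of x satisfy both, which gives a submanifold chart;
  so may points of other orbits, which gives the comparison of orbits by closure and rank.\<close>

lemma orbit_chart:
  assumes hx: "adC h x = 2 *\<^sub>R x"
    and regular: "\<And>z. adC h z - 2 *\<^sub>R z \<in> range (adC x) \<Longrightarrow> z \<in> range (adC x)"
  obtains U V \<Phi> g where "open U" "open V" "x \<in> V" "homeomorphism V U g \<Phi>"
    "holomorphic_map_on g V" "holomorphic_map_on \<Phi> U"
    "\<And>w. w \<in> U \<Longrightarrow> w \<in> range (adC x) \<Longrightarrow> \<Phi> w \<in> Int_orbit adC x"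
    "\<And>w. w \<in> U \<Longrightarrow> \<Phi> w \<in> range (adC (\<Phi> w)) \<Longrightarrow>
      cvec.dim (range (adC (\<Phi> w))) \<le> cvec.dim (range (adC x)) \<Longrightarrow> w \<in> range (adC x)"
proof -
  obtain \<sigma> where \<sigma>: "complex_linear \<sigma>" "\<And>r. r \<in> range (adC x) \<Longrightarrow> adC (\<sigma> r) x = r"
    using ad_right_inverse[of x] by metis
  obtain \<epsilon> where \<epsilon>: "\<epsilon> > 0" "\<And>z. adC (\<sigma> z) x = 0 \<Longrightarrow> norm z < \<epsilon> \<Longrightarrow> x + z \<in> range (adC (x + z)) \<Longrightarrow>
    cvec.dim (range (adC (x + z))) \<le> cvec.dim (range (adC x)) \<Longrightarrow> z = 0"
    using transversal_slice[OF hx regular \<sigma>] by metis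
  obtain F' where F': "\<And>w. (slice_map \<sigma> x has_derivative blinfun_apply (F' w)) (at w)"
    "continuous_on UNIV F'" "F' 0 = id_blinfun"
    "\<And>w c h. blinfun_apply (F' w) (cscale c h) = cscale c (blinfun_apply (F' w) h)"
    using slice_map_derivative[OF \<sigma>] by metis
  define P where "P w = adC (\<sigma> w) x" for w
  have Pr: "P w \<in> range (adC x)" for w
    unfolding P_def by (rule cbr_in_range)
  have P_id: "P r = r" if "r \<in> range (adC x)" for r using \<sigma>(2) that by (simp add: P_def)
  have linP: "linear P" unfolding P_def
    by (rule complex_linear_imp_linear[OF complex_linear_compose[OF complex_linear_cbr_left \<sigma>(1)]])
  define U0 where "U0 = {w. norm (w - P w) < \<epsilon>}"
  have inv0: "id_blinfun o\<^sub>L F' 0 = id_blinfun"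
    unfolding F'(3) by (rule blinfun_eqI) simp
  have "open U0"
    unfolding U0_def
    by (intro open_Collect_less continuous_intros linear_continuous_on linP[unfolded linear_conv_bounded_linear])
  moreover have "0 \<in> U0" using \<epsilon>(1) linear_0[OF linP] by (simp add: U0_def)
  ultimately obtain U V g g' where U: "open U" "U \<subseteq> U0" "0 \<in> U" "open V" "slice_map \<sigma> x 0 \<in> V"
    and hom: "homeomorphism U V (slice_map \<sigma> x) g"
    and g': "\<And>y. y \<in> V \<Longrightarrow> (g has_derivative g' y) (at y)"
      "\<And>y. y \<in> V \<Longrightarrow> g' y = inv (blinfun_apply (F' (g y)))" "\<And>y. y \<in> V \<Longrightarrow> bij (blinfun_apply (F' (g y)))"
    using inverse_function_theorem[OF _ F'(1) continuous_on_subset[OF F'(2) subset_UNIV] _ inv0]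
    by metis
  have "slice_map \<sigma> x 0 = x"
  proof -
    have "\<sigma> 0 = 0" using linear_0[OF complex_linear_imp_linear[OF \<sigma>(1)]] .
    then show ?thesis by (simp add: slice_map_def C.br.zero_left[abs_def] C.br.zero_left)
  qed
  then have xV: "x \<in> V" using U by simp
  have hom': "homeomorphism V U g (slice_map \<sigma> x)" using hom by (rule homeomorphism_symD)
  have hol1: "holomorphic_map_on g V"
    unfolding holomorphic_map_on_def
    using holomorphic_inverse[OF g' F'(4)] by blast
  have hol2: "holomorphic_map_on (slice_map \<sigma> x) U"
    unfolding holomorphic_map_on_def using F'(1,4) by blast
  have orb: "slice_map \<sigma> x w \<in> Int_orbit adC x" if "w \<in> range (adC x)" for w
    using P_id[OF that] C.Int_orbit_exp[OF C.Int_orbit_refl] by (simp add: slice_map_def P_def)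
  have backward: "w \<in> range (adC x)" if "w \<in> U" and mem: "slice_map \<sigma> x w \<in> range (adC (slice_map \<sigma> x w))"
    and dim: "cvec.dim (range (adC (slice_map \<sigma> x w))) \<le> cvec.dim (range (adC x))" for w
  proof -
    \<comment> \<open>The group element \<gamma> is undone: membership in the own ad-range and the
      rank are invariant, so both pass to x + n with n in the slice, and the slice lemma gives n =
      0.\<close>
    define n where "n = w - P w"
    define \<gamma> where "\<gamma> = exp_op (adC (\<sigma> (P w)))"
    have \<gamma>: "\<gamma> \<in> Int_group adC" unfolding \<gamma>_def by (rule C.exp_ad_in_Int_group)
    have y: "slice_map \<sigma> x w = \<gamma> (x + n)" by (simp add: slice_map_def \<gamma>_def n_def P_def)
    obtain \<gamma>' where \<gamma>': "\<And>v. \<gamma>' (\<gamma> v) = v" using C.Int_group_inverse[OF \<gamma>] by metis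
    have "\<gamma> (x + n) \<in> \<gamma> ` range (adC (x + n))" using mem unfolding y C.range_br_Int_group[OF \<gamma>] .
    then have "x + n \<in> range (adC (x + n))" using \<gamma>' by (metis imageE)
    moreover have "cvec.dim (range (adC (x + n))) \<le> cvec.dim (range (adC x))"
      using dim unfolding y range_cbr_dim_Int_group[OF \<gamma>] .
    moreover have "P n = 0" using P_id[OF Pr] linear_diff[OF linP] by (simp add: n_def)
    moreover have "norm n < \<epsilon>" using \<open>w \<in> U\<close> U(2) by (auto simp: U0_def n_def)
    ultimately have "n = 0" using \<epsilon>(2) by (simp add: P_def)
    then have "w = P w" by (simp add: n_def)
    then show ?thesis using Pr by metis
  qed
  show ?thesis
    by (rule that[OF U(1,4) xV hom' hol1 hol2]) (use orb backward in blast)+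
qed

lemma orbit_in_own_range:
  assumes "x \<in> range (adC x)" "y \<in> Int_orbit adC x"
  shows "y \<in> range (adC y)" "cvec.dim (range (adC y)) = cvec.dim (range (adC x))"
proof -
  obtain g where g: "g \<in> Int_group adC" "y = g x" using assms(2) unfolding Int_orbit_def by blast
  then show "y \<in> range (adC y)" using assms(1) C.range_br_Int_group[OF g(1), of x] by blast
  show "cvec.dim (range (adC y)) = cvec.dim (range (adC x))"
    using g range_cbr_dim_Int_group by simp
qed

lemma holomorphic_map_on_compose_complex_linear:
  fixes f g :: "'a \<times> 'a \<Rightarrow> 'a \<times> 'a"
  assumes "holomorphic_map_on f (g ` U)" "complex_linear g"
  shows "holomorphic_map_on (\<lambda>x. f (g x)) U"
  unfolding holomorphic_map_on_def
proof
  fix x assume "x \<in> U"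
  then obtain D where D: "(f has_derivative D) (at (g x))" "\<forall>c v. D (cscale c v) = cscale c (D v)"
    using assms(1) unfolding holomorphic_map_on_def by blast
  have "(g has_derivative g) (at x)"
    using complex_linear_imp_linear[OF assms(2)]
    by (intro bounded_linear_imp_has_derivative) (simp add: linear_conv_bounded_linear)
  from diff_chain_at[OF this D(1)] have "((\<lambda>x. f (g x)) has_derivative (\<lambda>v. D (g v))) (at x)"
    by (simp add: o_def)
  moreover have "D (g (cscale c v)) = cscale c (D (g v))" for c v
    unfolding complex_linear_scale[OF assms(2)] using D(2) by blast
  ultimately show "\<exists>D. ((\<lambda>x. f (g x)) has_derivative D) (at x) \<and> (\<forall>c v. D (cscale c v) = cscale c (D v))"
    by (intro exI[of _ "\<lambda>v. D (g v)"] conjI allI)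
qed

lemma complex_linear_compose_holomorphic_map_on:
  fixes f g :: "'a \<times> 'a \<Rightarrow> 'a \<times> 'a"
  assumes "holomorphic_map_on f U" "complex_linear g"
  shows "holomorphic_map_on (\<lambda>x. g (f x)) U"
  unfolding holomorphic_map_on_def
proof
  fix x assume "x \<in> U"
  then obtain D where D: "(f has_derivative D) (at x)" "\<forall>c v. D (cscale c v) = cscale c (D v)"
    using assms(1) unfolding holomorphic_map_on_def by blast
  have "bounded_linear g"
    using complex_linear_imp_linear[OF assms(2)] by (simp add: linear_conv_bounded_linear)
  from bounded_linear.has_derivative[OF this D(1)]
  show "\<exists>D. ((\<lambda>x. g (f x)) has_derivative D) (at x) \<and> (\<forall>c v. D (cscale c v) = cscale c (D v))"
    using D(2) complex_linear_scale[OF assms(2)] by (intro exI[of _ "\<lambda>v. g (D v)"]) simp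
qed

context
  fixes x h :: "'a \<times> 'a"
  assumes hx: "adC h x = 2 *\<^sub>R x"
    and regular: "\<And>z. adC h z - 2 *\<^sub>R z \<in> range (adC x) \<Longrightarrow> z \<in> range (adC x)"
begin

lemma in_own_range: "x \<in> range (adC x)"
proof -
  have "adC x (- ((1/2) *\<^sub>R h)) = (1/2) *\<^sub>R adC h x"
    using C.br_antisym[of x h] by (simp only: C.br.minus_right C.br.scaleR_right) simp
  then have "adC x (- ((1/2) *\<^sub>R h)) = x" using hx by simp
  then show ?thesis by (metis rangeI)
qed

lemma complex_submanifold_orbit: "complex_submanifold (Int_orbit adC x) (cvec.dim (range (adC x)))"
  unfolding complex_submanifold_def
proof
  fix y assume y: "y \<in> Int_orbit adC x"
  obtain U V \<Phi> g where c: "open U" "open V" "x \<in> V" "homeomorphism V U g \<Phi>"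
    "holomorphic_map_on g V" "holomorphic_map_on \<Phi> U"
    "\<And>w. w \<in> U \<Longrightarrow> w \<in> range (adC x) \<Longrightarrow> \<Phi> w \<in> Int_orbit adC x"
    "\<And>w. w \<in> U \<Longrightarrow> \<Phi> w \<in> range (adC (\<Phi> w)) \<Longrightarrow>
      cvec.dim (range (adC (\<Phi> w))) \<le> cvec.dim (range (adC x)) \<Longrightarrow> w \<in> range (adC x)"
    using orbit_chart[OF hx regular] by metis
  note hom = homeomorphism_apply1[OF c(4)] homeomorphism_apply2[OF c(4)]
    homeomorphism_image1[OF c(4)] homeomorphism_image2[OF c(4)]
  obtain \<gamma> where \<gamma>: "\<gamma> \<in> Int_group adC" "y = \<gamma> x" using y unfolding Int_orbit_def by blast
  obtain \<gamma>' where \<gamma>': "\<gamma>' \<in> Int_group adC" "\<And>v. \<gamma> (\<gamma>' v) = v" "\<And>v. \<gamma>' (\<gamma> v) = v"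
    using C.Int_group_inverse[OF \<gamma>(1)] by metis
  have cl: "complex_linear \<gamma>" "complex_linear \<gamma>'"
    using \<gamma>(1) \<gamma>'(1) by (auto intro: complex_linear_Int_group)
  have cont: "continuous_on S \<gamma>" "continuous_on S \<gamma>'" for S
    using cl[THEN complex_linear_imp_linear] by (auto simp: linear_conv_bounded_linear intro: linear_continuous_on)
  \<comment> \<open>The chart at x is transported to y by the group element with y = \<gamma> x; it
    preserves the orbit and is complex linear, so nothing about the chart changes.\<close>
  let ?U = "\<gamma> ` V" and ?f = "\<lambda>y. g (\<gamma>' y)" and ?g = "\<lambda>w. \<gamma> (\<Phi> w)"
  have \<gamma>V: "\<gamma>' ` \<gamma> ` V = V" using \<gamma>'(3) by (simp add: image_image)
  have "?U = \<gamma>' -` V"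
  proof (intro equalityI subsetI)
    fix v assume "v \<in> \<gamma>' -` V"
    with \<gamma>'(2)[of v] show "v \<in> ?U" by (metis imageI vimageE)
  qed (use \<gamma>'(3) in force)
  then have oU: "open ?U" using open_vimage[OF \<open>open V\<close> cont(2)[of UNIV]] by simp
  have h: "homeomorphism ?U U ?f ?g"
  proof (rule homeomorphismI)
    show "continuous_on ?U ?f"
      by (rule continuous_on_compose2[OF homeomorphism_cont1[OF c(4)] cont(2)]) (simp add: \<gamma>V)
    show "continuous_on U ?g"
      by (rule continuous_on_compose2[OF cont(1) homeomorphism_cont2[OF c(4)] subset_UNIV])
  qed (use hom \<gamma>' in auto)
  have h1: "holomorphic_map_on ?f ?U"
    by (rule holomorphic_map_on_compose_complex_linear[OF _ cl(2)]) (simp add: \<gamma>V c(5))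
  have h2: "holomorphic_map_on ?g U"
    by (rule complex_linear_compose_holomorphic_map_on[OF c(6) cl(1)])
  have eq: "?f ` (Int_orbit adC x \<inter> ?U) = range (adC x) \<inter> U"
  proof (intro equalityI subsetI)
    fix w assume "w \<in> ?f ` (Int_orbit adC x \<inter> ?U)"
    then obtain v where v: "v \<in> V" "\<gamma> v \<in> Int_orbit adC x" "w = g v" using \<gamma>' by auto
    have "\<gamma>' (\<gamma> v) \<in> Int_orbit adC x" by (rule C.Int_orbit_group[OF v(2) \<gamma>'(1)])
    then have "v \<in> Int_orbit adC x" by (simp add: \<gamma>')
    from orbit_in_own_range[OF in_own_range this] show "w \<in> range (adC x) \<inter> U"
      using c(8)[of w] v hom by auto
  next
    fix w assume w: "w \<in> range (adC x) \<inter> U"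
    then have "?g w \<in> Int_orbit adC x" using c(7) by (intro C.Int_orbit_group[OF _ \<gamma>(1)]) auto
    moreover have "?g w \<in> ?U" "?f (?g w) = w" using w hom \<gamma>' by auto
    ultimately show "w \<in> ?f ` (Int_orbit adC x \<inter> ?U)" by (metis IntI imageI)
  qed
  show "\<exists>U W f g E. open U \<and> y \<in> U \<and> open W \<and> homeomorphism U W f g \<and>
       holomorphic_map_on f U \<and> holomorphic_map_on g W \<and>
       cvec.subspace E \<and> cvec.dim E = cvec.dim (range (adC x)) \<and> f ` (Int_orbit adC x \<inter> U) = E \<inter> W"
    using oU \<gamma>(2) c(1,3) h h1 h2 complex_subspace_range eq
    by (intro exI[of _ ?U] exI[of _ U] exI[of _ ?f] exI[of _ ?g] exI[of _ "range (adC x)"]) simp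
qed

lemma complex_dimension_orbit: "complex_dimension (Int_orbit adC x) = cvec.dim (range (adC x))"
  using complex_dimension_eq[OF complex_submanifold_orbit] C.Int_orbit_refl by blast

text \<open>Plays the part of "boundary orbits have smaller dimension". A point of the orbit of y
  inside the chart at x has small enough rank and lies in its own ad-range, so the chart puts it on
  the orbit of x.\<close>

lemma orbit_eq_of_closure:
  assumes "x \<in> closure (Int_orbit adC y)" "y \<in> range (adC y)"
    and "cvec.dim (range (adC y)) \<le> cvec.dim (range (adC x))"
  shows "Int_orbit adC y = Int_orbit adC x"
proof -
  obtain U V \<Phi> g where c: "open V" "x \<in> V" "homeomorphism V U g \<Phi>"
    "\<And>w. w \<in> U \<Longrightarrow> w \<in> range (adC x) \<Longrightarrow> \<Phi> w \<in> Int_orbit adC x"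
    "\<And>w. w \<in> U \<Longrightarrow> \<Phi> w \<in> range (adC (\<Phi> w)) \<Longrightarrow>
      cvec.dim (range (adC (\<Phi> w))) \<le> cvec.dim (range (adC x)) \<Longrightarrow> w \<in> range (adC x)"
    using orbit_chart[OF hx regular] by metis
  obtain z where z: "z \<in> V" "z \<in> Int_orbit adC y"
    using assms(1) c(1,2) by (metis closure_iff_nhds_not_empty disjoint_iff open_Int_closure_eq_empty)
  have "g z \<in> U" "\<Phi> (g z) = z"
    using z(1) homeomorphism_image1[OF c(3)] homeomorphism_apply1[OF c(3)] by auto
  then have "z \<in> Int_orbit adC x"
    using c(4)[of "g z"] c(5)[of "g z"] orbit_in_own_range[OF assms(2) z(2)] assms(3) by simp
  with z(2) show ?thesis by (rule C.Int_orbit_eqI)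
qed

end

end

section \<open>The Killing form and nilpotent elements\<close>

definition trace_op :: "('a::euclidean_space \<Rightarrow> 'a) \<Rightarrow> real" where
  "trace_op T = (\<Sum>b\<in>Basis. T b \<bullet> b)"

lemma trace_op_commute:
  fixes S T :: "'a::euclidean_space \<Rightarrow> 'a"
  assumes "linear S" "linear T"
  shows "trace_op (\<lambda>x. S (T x)) = trace_op (\<lambda>x. T (S x))"
proof -
  have expand: "S (T b) \<bullet> d = (\<Sum>c\<in>Basis. (T b \<bullet> c) * (S c \<bullet> d))" if "linear S" for S T :: "'a \<Rightarrow> 'a" and b d
  proof -
    have "S (T b) = S (\<Sum>c\<in>Basis. (T b \<bullet> c) *\<^sub>R c)" by (simp add: euclidean_representation)
    also have "\<dots> = (\<Sum>c\<in>Basis. (T b \<bullet> c) *\<^sub>R S c)"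
      using that by (simp add: linear_sum linear_cmul)
    finally show ?thesis by (simp add: inner_sum_left)
  qed
  have "trace_op (\<lambda>x. S (T x)) = (\<Sum>b\<in>Basis. \<Sum>c\<in>Basis. (T b \<bullet> c) * (S c \<bullet> b))"
    unfolding trace_op_def by (intro sum.cong refl expand assms)
  also have "\<dots> = (\<Sum>c\<in>Basis. \<Sum>b\<in>Basis. (S c \<bullet> b) * (T b \<bullet> c))"
    by (subst sum.swap) (simp add: mult.commute)
  also have "\<dots> = trace_op (\<lambda>x. T (S x))"
    unfolding trace_op_def by (intro sum.cong refl expand[symmetric] assms)
  finally show ?thesis .
qed

text \<open>With P_i a projection onto the image of T^i, T P_i takes values in the next image, so
  P_(i+1) may be inserted on the left and moved to the right under the trace, where it absorbs P_i.
  Thus the trace of T P_i does not depend on i; P_0 is the identity and P_n is 0.\<close>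

lemma trace_op_nilpotent:
  fixes T :: "'a::euclidean_space \<Rightarrow> 'a"
  assumes T: "linear T" and nil: "\<And>x. (T ^^ n) x = 0"
  shows "trace_op T = 0"
proof -
  have pow: "linear (T ^^ i)" for i
  proof (induction i)
    case (Suc i)
    show ?case unfolding funpow.simps by (rule linear_compose[OF Suc T])
  qed (simp add: linear_iff)
  define R where "R i = range (T ^^ i)" for i
  have sub: "subspace (R i)" for i unfolding R_def by (rule linear_subspace_image[OF pow subspace_UNIV])
  have "\<exists>P. linear P \<and> (\<forall>x. P x \<in> R i) \<and> (\<forall>x\<in>R i. P x = x)" for i
    using subspace_projection[OF sub[of i]] by metis
  then obtain P where P: "\<And>i. linear (P i)" "\<And>i x. P i x \<in> R i" "\<And>i x. x \<in> R i \<Longrightarrow> P i x = x"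
    by metis
  have TR: "T x \<in> R (Suc i)" if "x \<in> R i" for x i using that by (auto simp: R_def)
  have RR: "R (Suc i) \<subseteq> R i" for i unfolding R_def by (auto simp: funpow_swap1)
  have "trace_op (\<lambda>x. T (P i x)) = trace_op (\<lambda>x. T (P (Suc i) x))" for i
  proof -
    have lin: "linear (\<lambda>x. T (P i x))" using linear_compose[OF P(1) T] by (simp add: o_def)
    have "trace_op (\<lambda>x. T (P i x)) = trace_op (\<lambda>x. P (Suc i) (T (P i x)))"
      using P(3)[OF TR[OF P(2)]] by simp
    also have "\<dots> = trace_op (\<lambda>x. T (P i (P (Suc i) x)))"
      by (rule trace_op_commute[OF P(1) lin])
    also have "\<dots> = trace_op (\<lambda>x. T (P (Suc i) x))"
      using P(3)[OF subsetD[OF RR P(2)]] by simp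
    finally show ?thesis .
  qed
  then have "trace_op (\<lambda>x. T (P 0 x)) = trace_op (\<lambda>x. T (P i x))" for i
    by (induction i) simp_all
  from this[of n] have "trace_op (\<lambda>x. T (P 0 x)) = trace_op (\<lambda>x. T (P n x))" .
  moreover have "P 0 x = x" for x by (rule P(3)) (simp add: R_def)
  moreover have "P n x = 0" for x using P(2)[of n x] nil by (auto simp: R_def)
  ultimately have "trace_op T = trace_op (\<lambda>x. T 0)" by simp
  then show ?thesis by (simp add: trace_op_def linear_0[OF T])
qed

section \<open>Nilpotency from commutation relations in an associative algebra\<close>

context
  fixes X Y C :: "'r::real_algebra_1"
  assumes C: "X * Y = Y * X + C" and XC: "X * C = C * X"
begin

lemma power_commutator: "X ^ Suc i * Y = Y * X ^ Suc i + real (Suc i) *\<^sub>R (C * X ^ i)"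
proof (induction i)
  case (Suc i)
  have "X ^ Suc (Suc i) * Y = X * (X ^ Suc i * Y)" by (simp add: mult.assoc)
  also have "\<dots> = (X * Y) * X ^ Suc i + real (Suc i) *\<^sub>R ((X * C) * X ^ i)"
    unfolding Suc.IH by (simp add: distrib_left mult.assoc)
  also have "\<dots> = Y * X ^ Suc (Suc i) + real (Suc (Suc i)) *\<^sub>R (C * X ^ Suc i)"
    unfolding C XC
    by (simp only: of_nat_Suc[of "Suc i"] scaleR_add_left scaleR_one distrib_right mult.assoc power_Suc add.assoc)
  finally show ?case .
qed (simp add: C)

text \<open>Jacobson's lemma. A relation C^k X^(i+1) = 0 is traded for C^(2k+1) X^i = 0, lowering
  the exponent of X to zero.\<close>

lemma commutator_nilpotent:
  assumes "X ^ m = 0"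
  shows "\<exists>k. C ^ k = 0"
proof -
  have "\<exists>k. C ^ k * X ^ i = 0" if "C ^ k * X ^ (i + j) = 0" for i j k
    using that
  proof (induction j arbitrary: k)
    case (Suc j)
    let ?i = "i + j"
    have comm: "X ^ l * C ^ k = C ^ k * X ^ l" for l
      by (rule power_commuting_commutes[OF power_commuting_commutes[OF XC[symmetric], symmetric]])
    have 2: "C ^ k * X ^ Suc ?i = 0" using Suc.prems by (simp only: add_Suc_right)
    have 1: "X ^ Suc ?i * C ^ k = 0" unfolding comm by (rule 2)
    note 3 = comm[of ?i]
    \<comment> \<open>Commuting Y past the power of X produces one term that still contains C^k
      X^(i+1) = 0, and one term in which X has lost a factor and C has gained powers.\<close>
    have "0 = C ^ k * X ^ Suc ?i * (Y * C ^ k)" unfolding 2 by simp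
    also have "\<dots> = C ^ k * (X ^ Suc ?i * Y) * C ^ k" by (simp only: mult.assoc)
    also have "\<dots> = C ^ k * Y * (X ^ Suc ?i * C ^ k) + real (Suc ?i) *\<^sub>R (C ^ k * C * (X ^ ?i * C ^ k))"
      unfolding power_commutator
      by (simp only: distrib_left distrib_right mult.assoc mult_scaleR_left mult_scaleR_right)
    also have "\<dots> = real (Suc ?i) *\<^sub>R (C ^ k * C * C ^ k * X ^ ?i)"
      unfolding 1 3 by (simp add: mult.assoc)
    also have "C ^ k * C * C ^ k = C ^ (k + 1 + k)" by (simp only: power_add power_one_right)
    finally have "real (Suc ?i) *\<^sub>R (C ^ (k + 1 + k) * X ^ ?i) = 0" by simp
    then have "C ^ (k + 1 + k) * X ^ ?i = 0" by (simp only: scaleR_eq_0_iff) simp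
    then show ?case by (rule Suc.IH)
  qed auto
  from this[of 0 0 m] assms show ?thesis by simp
qed

text \<open>On elements V killed by X^(i+1), the operator X^i (X Y)^n acts as (i+1)^n C^n X^i. Since
  C is nilpotent, finitely many factors X Y lower the X-order by one. V stands for a vector; V = 1
  gives the claim.\<close>

lemma product_nilpotent:
  assumes "X ^ m = 0"
  shows "\<exists>n. (X * Y) ^ n = 0"
proof -
  obtain k where k: "C ^ k = 0" using commutator_nilpotent[OF assms] by blast
  have step: "X ^ i * ((X * Y) * W) = real (Suc i) *\<^sub>R (C * (X ^ i * W))" if "X ^ Suc i * W = 0" for i W
  proof -
    have "X ^ i * ((X * Y) * W) = X ^ Suc i * Y * W" by (simp only: power_Suc2 mult.assoc)
    also have "\<dots> = Y * (X ^ Suc i * W) + real (Suc i) *\<^sub>R (C * (X ^ i * W))"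
      unfolding power_commutator by (simp only: distrib_right mult.assoc mult_scaleR_left)
    finally show ?thesis using that by simp
  qed
  have "\<exists>n. (X * Y) ^ n * V = 0" if "X ^ i * V = 0" for i V
    using that
  proof (induction i arbitrary: V)
    case (Suc i)
    have "X ^ Suc i * ((X * Y) ^ n * V) = 0 \<and> X ^ i * ((X * Y) ^ n * V) = (real (Suc i)) ^ n *\<^sub>R (C ^ n * (X ^ i * V))" for n
    proof (induction n)
      case (Suc n)
      let ?W = "(X * Y) ^ n * V"
      have W: "X ^ Suc i * ?W = 0" using Suc.IH ..
      have 1: "X ^ i * ((X * Y) ^ Suc n * V) = real (Suc i) *\<^sub>R (C * (X ^ i * ?W))"
        using step[OF W] by (simp only: power_Suc mult.assoc)
      have "X ^ Suc i * ((X * Y) ^ Suc n * V) = X * (X ^ i * ((X * Y) ^ Suc n * V))"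
        by (simp only: power_Suc mult.assoc)
      also have "\<dots> = real (Suc i) *\<^sub>R ((X * C) * (X ^ i * ?W))" unfolding 1 by (simp add: mult.assoc)
      also have "\<dots> = real (Suc i) *\<^sub>R (C * (X ^ Suc i * ?W))" unfolding XC by (simp add: mult.assoc)
      finally have "X ^ Suc i * ((X * Y) ^ Suc n * V) = 0" using W by simp
      moreover have "X ^ i * ((X * Y) ^ Suc n * V) = real (Suc i) ^ Suc n *\<^sub>R (C ^ Suc n * (X ^ i * V))"
        unfolding 1 using Suc.IH by (simp add: mult.assoc)
      ultimately show ?case ..
    qed (use Suc.prems in simp)
    from this[of k] have "X ^ i * ((X * Y) ^ k * V) = 0" by (simp add: k)
    from Suc.IH[OF this] obtain n where "(X * Y) ^ n * ((X * Y) ^ k * V) = 0" ..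
    then have "(X * Y) ^ (n + k) * V = 0" by (simp add: power_add mult.assoc)
    then show ?case ..
  qed (auto intro: exI[of _ 0])
  from this[of m 1] assms show ?thesis by simp
qed

end

text \<open>The usual sl(2) identity with H kept to the left of X^n, hence the shift -n. In this
  form H acts directly on X^n w, so its eigenvalue can be read off.\<close>

lemma sl2_power_commutator:
  fixes X F H :: "'r::real_algebra_1"
  assumes "X * F = F * X + H" "H * X = X * H + 2 *\<^sub>R X"
  shows "X ^ Suc n * F = F * X ^ Suc n + real (Suc n) *\<^sub>R (H * X ^ n - real n *\<^sub>R X ^ n)"
proof (induction n)
  case (Suc n)
  have XH: "X * H = H * X - 2 *\<^sub>R X" using assms(2) by simp
  have "X ^ Suc (Suc n) * F = X * (X ^ Suc n * F)" by (simp add: mult.assoc)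
  also have "\<dots> = (X * F) * X ^ Suc n + real (Suc n) *\<^sub>R ((X * H) * X ^ n - real n *\<^sub>R X ^ Suc n)"
    unfolding Suc.IH by (simp add: distrib_left right_diff_distrib mult.assoc)
  also have "(X * H) * X ^ n = H * X ^ Suc n - 2 *\<^sub>R X ^ Suc n"
    unfolding XH by (simp add: left_diff_distrib mult.assoc)
  also have "(X * F) * X ^ Suc n = F * X ^ Suc (Suc n) + H * X ^ Suc n"
    unfolding assms(1) by (simp add: distrib_right mult.assoc)
  also have "F * X ^ Suc (Suc n) + H * X ^ Suc n
      + real (Suc n) *\<^sub>R (H * X ^ Suc n - 2 *\<^sub>R X ^ Suc n - real n *\<^sub>R X ^ Suc n)
    = F * X ^ Suc (Suc n) + real (Suc (Suc n)) *\<^sub>R (H * X ^ Suc n - real (Suc n) *\<^sub>R X ^ Suc n)"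
  proof -
    define s where "s = real (Suc n)"
    have s: "real n = s - 1" "real (Suc (Suc n)) = 1 + s" by (simp_all add: s_def)
    have e: "(1 + s) * s = s * 2 + s * (s - 1)" by (simp add: algebra_simps)
    have *: "A + s *\<^sub>R (A - 2 *\<^sub>R B - (s - 1) *\<^sub>R B) = (1 + s) *\<^sub>R (A - s *\<^sub>R B)" for A B :: 'r
      by (simp only: scaleR_diff_right scaleR_scaleR e scaleR_add_left scaleR_add_right scaleR_one diff_diff_eq add_diff_eq)
    show ?thesis unfolding s_def[symmetric] s *[symmetric] by (simp only: add.assoc)
  qed
  finally show ?case .
qed (simp add: assms(1))

context euclidean_lie_algebra
begin

lemma killing_eq_trace: "killing br x y = trace_op (\<lambda>b. br x (br y b))"
  by (simp add: killing_def trace_op_def)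

lemma killing_sym: "killing br x y = killing br y x"
  unfolding killing_eq_trace by (rule trace_op_commute[OF linear_br linear_br])

lemma linear_killing: "linear (killing br x)"
  by (rule linearI) (simp_all add: killing_def br.add_left br.add_right br.scaleR_left br.scaleR_right
      inner_add_left sum.distrib sum_distrib_left)

lemma killing_invariant: "killing br (br x y) z = killing br x (br y z)"
proof -
  have comm: "br (br u v) w = br u (br v w) - br v (br u w)" for u v w
    using br_br[of u v w] by simp
  have lin: "linear (\<lambda>b. br u (br v b))" for u v
    using linear_compose[OF linear_br linear_br] by (simp add: o_def)
  have "trace_op (\<lambda>b. br y (br x (br z b))) = trace_op (\<lambda>b. br x (br z (br y b)))"
    by (rule trace_op_commute[OF linear_br lin])
  then show ?thesis
    unfolding killing_eq_trace comm br.diff_right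
    by (simp add: trace_op_def inner_diff_left sum_subtractf)
qed

lemma endo_of_ad_mult: "endo_of (br x) * endo_of (br y) = endo_of (br y) * endo_of (br x) + endo_of (br (br x y))"
  by (rule endo_eqI) (simp add: linear_br endo_apply.add_left, subst br_br, simp)

lemma endo_of_ad_scaleR: "endo_of (br (c *\<^sub>R x)) = c *\<^sub>R endo_of (br x)"
  by (rule endo_eqI) (simp add: linear_br endo_apply.scaleR_left br.scaleR_left)

lemma nilpotent_endo:
  assumes "x \<in> nilpotent_cone br"
  obtains m where "endo_of (br x) ^ m = 0"
proof -
  obtain m where "\<And>y. (br x ^^ m) y = 0" using assms by (auto simp: nilpotent_cone_def)
  moreover have "endo_apply (endo_of (br x)) = br x" using endo_apply_endo_of[OF linear_br] by blast
  ultimately have "endo_of (br x) ^ m = 0"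
    by (intro endo_eqI) (simp add: endo_apply_power endo_apply.zero_left)
  then show ?thesis by (rule that)
qed

text \<open>The assumption [x, [x, y]] = 0 says that ad [x, y] commutes with ad x, so ad x ad y is
  nilpotent and its trace vanishes.\<close>

lemma killing_eq_0_nilpotent:
  assumes "x \<in> nilpotent_cone br" "br x (br x y) = 0"
  shows "killing br x y = 0"
proof -
  let ?X = "endo_of (br x)" and ?Y = "endo_of (br y)" and ?C = "endo_of (br (br x y))"
  have "endo_of (br (br x (br x y))) = 0"
    unfolding assms(2) using endo_of_ad_scaleR[of 0 0] by simp
  then have comm: "?X * ?C = ?C * ?X"
    using endo_of_ad_mult[of x "br x y"] by (simp only: add_0_right)
  obtain m where m: "?X ^ m = 0" using nilpotent_endo[OF assms(1)] .
  obtain n where n: "(?X * ?Y) ^ n = 0"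
    using product_nilpotent[OF endo_of_ad_mult comm m] ..
  have XY: "endo_apply (?X * ?Y) = (\<lambda>b. br x (br y b))" by (simp add: linear_br fun_eq_iff)
  have "((\<lambda>b. br x (br y b)) ^^ n) v = 0" for v
    unfolding XY[symmetric] endo_apply_power[symmetric] n by (rule endo_apply.zero_left)
  moreover have "linear (\<lambda>b. br x (br y b))"
    using linear_compose[OF linear_br linear_br] by (simp add: o_def)
  ultimately show ?thesis unfolding killing_eq_trace by (intro trace_op_nilpotent)
qed

end

section \<open>Neutral elements when the Killing form is nondegenerate\<close>

locale nondegenerate_lie_algebra = euclidean_lie_algebra +
  assumes killing_nondegenerate: "(\<And>y. killing br x y = 0) \<Longrightarrow> x = 0"
begin

text \<open>Nondegeneracy makes the map \<Psi> representing the Killing form in the inner product of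
  the type bijective, so the component z of v orthogonal to W is the image of some y.\<close>

lemma killing_separation:
  assumes "subspace W" "v \<notin> W"
  obtains y where "\<And>w. w \<in> W \<Longrightarrow> killing br w y = 0" "killing br v y \<noteq> 0"
proof -
  have W: "span W = W" using assms(1) by (rule span_eq_iff[THEN iffD2])
  obtain w0 z where w0: "w0 \<in> W" and z: "\<And>w. w \<in> W \<Longrightarrow> orthogonal z w" and v: "v = w0 + z"
    by (rule orthogonal_subspace_decomp_exists[of W v, unfolded W]) (rule that, assumption+)
  have wz: "w \<bullet> z = 0" if "w \<in> W" for w using z[OF that] by (simp add: orthogonal_def inner_commute)
  have "z \<noteq> 0" using w0 v assms(2) by auto
  then have vz: "v \<bullet> z \<noteq> 0" unfolding v inner_add_left wz[OF w0] by simp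
  define \<Psi> where "\<Psi> y = (\<Sum>b\<in>Basis. killing br y b *\<^sub>R b)" for y
  have lin: "linear (\<lambda>y. killing br y w)" for w
    unfolding killing_sym[of _ w] by (rule linear_killing)
  have "linear \<Psi>"
    unfolding \<Psi>_def by (rule linearI)
      (simp_all add: linear_add[OF lin] linear_cmul[OF lin] scaleR_add_left sum.distrib scaleR_right.sum)
  have \<Psi>: "w \<bullet> \<Psi> y = killing br w y" for w y
  proof -
    have "killing br y w = killing br y (\<Sum>b\<in>Basis. (w \<bullet> b) *\<^sub>R b)" by (simp add: euclidean_representation)
    also have "\<dots> = (\<Sum>b\<in>Basis. (w \<bullet> b) * killing br y b)"
      by (simp add: linear_sum[OF linear_killing] linear_cmul[OF linear_killing])
    finally have "killing br w y = (\<Sum>b\<in>Basis. (w \<bullet> b) * killing br y b)" unfolding killing_sym[of w y] .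
    then show ?thesis by (simp add: \<Psi>_def inner_sum_right mult.commute)
  qed
  have "inj \<Psi>"
  proof (rule linear_injective_0[OF \<open>linear \<Psi>\<close>, THEN iffD2], intro allI impI)
    fix y assume "\<Psi> y = 0"
    then have "killing br w y = 0" for w using \<Psi>[of w y] by simp
    then show "y = 0" by (intro killing_nondegenerate) (simp only: killing_sym[of y])
  qed
  then have "surj \<Psi>" using \<open>linear \<Psi>\<close> by (simp add: linear_injective_imp_surjective)
  then obtain y where y: "z = \<Psi> y" by (metis surjD)
  have 1: "killing br w y = w \<bullet> z" for w unfolding y by (rule \<Psi>[symmetric])
  show ?thesis
  proof (rule that)
    show "killing br w y = 0" if "w \<in> W" for w
      unfolding 1 using that by (rule wz)
    show "killing br v y \<noteq> 0" unfolding 1 by (rule vz)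
  qed
qed

text \<open>A substitute for the Jacobson--Morozov theorem: only the semisimple element is produced,
  together with the part of the representation theory that is needed for a transversal slice.\<close>

lemma nilpotent_in_range_square:
  assumes "x \<in> nilpotent_cone br"
  shows "\<exists>f. br x (br x f) = x"
proof (rule ccontr)
  assume no: "\<nexists>f. br x (br x f) = x"
  have "subspace (range (\<lambda>f. br x (br x f)))"
    using linear_compose[OF linear_br linear_br] by (intro linear_subspace_image subspace_UNIV) (simp add: o_def)
  moreover have "x \<notin> range (\<lambda>f. br x (br x f))" using no by (metis imageE)
  ultimately obtain y where y: "\<And>w. killing br (br x (br x w)) y = 0" "killing br x y \<noteq> 0"
    using killing_separation[of "range (\<lambda>f. br x (br x f))" x] by (metis rangeI)
  have swap: "killing br (br x a) b = - killing br a (br x b)" for a b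
    using killing_invariant[of a x b] br_antisym[of x a] linear_killing
    by (metis (no_types) killing_sym linear_neg)
  \<comment> \<open>Moving ad x across the form twice turns "y annihilates the image of (ad x)^2"
    into (ad x)^2 y = 0. Nilpotency of x then forces B(x, y) = 0, against the choice of y.\<close>
  have "killing br (br x (br x y)) w = 0" for w
    using y(1)[of w] swap[of "br x w" y] swap[of w "br x y"] by (simp add: killing_sym)
  then have "br x (br x y) = 0" by (rule killing_nondegenerate)
  from killing_eq_0_nilpotent[OF assms this] y(2) show False by simp
qed

lemma neutral_element:
  assumes "x \<in> nilpotent_cone br"
  obtains f h where "h = br x f" "br h x = 2 *\<^sub>R x"
proof -
  obtain f where f: "br x (br x f) = x" using nilpotent_in_range_square[OF assms] by blast
  have "br (br x f) x = - x" unfolding br_antisym[of "br x f" x] f ..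
  then have "br (br x (- (2 *\<^sub>R f))) x = 2 *\<^sub>R x"
    by (simp add: br.minus_right br.minus_left br.scaleR_right br.scaleR_left)
  then show ?thesis using that by blast
qed

text \<open>The statement that a highest weight vector has no negative weight, but without a full
  sl(2) triple: only h = [x, f] and [h, x] = 2 x are used, never [h, f]. One shows that y lies in
  the image of every power of the nilpotent ad x.\<close>

lemma neutral_element_eigenvalue:
  assumes x: "x \<in> nilpotent_cone br" and h: "h = br x f" "br h x = 2 *\<^sub>R x"
    and y: "br x y = 0" "br h y = - (2 *\<^sub>R y)"
  shows "y = 0"
proof -
  let ?X = "endo_of (br x)" and ?F = "endo_of (br f)" and ?H = "endo_of (br h)"
  have XF: "?X * ?F = ?F * ?X + ?H" using endo_of_ad_mult[of x f] h by simp
  have HX: "?H * ?X = ?X * ?H + 2 *\<^sub>R ?X" using endo_of_ad_mult[of h x] h by (simp add: endo_of_ad_scaleR)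
  have "\<exists>w. y = endo_apply (?X ^ n) w" for n
  proof (induction n)
    case (Suc n)
    then obtain w where w: "y = endo_apply (?X ^ n) w" by blast
    have "endo_apply (?X ^ Suc n) (endo_apply ?F w) = endo_apply (?X ^ Suc n * ?F) w" by simp
    also have "\<dots> = endo_apply ?F (endo_apply (?X ^ Suc n) w)
        + real (Suc n) *\<^sub>R (endo_apply ?H (endo_apply (?X ^ n) w) - real n *\<^sub>R endo_apply (?X ^ n) w)"
      unfolding sl2_power_commutator[OF XF HX]
      by (simp only: endo_apply.add_left endo_apply.diff_left endo_apply.scaleR_left endo_apply_mult)
    also have "endo_apply (?X ^ Suc n) w = 0" using y(1) w by (simp add: linear_br)
    also have "endo_apply ?H (endo_apply (?X ^ n) w) - real n *\<^sub>R endo_apply (?X ^ n) w = (- 2 - real n) *\<^sub>R y"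
      using y(2) w by (simp add: linear_br algebra_simps)
    \<comment> \<open>The factor (n + 1)(-2 - n) is nonzero for every n, so dividing by it exhibits
      y in the image of the next power.\<close>
    finally have "endo_apply (?X ^ Suc n) (endo_apply ?F w) = (real (Suc n) * (- 2 - real n)) *\<^sub>R y"
      by (simp add: endo_apply.zero_right)
    then have "endo_apply (?X ^ Suc n) ((1 / (real (Suc n) * (- 2 - real n))) *\<^sub>R endo_apply ?F w) = y"
      by (simp only: endo_apply.scaleR_right) simp
    then show ?case by metis
  qed auto
  moreover obtain m where "?X ^ m = 0" using nilpotent_endo[OF x] .
  ultimately show ?thesis by (metis endo_apply.zero_left)
qed

text \<open>By Killing duality, ad h - 2 is surjective on g / [x, g] because ad h + 2 is injective
  on the kernel of ad x, the preceding lemma. In finite dimension surjectivity gives the injectivity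
  that is wanted.\<close>

lemma neutral_element_regular:
  assumes x: "x \<in> nilpotent_cone br" and h: "h = br x f" "br h x = 2 *\<^sub>R x"
    and z: "br h z - 2 *\<^sub>R z \<in> range (br x)"
  shows "z \<in> range (br x)"
proof -
  define R where "R = range (br x)"
  have R: "subspace R" unfolding R_def by (intro linear_subspace_image linear_br subspace_UNIV)
  obtain P where P: "linear P" "\<And>x. P x \<in> R" "\<And>x. x \<in> R \<Longrightarrow> P x = x"
    using subspace_projection[OF R] by metis
  define T where "T w = br h w - 2 *\<^sub>R w" for w
  have linT: "linear T" unfolding T_def by (rule linearI) (simp_all add: br.add_right br.scaleR_right algebra_simps)
  have TR: "T r \<in> R" if "r \<in> R" for r
  proof -
    obtain w where "r = br x w" using \<open>r \<in> R\<close> unfolding R_def by blast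
    then have "br h r = br x (2 *\<^sub>R w + br h w)"
      using br_br[of h x w] h(2) by (simp add: br.add_right br.scaleR_right br.scaleR_left)
    then have "br h r \<in> R" unfolding R_def by blast
    then show ?thesis unfolding T_def by (intro subspace_diff[OF R] subspace_scale[OF R] that)
  qed
  define W where "W = {r + T w |r w. r \<in> R}"
  have "W = UNIV"
  proof (rule ccontr)
    assume "W \<noteq> UNIV"
    then obtain v where "v \<notin> W" by blast
    have W': "W = {r + t |r t. r \<in> R \<and> t \<in> range T}" unfolding W_def by blast
    have "subspace W"
      unfolding W' by (rule subspace_sums[OF R linear_subspace_image[OF linT subspace_UNIV]])
    then obtain y where y: "\<And>w. w \<in> W \<Longrightarrow> killing br w y = 0" "killing br v y \<noteq> 0"
      using killing_separation[OF _ \<open>v \<notin> W\<close>] by metis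
    have "R \<subseteq> W" unfolding W_def using linear_0[OF linT] by force
    moreover have "range T \<subseteq> W" unfolding W_def using subspace_0[OF R] by force
    ultimately have 1: "killing br (br x w) y = 0" and 2: "killing br (T w) y = 0" for w
      using y(1) unfolding R_def by blast+
    have swap: "killing br (br u a) b = - killing br a (br u b)" for u a b
      using killing_invariant[of a u b] br_antisym[of u a] linear_killing
      by (metis (no_types) killing_sym linear_neg)
    \<comment> \<open>Orthogonality to [x, g] and to the image of T = ad h - 2 dualises to [x, y] =
      0 and [h, y] = -2 y.\<close>
    have "br x y = 0"
      using 1 swap[of x _ y] by (intro killing_nondegenerate) (simp add: killing_sym)
    moreover have "br h y + 2 *\<^sub>R y = 0"
    proof (rule killing_nondegenerate)
      fix w
      have "killing br y (T w) = killing br y (br h w) - 2 * killing br y w"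
        unfolding T_def by (simp add: linear_diff[OF linear_killing] linear_cmul[OF linear_killing])
      then have "killing br w (br h y + 2 *\<^sub>R y) = 0"
        using 2[of w] swap[of h w y]
        by (simp add: linear_add[OF linear_killing] linear_cmul[OF linear_killing] killing_sym)
      then show "killing br (br h y + 2 *\<^sub>R y) w = 0" by (simp add: killing_sym)
    qed
    then have "br h y = - (2 *\<^sub>R y)" by (simp add: eq_neg_iff_add_eq_0)
    ultimately have "y = 0" using neutral_element_eigenvalue[OF x h] by blast
    then show False using y(2) linear_0[OF linear_killing] by simp
  qed
  \<comment> \<open>An operator on the whole space in place of the quotient map: it keeps the
    \<open>R\<close>-component of v and takes the component of \<open>T v\<close> along the
    complement, so surjectivity and injectivity of \<psi> are those of \<open>T\<close> modulo
    \<open>R\<close>.\<close>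
  define \<psi> where "\<psi> v = P v + (T v - P (T v))" for v
  have lin\<psi>: "linear \<psi>" unfolding \<psi>_def
    by (rule linearI) (simp_all add: linear_add[OF P(1)] linear_add[OF linT] linear_cmul[OF P(1)] linear_cmul[OF linT] algebra_simps)
  have "surj \<psi>"
  proof (rule surjI)
    define pick where "pick t = (SOME u. \<exists>r\<in>R. t = r + T u)" for t
    fix t
    have "\<exists>u. \<exists>r\<in>R. t = r + T u" using \<open>W = UNIV\<close> unfolding W_def by blast
    then have "\<exists>r\<in>R. t = r + T (pick t)" unfolding pick_def by (rule someI_ex)
    then obtain r where r: "r \<in> R" "t = r + T (pick t)" by blast
    define u where "u = pick t"
    have Tu: "T u = t - r" using r(2) unfolding u_def by (metis add_diff_cancel_left')
    have eq: "T u - P (T u) = t - P t"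
      unfolding Tu using P(3)[OF r(1)] by (simp add: linear_diff[OF P(1)])
    have Pu: "P (u - P u + P t) = P t"
      using P(3)[OF P(2)] by (simp add: linear_add[OF P(1)] linear_diff[OF P(1)])
    have TP: "T (P a) - P (T (P a)) = 0" for a using P(3)[OF TR[OF P(2)]] by simp
    have "T (u - P u + P t) - P (T (u - P u + P t)) = T u - P (T u)"
      using TP[of u] TP[of t]
      by (simp add: linear_add[OF P(1)] linear_diff[OF P(1)] linear_add[OF linT] linear_diff[OF linT])
    \<comment> \<open>The witness is u = \<open>pick t\<close> with its \<open>R\<close>-component
      replaced by that of t; this changes \<open>T u\<close> only inside \<open>R\<close>.\<close>
    then show "\<psi> (pick t - P (pick t) + P t) = t"
      using eq Pu by (simp add: \<psi>_def u_def)
  qed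
  then have "inj \<psi>" using lin\<psi> by (simp add: linear_surjective_imp_injective)
  moreover have "\<psi> (z - P z) = 0"
  proof -
    have "T z \<in> R" using z by (simp add: T_def R_def)
    then have "T (z - P z) \<in> R" using TR[OF P(2)] R by (simp add: linear_diff[OF linT] subspace_diff)
    then show ?thesis using P(3) P(3)[OF P(2)] by (simp add: \<psi>_def linear_diff[OF P(1)])
  qed
  ultimately have "z - P z = 0" unfolding linear_injective_0[OF lin\<psi>] by blast
  then show ?thesis using P(2)[of z] by (simp add: R_def)
qed

end

section \<open>Restricted root spaces\<close>

locale cartan_lie_algebra = euclidean_lie_algebra br
  for br :: "'a::euclidean_space \<Rightarrow> 'a \<Rightarrow> 'a" +
  fixes \<theta> :: "'a \<Rightarrow> 'a" and a :: "'a set"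
  assumes cartan_involution: "cartan_involution br \<theta>"
    and maximal_abelian: "maximal_abelian_in br {x. \<theta> x = - x} a"
begin

lemma linear_theta: "linear \<theta>"
  and theta_br: "\<theta> (br x y) = br (\<theta> x) (\<theta> y)"
  and theta_theta [simp]: "\<theta> (\<theta> x) = x"
  using cartan_involution by (auto simp: cartan_involution_def)

lemma killing_theta: "killing br (\<theta> x) (\<theta> y) = killing br x y"
proof -
  have ad: "br (\<theta> u) v = \<theta> (br u (\<theta> v))" for u v by (simp add: theta_br)
  have lin: "linear (\<lambda>b. br x (br y (\<theta> b)))"
    using linear_compose[OF linear_compose[OF linear_theta linear_br] linear_br] by (simp add: o_def)
  have "killing br (\<theta> x) (\<theta> y) = trace_op (\<lambda>b. \<theta> (br x (br y (\<theta> b))))"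
    unfolding killing_eq_trace ad by simp
  also have "\<dots> = trace_op (\<lambda>b. br x (br y (\<theta> (\<theta> b))))"
    by (rule trace_op_commute[OF linear_theta lin])
  finally show ?thesis by (simp add: killing_eq_trace)
qed

text \<open>The standard inner product attached to a Cartan involution. The adjoint of ad u is -ad
  (\<theta> u), so ad h is self-adjoint for h in \<open>a\<close>; this form, not the inner product
  of the type, measures lengths from here on.\<close>

definition bform :: "'a \<Rightarrow> 'a \<Rightarrow> real" where
  "bform x y = - killing br x (\<theta> y)"

lemma bform_sym: "bform x y = bform y x"
  using killing_theta[of x "\<theta> y"] by (simp add: bform_def killing_sym[of "\<theta> x"])

lemma bform_pos: "x \<noteq> 0 \<Longrightarrow> bform x x > 0"
  using cartan_involution by (simp add: cartan_involution_def bform_def)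

lemma bilinear_bform: "bilinear bform"
proof -
  have right: "linear (bform x)" for x
    unfolding bform_def
    using linear_compose_neg[OF linear_compose[OF linear_theta linear_killing[of x]]] by (simp add: o_def)
  then show ?thesis unfolding bilinear_def using bform_sym by (simp add: bform_sym[of _ "_"] eta_contract_eq)
qed

sublocale bform: bounded_bilinear bform
  using bilinear_bform by (simp add: bilinear_conv_bounded_bilinear)

sublocale nondegenerate_lie_algebra br
proof (unfold_locales, rule ccontr)
  fix x assume 0: "\<And>y. killing br x y = 0" and "x \<noteq> 0"
  from bform_pos[OF \<open>x \<noteq> 0\<close>] 0 show False by (simp add: bform_def)
qed

lemma bform_eq_0_iff: "bform x x = 0 \<longleftrightarrow> x = 0"
  using bform_pos[of x] by (cases "x = 0") (simp_all add: bform.zero_left)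

lemma bform_adjoint: "bform (br u x) y = - bform x (br (\<theta> u) y)"
proof -
  have "killing br (br u x) z = - killing br x (br u z)" for z
  proof -
    have "killing br (br u x) z = - killing br z (br x u)"
      unfolding br_antisym[of u x] killing_sym[of "- br x u" z] by (rule linear_neg[OF linear_killing])
    then show ?thesis unfolding killing_sym[of z] killing_invariant .
  qed
  then show ?thesis by (simp add: bform_def theta_br)
qed

lemma subspace_a: "subspace a" and a_theta: "h \<in> a \<Longrightarrow> \<theta> h = - h"
  and a_abelian: "h \<in> a \<Longrightarrow> h' \<in> a \<Longrightarrow> br h h' = 0"
  using maximal_abelian by (auto simp: maximal_abelian_in_def abelian_subspace_in_def)

lemma bform_a: "h \<in> a \<Longrightarrow> bform (br h x) y = bform x (br h y)"
  by (simp add: bform_adjoint a_theta br.minus_left bform.minus_right)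

text \<open>Adjoining y to \<open>a\<close> gives an abelian subspace of the -1 eigenspace of
  \<theta>, so maximality absorbs it.\<close>

lemma in_a_if_centralizes:
  assumes "\<theta> y = - y" "\<And>h. h \<in> a \<Longrightarrow> br h y = 0"
  shows "y \<in> a"
proof -
  define a' where "a' = {h + t |h t. h \<in> a \<and> t \<in> span {y}}"
  have el: "\<exists>h\<in>a. \<exists>c. u = h + c *\<^sub>R y" if "u \<in> a'" for u
    using that unfolding a'_def span_singleton by blast
  have "subspace a'" unfolding a'_def by (rule subspace_sums[OF subspace_a subspace_span])
  moreover have "a' \<subseteq> {x. \<theta> x = - x}"
  proof
    fix u assume "u \<in> a'"
    then obtain h c where "h \<in> a" "u = h + c *\<^sub>R y" using el by blast
    then show "u \<in> {x. \<theta> x = - x}"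
      using assms(1) by (simp add: a_theta linear_add[OF linear_theta] linear_cmul[OF linear_theta])
  qed
  moreover have "br u v = 0" if uv: "u \<in> a'" "v \<in> a'" for u v
  proof -
    obtain h c where u: "h \<in> a" "u = h + c *\<^sub>R y" using el[OF uv(1)] by blast
    obtain h' c' where v: "h' \<in> a" "v = h' + c' *\<^sub>R y" using el[OF uv(2)] by blast
    have "br y h' = 0" using assms(2)[OF v(1)] br_antisym[of h' y] by simp
    then show ?thesis
      using u(1) v(1) assms(2) unfolding u(2) v(2)
      by (simp add: br.add_left br.add_right br.scaleR_left br.scaleR_right a_abelian br_self)
  qed
  ultimately have "abelian_subspace_in br {x. \<theta> x = - x} a'" by (simp add: abelian_subspace_in_def)
  moreover have "a \<subseteq> a'"
  proof
    fix h assume "h \<in> a"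
    then have "h + 0 \<in> a'" unfolding a'_def using span_zero by blast
    then show "h \<in> a'" by simp
  qed
  ultimately have "a' = a" using maximal_abelian by (simp add: maximal_abelian_in_def)
  moreover have "0 + y \<in> a'" unfolding a'_def using subspace_0[OF subspace_a] span_base[of y "{y}"] by blast
  ultimately show ?thesis by simp
qed

section \<open>Simultaneous diagonalisation of ad a\<close>

abbreviation (input) "rs \<equiv> root_space br a"

lemma root_spaceI: "(\<And>h. h \<in> a \<Longrightarrow> br h x = \<xi> h *\<^sub>R x) \<Longrightarrow> x \<in> rs \<xi>"
  and root_spaceD: "x \<in> rs \<xi> \<Longrightarrow> h \<in> a \<Longrightarrow> br h x = \<xi> h *\<^sub>R x"
  by (auto simp: root_space_def)

lemma subspace_root_space: "subspace (rs \<xi>)"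
  unfolding subspace_def
  by (auto intro!: root_spaceI simp: br.zero_right br.add_right br.scaleR_right root_spaceD scaleR_add_right)

lemma br_root_space:
  assumes "x \<in> rs \<xi>" "y \<in> rs \<eta>"
  shows "br x y \<in> rs (\<lambda>h. \<xi> h + \<eta> h)"
proof (rule root_spaceI)
  fix h assume "h \<in> a"
  then show "br h (br x y) = (\<xi> h + \<eta> h) *\<^sub>R br x y"
    unfolding br_br[of h x y] using assms
    by (simp add: root_spaceD br.scaleR_left br.scaleR_right scaleR_add_left)
qed

lemma theta_root_space:
  assumes "x \<in> rs \<xi>"
  shows "\<theta> x \<in> rs (\<lambda>h. - \<xi> h)"
proof (rule root_spaceI)
  fix h assume h: "h \<in> a"
  have "\<theta> (br h x) = - br h (\<theta> x)" using h by (simp add: theta_br a_theta br.minus_left)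
  moreover have "\<theta> (br h x) = \<xi> h *\<^sub>R \<theta> x"
    using root_spaceD[OF assms h] by (simp add: linear_cmul[OF linear_theta])
  ultimately show "br h (\<theta> x) = - \<xi> h *\<^sub>R \<theta> x" by (simp add: minus_equation_iff)
qed

lemma dual_on_eqI: "\<xi> \<in> dual_on a \<Longrightarrow> \<eta> \<in> dual_on a \<Longrightarrow> (\<And>h. h \<in> a \<Longrightarrow> \<xi> h = \<eta> h) \<Longrightarrow> \<xi> = \<eta>"
  by (rule ext) (metis (mono_tags, lifting) dual_on_def mem_Collect_eq)

lemma dual_on_add: "\<xi> \<in> dual_on a \<Longrightarrow> \<eta> \<in> dual_on a \<Longrightarrow> (\<lambda>h. \<xi> h + \<eta> h) \<in> dual_on a"
  and dual_on_uminus: "\<xi> \<in> dual_on a \<Longrightarrow> (\<lambda>h. - \<xi> h) \<in> dual_on a"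
  by (simp_all add: dual_on_def algebra_simps)

lemma bform_root_spaces:
  assumes "x \<in> rs \<xi>" "y \<in> rs \<eta>" "\<xi> \<in> dual_on a" "\<eta> \<in> dual_on a" "\<xi> \<noteq> \<eta>"
  shows "bform x y = 0"
proof -
  obtain h where h: "h \<in> a" "\<xi> h \<noteq> \<eta> h" using dual_on_eqI[OF assms(3,4)] assms(5) by blast
  have "\<xi> h * bform x y = \<eta> h * bform x y"
    using bform_a[OF h(1), of x y] root_spaceD[OF assms(1) h(1)] root_spaceD[OF assms(2) h(1)]
    by (simp add: bform.scaleR_left bform.scaleR_right)
  with h(2) show ?thesis by simp
qed

text \<open>The Rayleigh quotient is homogeneous of degree 0, so its maximum over \<open>W\<close>
  is attained on the compact unit sphere of the ambient norm. A maximiser is an eigenvector.\<close>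

lemma selfadjoint_eigenvector:
  assumes W: "subspace W" "W \<noteq> {0}" and T: "linear T" "\<And>w. w \<in> W \<Longrightarrow> T w \<in> W"
    and adj: "\<And>x y. bform (T x) y = bform x (T y)"
  obtains \<mu> w where "w \<in> W" "w \<noteq> 0" "T w = \<mu> *\<^sub>R w"
proof -
  let ?S = "sphere 0 1 \<inter> W"
  define f where "f w = bform (T w) w / bform w w" for w
  obtain w1 where w1: "w1 \<in> W" "w1 \<noteq> 0" using W subspace_0[OF W(1)] by blast
  have unit: "(1 / norm w) *\<^sub>R w \<in> ?S" if "w \<in> W" "w \<noteq> 0" for w
    using that subspace_scale[OF W(1)] by simp
  have "compact ?S" by (intro compact_Int_closed compact_sphere closed_subspace W)
  moreover have "?S \<noteq> {}" using unit[OF w1] by blast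
  moreover have "continuous_on ?S f"
    unfolding f_def
    by (intro continuous_on_divide bform.continuous_on continuous_on_id linear_continuous_on ballI)
      (use T(1) in \<open>auto simp: linear_conv_bounded_linear bform_eq_0_iff\<close>)
  ultimately obtain w0 where w0: "w0 \<in> ?S" "\<And>w. w \<in> ?S \<Longrightarrow> f w \<le> f w0"
    using continuous_attains_sup[of ?S f] by blast
  define \<mu> where "\<mu> = f w0"
  have "w0 \<in> W" "w0 \<noteq> 0" using w0(1) by auto
  \<comment> \<open>By the choice of \<mu>, \<open>q\<close> is positive semidefinite on
    \<open>W\<close> and vanishes at w0, so w0 is in its radical; testing against \<mu> w0 - T w0
    finishes.\<close>
  define q where "q u v = \<mu> * bform u v - bform (T u) v" for u v
  have q_nonneg: "q w w \<ge> 0" if "w \<in> W" for w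
  proof (cases "w = 0")
    case False
    have "f ((1 / norm w) *\<^sub>R w) = f w"
      using False by (simp add: f_def linear_cmul[OF T(1)] bform.scaleR_left bform.scaleR_right field_simps)
    then have "f w \<le> \<mu>" using w0(2)[OF unit[OF that False]] by (simp add: \<mu>_def)
    then show ?thesis using bform_pos[OF False] by (simp add: f_def q_def field_simps)
  qed (simp add: q_def bform.zero_right)
  have q0: "q w0 w0 = 0"
    using bform_pos[OF \<open>w0 \<noteq> 0\<close>] by (simp add: q_def \<mu>_def f_def)
  have q_sym: "q u v = q v u" for u v
    using adj[of u v] by (simp add: q_def bform_sym[of u] bform_sym[of v "T u"] bform_sym[of u v])
  have "q w0 v = 0" if v: "v \<in> W" for v
  proof -
    \<comment> \<open>The sign of \<open>q\<close> along the line w0 + t v; a quadratic in t without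
      constant term that is never negative has no linear term.\<close>
    have quad: "2 * t * q w0 v + t\<^sup>2 * q v v \<ge> 0" for t
    proof -
      have "w0 + t *\<^sub>R v \<in> W" by (intro subspace_add[OF W(1)] subspace_scale[OF W(1)] v \<open>w0 \<in> W\<close>)
      from q_nonneg[OF this] have "0 \<le> q (w0 + t *\<^sub>R v) (w0 + t *\<^sub>R v)" .
      also have "\<dots> = q w0 w0 + t * q w0 v + t * q v w0 + t\<^sup>2 * q v v"
        by (simp add: q_def linear_add[OF T(1)] linear_cmul[OF T(1)] bform.add_left bform.add_right
            bform.scaleR_left bform.scaleR_right algebra_simps power2_eq_square)
      finally show ?thesis using q0 q_sym[of v w0] by simp
    qed
    show ?thesis
    proof (cases "q v v = 0")
      case True
      then have "2 * (- q w0 v) * q w0 v \<ge> 0" using quad[of "- q w0 v"] by simp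
      then show ?thesis using zero_le_square[of "q w0 v"] by (auto simp: mult_le_0_iff)
    next
      case False
      then have pos: "q v v > 0" using q_nonneg[OF v] by simp
      have "2 * (- q w0 v / q v v) * q w0 v + (- q w0 v / q v v)\<^sup>2 * q v v = - ((q w0 v)\<^sup>2 / q v v)"
        using pos by (simp add: field_simps power2_eq_square)
      then have "(q w0 v)\<^sup>2 / q v v \<le> 0" using quad[of "- q w0 v / q v v"] by simp
      then have "(q w0 v)\<^sup>2 \<le> 0" using pos by (simp add: divide_le_0_iff)
      then show ?thesis by simp
    qed
  qed
  moreover have "\<mu> *\<^sub>R w0 - T w0 \<in> W"
    by (intro subspace_diff[OF W(1)] subspace_scale[OF W(1)] T(2) \<open>w0 \<in> W\<close>)
  ultimately have "q w0 (\<mu> *\<^sub>R w0 - T w0) = 0" by blast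
  then have "bform (\<mu> *\<^sub>R w0 - T w0) (\<mu> *\<^sub>R w0 - T w0) = 0"
    by (simp add: q_def bform.diff_left bform.scaleR_left)
  then have "T w0 = \<mu> *\<^sub>R w0" by (simp add: bform_eq_0_iff)
  with \<open>w0 \<in> W\<close> \<open>w0 \<noteq> 0\<close> show ?thesis by (rule that)
qed

text \<open>In an invariant subspace of least dimension each ad h is a scalar: an eigenspace of ad h
  is again invariant, because \<open>a\<close> is abelian, so it is everything.\<close>

lemma invariant_subspace_root_vector:
  assumes W: "subspace W" "W \<noteq> {0}" "\<And>h w. h \<in> a \<Longrightarrow> w \<in> W \<Longrightarrow> br h w \<in> W"
  obtains \<xi> w where "\<xi> \<in> dual_on a" "w \<in> W" "w \<noteq> 0" "w \<in> rs \<xi>"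
proof -
  define good where "good V \<longleftrightarrow> subspace V \<and> V \<noteq> {0} \<and> V \<subseteq> W \<and> (\<forall>h\<in>a. \<forall>w\<in>V. br h w \<in> V)" for V
  have "good W" using W by (simp add: good_def)
  then obtain V where V: "good V" "\<And>V'. good V' \<Longrightarrow> dim V \<le> dim V'"
    using ex_has_least_nat[of good W dim] by blast
  have sV: "subspace V" and V0: "V \<noteq> {0}" and VW: "V \<subseteq> W" and Va: "\<And>h w. h \<in> a \<Longrightarrow> w \<in> V \<Longrightarrow> br h w \<in> V"
    using V(1) by (auto simp: good_def)
  have "\<exists>\<mu>. \<forall>w\<in>V. br h w = \<mu> *\<^sub>R w" if h: "h \<in> a" for h
  proof -
    obtain \<mu> w where w: "w \<in> V" "w \<noteq> 0" "br h w = \<mu> *\<^sub>R w"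
      using selfadjoint_eigenvector[OF sV V0 linear_br Va[OF h] bform_a[OF h]] by blast
    define V' where "V' = {w \<in> V. br h w = \<mu> *\<^sub>R w}"
    have "subspace V'"
      unfolding V'_def subspace_def using sV
      by (auto simp: br.zero_right br.add_right br.scaleR_right scaleR_add_right subspace_0 subspace_add subspace_scale)
    moreover have "br h' v \<in> V'" if "h' \<in> a" "v \<in> V'" for h' v
    proof -
      have "br h (br h' v) = br h' (br h v)"
        unfolding br_br[of h h' v] using a_abelian[OF h that(1)] by (simp add: br.zero_left)
      then show ?thesis using that Va by (simp add: V'_def br.scaleR_right)
    qed
    moreover have "w \<in> V'" using w by (simp add: V'_def)
    ultimately have "good V'" using VW w(2) unfolding good_def V'_def by blast
    then have "V' = V"
      using V(2)[of V'] sV \<open>subspace V'\<close> by (intro subspace_dim_equal) (auto simp: V'_def)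
    then show ?thesis unfolding V'_def by blast
  qed
  then obtain \<mu> where \<mu>: "\<And>h w. h \<in> a \<Longrightarrow> w \<in> V \<Longrightarrow> br h w = \<mu> h *\<^sub>R w" by metis
  obtain w where w: "w \<in> V" "w \<noteq> 0" using V0 subspace_0[OF sV] by blast
  \<comment> \<open>The value 0 outside \<open>a\<close> is the convention required by
    \<open>dual_on\<close>.\<close>
  define \<xi> where "\<xi> h = (if h \<in> a then \<mu> h else 0)" for h
  have ev: "br h w = \<xi> h *\<^sub>R w" if "h \<in> a" for h using \<mu>[OF that w(1)] that by (simp add: \<xi>_def)
  have "\<xi> \<in> dual_on a"
    unfolding dual_on_def
  proof (intro CollectI conjI ballI allI impI)
    fix x y c assume x: "x \<in> a"
    have "c *\<^sub>R x \<in> a" by (rule subspace_scale[OF subspace_a x])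
    then have "\<xi> (c *\<^sub>R x) *\<^sub>R w = br (c *\<^sub>R x) w" by (rule ev[symmetric])
    also have "\<dots> = (c * \<xi> x) *\<^sub>R w" by (simp only: br.scaleR_left ev[OF x] scaleR_scaleR)
    finally show "\<xi> (c *\<^sub>R x) = c * \<xi> x" using w(2) by simp
    assume y: "y \<in> a"
    have "x + y \<in> a" by (rule subspace_add[OF subspace_a x y])
    then have "\<xi> (x + y) *\<^sub>R w = br (x + y) w" by (rule ev[symmetric])
    also have "\<dots> = (\<xi> x + \<xi> y) *\<^sub>R w" by (simp only: br.add_left ev[OF x] ev[OF y] scaleR_add_left)
    finally show "\<xi> (x + y) = \<xi> x + \<xi> y" using w(2) by simp
  qed (simp add: \<xi>_def)
  moreover have "w \<in> rs \<xi>" by (rule root_spaceI[OF ev])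
  ultimately show ?thesis using that w VW by blast
qed

text \<open>Otherwise the \<open>bform\<close>-orthogonal complement of the span is nonzero and
  stable under \<open>a\<close>, hence contains a root vector. That vector is also in the span, so
  it is orthogonal to itself.\<close>

lemma span_root_spaces: "span (\<Union>\<xi>\<in>dual_on a. rs \<xi>) = UNIV"
proof (rule ccontr)
  define K where "K = span (\<Union>\<xi>\<in>dual_on a. rs \<xi>)"
  assume "span (\<Union>\<xi>\<in>dual_on a. rs \<xi>) \<noteq> UNIV"
  then obtain v where "v \<notin> K" unfolding K_def by blast
  obtain y where y: "\<And>w. w \<in> K \<Longrightarrow> killing br w y = 0" "killing br v y \<noteq> 0"
    using killing_separation[OF _ \<open>v \<notin> K\<close>] unfolding K_def by (metis subspace_span)
  have Ka: "br h x \<in> K" if "h \<in> a" "x \<in> K" for h x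
    using that(2) unfolding K_def
  proof (induction rule: span_induct_alt)
    case (step c x y)
    have "br h (c *\<^sub>R x + y) = c *\<^sub>R br h x + br h y" by (simp add: br.add_right br.scaleR_right)
    moreover obtain \<xi> where \<xi>: "\<xi> \<in> dual_on a" "x \<in> rs \<xi>" using step(1) by blast
    have "x \<in> span (\<Union>\<xi>\<in>dual_on a. rs \<xi>)" using \<xi> by (blast intro: span_base)
    then have "br h x \<in> span (\<Union>\<xi>\<in>dual_on a. rs \<xi>)"
      unfolding root_spaceD[OF \<xi>(2) that(1)] by (rule span_scale)
    ultimately show ?case using step.IH by (simp add: span_add span_scale)
  qed (simp add: br.zero_right span_zero)
  define W where "W = {u. \<forall>x\<in>K. bform x u = 0}"
  have "subspace W"
    unfolding W_def subspace_def by (simp add: bform.zero_right bform.add_right bform.scaleR_right)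
  moreover have "W \<noteq> {0}"
  proof -
    have "\<theta> y \<in> W" using y(1) by (simp add: W_def bform_def)
    moreover have "\<theta> y \<noteq> 0"
    proof
      assume "\<theta> y = 0"
      then have "\<theta> (\<theta> y) = 0" using linear_0[OF linear_theta] by simp
      then show False using y(2) linear_0[OF linear_killing] by simp
    qed
    ultimately show ?thesis by blast
  qed
  moreover have "br h u \<in> W" if "h \<in> a" "u \<in> W" for h u
    using that Ka by (simp add: W_def flip: bform_a)
  ultimately obtain \<xi> w where w: "\<xi> \<in> dual_on a" "w \<in> W" "w \<noteq> 0" "w \<in> rs \<xi>"
    by (rule invariant_subspace_root_vector)
  have "w \<in> K" unfolding K_def using w(1,4) by (blast intro: span_base)
  then have "bform w w = 0" using w(2) by (simp add: W_def)
  with w(3) show False by (simp add: bform_eq_0_iff)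
qed

definition weights :: "('a \<Rightarrow> real) set" where
  "weights = {\<xi> \<in> dual_on a. rs \<xi> \<noteq> {0}}"

lemma weights_dual: "\<xi> \<in> weights \<Longrightarrow> \<xi> \<in> dual_on a"
  by (simp add: weights_def)

lemma restricted_roots_weights: "restricted_roots br a = weights - {\<lambda>_. 0}"
  by (auto simp: restricted_roots_def weights_def)

lemma weightsI: "\<xi> \<in> dual_on a \<Longrightarrow> x \<in> rs \<xi> \<Longrightarrow> x \<noteq> 0 \<Longrightarrow> \<xi> \<in> weights"
  by (auto simp: weights_def)

lemma weight_vector:
  assumes "\<xi> \<in> weights"
  obtains x where "x \<in> rs \<xi>" "x \<noteq> 0"
  using assms subspace_0[OF subspace_root_space[of \<xi>]] unfolding weights_def by blast

lemma weight_uminus: "\<xi> \<in> weights \<Longrightarrow> (\<lambda>h. - \<xi> h) \<in> weights"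
proof -
  assume "\<xi> \<in> weights"
  then obtain x where x: "x \<in> rs \<xi>" "x \<noteq> 0" by (rule weight_vector)
  have "\<theta> x \<noteq> 0" using x(2) linear_0[OF linear_theta] theta_theta by metis
  then show ?thesis
    using weightsI[OF dual_on_uminus theta_root_space] weights_dual[OF \<open>\<xi> \<in> weights\<close>] x(1) by blast
qed

text \<open>Root spaces of distinct functionals are \<open>bform\<close>-orthogonal, so a root
  vector of a weight missing from \<open>X\<close> would be orthogonal to the whole space.\<close>

lemma weight_in_spanning_set:
  assumes "span (\<Union>\<eta>\<in>X. rs \<eta>) = UNIV" "X \<subseteq> dual_on a" "\<xi> \<in> weights"
  shows "\<xi> \<in> X"
proof (rule ccontr)
  assume "\<xi> \<notin> X"
  obtain x where x: "x \<in> rs \<xi>" "x \<noteq> 0" using assms(3) by (rule weight_vector)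
  have "bform y x = 0" if "y \<in> span (\<Union>\<eta>\<in>X. rs \<eta>)" for y
    using that
  proof (induction rule: span_induct_alt)
    case (step c y z)
    then obtain \<eta> where \<eta>: "\<eta> \<in> X" "y \<in> rs \<eta>" by blast
    have "bform y x = 0"
      by (rule bform_root_spaces[OF \<eta>(2) x(1)]) (use \<eta>(1) \<open>\<xi> \<notin> X\<close> assms(2) weights_dual[OF assms(3)] in auto)
    then show ?case using step.IH by (simp add: bform.add_left bform.scaleR_left)
  qed (simp add: bform.zero_left)
  then have "bform x x = 0" using assms(1) by blast
  with x(2) show False by (simp add: bform_eq_0_iff)
qed

lemma root_space_decomposition_finite:
  "\<exists>X. finite X \<and> X \<subseteq> dual_on a \<and> v \<in> span (\<Union>\<xi>\<in>X. rs \<xi>)"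
proof -
  have "v \<in> span (\<Union>\<xi>\<in>dual_on a. rs \<xi>)" unfolding span_root_spaces by (rule UNIV_I)
  then show ?thesis
  proof (induction rule: span_induct_alt)
    case base
    show ?case by (intro exI[of _ "{}"]) (simp add: span_zero)
  next
    case (step c x y)
    obtain \<xi> where \<xi>: "\<xi> \<in> dual_on a" "x \<in> rs \<xi>" using step(1) by blast
    obtain X where X: "finite X" "X \<subseteq> dual_on a" "y \<in> span (\<Union>\<xi>\<in>X. rs \<xi>)" using step.IH by blast
    have "x \<in> span (\<Union>\<xi>\<in>insert \<xi> X. rs \<xi>)" by (rule span_base) (use \<xi>(2) in blast)
    moreover have "y \<in> span (\<Union>\<xi>\<in>insert \<xi> X. rs \<xi>)"
      by (rule subsetD[OF span_mono X(3)]) blast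
    ultimately have "c *\<^sub>R x + y \<in> span (\<Union>\<xi>\<in>insert \<xi> X. rs \<xi>)"
      by (intro span_add span_scale)
    moreover have "finite (insert \<xi> X)" "insert \<xi> X \<subseteq> dual_on a" using X \<xi>(1) by simp_all
    ultimately show ?case by blast
  qed
qed

text \<open>Finitely many functionals suffice for each basis vector, hence for the whole space, and
  every weight occurs in such a spanning family.\<close>

lemma finite_weights: "finite weights"
proof -
  obtain X where X: "\<And>v. finite (X v)" "\<And>v. X v \<subseteq> dual_on a" "\<And>v. v \<in> span (\<Union>\<xi>\<in>X v. rs \<xi>)"
    using root_space_decomposition_finite by metis
  define Y where "Y = (\<Union>b\<in>Basis. X b)"
  have Y: "finite Y" "Y \<subseteq> dual_on a" using X(1,2) by (auto simp: Y_def)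
  have "b \<in> span (\<Union>\<xi>\<in>Y. rs \<xi>)" if "b \<in> Basis" for b
    by (rule subsetD[OF span_mono X(3)[of b]]) (use that in \<open>auto simp: Y_def\<close>)
  then have "span (\<Union>\<xi>\<in>Y. rs \<xi>) = UNIV"
    using span_minimal[OF _ subspace_span, of Basis "\<Union>\<xi>\<in>Y. rs \<xi>"] by auto
  then have "weights \<subseteq> Y" using weight_in_spanning_set Y(2) by blast
  then show ?thesis using Y(1) by (rule finite_subset)
qed

lemma root_space_decomposition:
  obtains c where "\<And>\<xi>. c \<xi> \<in> rs \<xi>" "v = (\<Sum>\<xi>\<in>weights. c \<xi>)"
proof -
  have "v \<in> span (\<Union>\<xi>\<in>dual_on a. rs \<xi>)" unfolding span_root_spaces by (rule UNIV_I)
  then have "\<exists>c. (\<forall>\<xi>. c \<xi> \<in> rs \<xi>) \<and> v = (\<Sum>\<xi>\<in>weights. c \<xi>)"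
  proof (induction rule: span_induct_alt)
    case base
    show ?case by (rule exI[of _ "\<lambda>_. 0"]) (simp add: subspace_0[OF subspace_root_space])
  next
    case (step r x y)
    obtain \<eta> where \<eta>: "\<eta> \<in> dual_on a" "x \<in> rs \<eta>" using step(1) by blast
    obtain c where c: "\<forall>\<xi>. c \<xi> \<in> rs \<xi>" "y = (\<Sum>\<xi>\<in>weights. c \<xi>)" using step.IH by blast
    define c' where "c' \<xi> = (if \<xi> = \<eta> then r *\<^sub>R x else 0) + c \<xi>" for \<xi>
    have "c' \<xi> \<in> rs \<xi>" for \<xi>
      unfolding c'_def using c(1) \<eta>(2)
      by (intro subspace_add[OF subspace_root_space]) (auto intro: subspace_scale subspace_root_space subspace_0)
    moreover have "(\<Sum>\<xi>\<in>weights. c' \<xi>) = r *\<^sub>R x + y"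
    proof (cases "\<eta> \<in> weights")
      case False
      then have "x = 0" using \<eta> weightsI by blast
      then show ?thesis by (simp add: c'_def c(2) cong: if_cong)
    qed (simp add: c'_def c(2) sum.distrib finite_weights)
    ultimately show ?case by metis
  qed
  then show ?thesis using that by blast
qed

end

section \<open>Coroots and the highest root\<close>

context cartan_lie_algebra
begin

text \<open>The Killing dual of \<alpha>, without the usual factor 2 / (\<alpha>, \<alpha>). Thus
  \<alpha> takes the value (\<alpha>, \<alpha>) on it, and only signs and comparisons of values on
  it will count.\<close>

definition coroot :: "('a \<Rightarrow> real) \<Rightarrow> 'a" where
  "coroot \<alpha> = (SOME h. h \<in> a \<and> (\<forall>h'\<in>a. killing br h' h = \<alpha> h'))"

lemma bform_a_eq_killing: "h \<in> a \<Longrightarrow> bform h' h = killing br h' h"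
  using linear_neg[OF linear_killing] by (simp add: bform_def a_theta)

lemma a_eqI:
  assumes "h1 \<in> a" "h2 \<in> a" "\<And>h. h \<in> a \<Longrightarrow> killing br h h1 = killing br h h2"
  shows "h1 = h2"
proof -
  have d: "h1 - h2 \<in> a" by (rule subspace_diff[OF subspace_a assms(1,2)])
  have "bform (h1 - h2) (h1 - h2) = killing br (h1 - h2) h1 - killing br (h1 - h2) h2"
    unfolding bform_a_eq_killing[OF d] by (rule linear_diff[OF linear_killing])
  also have "\<dots> = 0" using assms(3)[OF d] by simp
  finally show ?thesis by (simp add: bform_eq_0_iff)
qed

text \<open>[x, \<theta> x] has weight zero and is negated by \<theta>; maximality of
  \<open>a\<close> catches exactly such elements.\<close>

lemma br_theta_in_a:
  assumes "x \<in> rs \<alpha>"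
  shows "br x (\<theta> x) \<in> a"
proof (rule in_a_if_centralizes)
  show "\<theta> (br x (\<theta> x)) = - br x (\<theta> x)"
    unfolding theta_br theta_theta by (rule br_antisym)
  fix h assume "h \<in> a"
  then show "br h (br x (\<theta> x)) = 0"
    using br_root_space[OF assms theta_root_space[OF assms]] by (simp add: root_space_def)
qed

lemma killing_br_theta:
  assumes "x \<in> rs \<alpha>" "h \<in> a"
  shows "killing br h (br x (\<theta> x)) = - bform x x * \<alpha> h"
proof -
  have "killing br h (br x (\<theta> x)) = killing br (\<alpha> h *\<^sub>R x) (\<theta> x)"
    unfolding killing_invariant[symmetric] root_spaceD[OF assms] ..
  also have "\<dots> = \<alpha> h * killing br x (\<theta> x)"
    unfolding killing_sym[of _ "\<theta> x"] by (simp add: linear_cmul[OF linear_killing])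
  finally show ?thesis by (simp add: bform_def)
qed

lemma coroot:
  assumes "\<alpha> \<in> weights"
  shows "coroot \<alpha> \<in> a" "\<And>h. h \<in> a \<Longrightarrow> killing br h (coroot \<alpha>) = \<alpha> h"
proof -
  obtain x where x: "x \<in> rs \<alpha>" "x \<noteq> 0" using assms by (rule weight_vector)
  \<comment> \<open>Invariance gives B(h', [x, \<theta> x]) = -\<open>bform x x\<close>
    \<alpha>(h'), which dictates the normalisation of the witness.\<close>
  define h where "h = (- 1 / bform x x) *\<^sub>R br x (\<theta> x)"
  have "h \<in> a" unfolding h_def by (rule subspace_scale[OF subspace_a br_theta_in_a[OF x(1)]])
  moreover have "killing br h' h = \<alpha> h'" if "h' \<in> a" for h'
    using killing_br_theta[OF x(1) that] bform_pos[OF x(2)]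
    by (simp add: h_def linear_cmul[OF linear_killing] linear_neg[OF linear_killing])
  ultimately have "\<exists>h. h \<in> a \<and> (\<forall>h'\<in>a. killing br h' h = \<alpha> h')" by blast
  then have "coroot \<alpha> \<in> a \<and> (\<forall>h'\<in>a. killing br h' (coroot \<alpha>) = \<alpha> h')"
    unfolding coroot_def by (rule someI_ex)
  then show "coroot \<alpha> \<in> a" "\<And>h. h \<in> a \<Longrightarrow> killing br h (coroot \<alpha>) = \<alpha> h" by blast+
qed

lemma coroot_sym:
  assumes "\<alpha> \<in> weights" "\<beta> \<in> weights"
  shows "\<alpha> (coroot \<beta>) = \<beta> (coroot \<alpha>)"
  using coroot(2)[OF assms(1) coroot(1)[OF assms(2)]] coroot(2)[OF assms(2) coroot(1)[OF assms(1)]]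
  by (simp add: killing_sym)

lemma coroot_pos:
  assumes "\<alpha> \<in> weights" "\<alpha> \<noteq> (\<lambda>_. 0)"
  shows "\<alpha> (coroot \<alpha>) > 0"
proof -
  have zero: "(\<lambda>_. 0) \<in> dual_on a" by (simp add: dual_on_def)
  have "coroot \<alpha> \<noteq> 0"
  proof
    assume 0: "coroot \<alpha> = 0"
    have "\<alpha> h = 0" if "h \<in> a" for h
      using coroot(2)[OF assms(1) that] linear_0[OF linear_killing] by (simp add: 0)
    then have "\<alpha> = (\<lambda>_. 0)" using dual_on_eqI[OF weights_dual[OF assms(1)] zero] by blast
    with assms(2) show False by blast
  qed
  then have "bform (coroot \<alpha>) (coroot \<alpha>) > 0" by (rule bform_pos)
  then show ?thesis
    using coroot[OF assms(1)] by (simp add: bform_a_eq_killing)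
qed

lemma br_theta_eq_coroot:
  assumes "\<alpha> \<in> weights" "x \<in> rs \<alpha>"
  shows "br x (\<theta> x) = - bform x x *\<^sub>R coroot \<alpha>"
proof (rule a_eqI)
  show "br x (\<theta> x) \<in> a" by (rule br_theta_in_a[OF assms(2)])
  show "- bform x x *\<^sub>R coroot \<alpha> \<in> a" by (rule subspace_scale[OF subspace_a coroot(1)[OF assms(1)]])
  fix h assume "h \<in> a"
  then show "killing br h (br x (\<theta> x)) = killing br h (- bform x x *\<^sub>R coroot \<alpha>)"
    using killing_br_theta[OF assms(2)] coroot(2)[OF assms(1)] by (simp only: linear_cmul[OF linear_killing] real_scaleR_def)
qed

text \<open>Polarisation of the formula for [x, \<theta> x]. For orthogonal x and y it becomes an
  antisymmetry, which the rotations of the highest root space rely on.\<close>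

lemma br_theta_polar:
  assumes "\<alpha> \<in> weights" "x \<in> rs \<alpha>" "y \<in> rs \<alpha>"
  shows "br x (\<theta> y) + br y (\<theta> x) = - (2 * bform x y) *\<^sub>R coroot \<alpha>"
proof -
  have "x + y \<in> rs \<alpha>" by (rule subspace_add[OF subspace_root_space assms(2,3)])
  note br_theta_eq_coroot[OF assms(1) this] br_theta_eq_coroot[OF assms(1,2)] br_theta_eq_coroot[OF assms(1,3)]
  then have "br x (\<theta> y) + (br y (\<theta> x) + (2 * bform x y) *\<^sub>R coroot \<alpha>) = 0"
    by (simp add: linear_add[OF linear_theta] br.add_left br.add_right bform.add_left bform.add_right
        bform_sym[of y x] algebra_simps)
  then show ?thesis by (simp add: eq_neg_iff_add_eq_0 add.assoc)
qed

text \<open>The sign of \<open>\<beta> (coroot \<alpha>)\<close> decides which of \<open>[x, y]\<close> and \<open>[\<theta> x, y]\<close> has to be nonzero; this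
  replaces the representation theory of \<open>sl(2)\<close>.\<close>

lemma norm_br_theta:
  assumes "\<alpha> \<in> weights" "x \<in> rs \<alpha>" "\<beta> \<in> weights" "y \<in> rs \<beta>"
  shows "bform (br (\<theta> x) y) (br (\<theta> x) y) =
    bform (br x y) (br x y) + bform x x * \<beta> (coroot \<alpha>) * bform y y"
proof -
  have 1: "br x (br (\<theta> x) y) = - (bform x x * \<beta> (coroot \<alpha>)) *\<^sub>R y + br (\<theta> x) (br x y)"
    unfolding br_br[of x "\<theta> x" y] br_theta_eq_coroot[OF assms(1,2)]
    by (simp add: br.scaleR_left br.minus_left root_spaceD[OF assms(4) coroot(1)[OF assms(1)]])
  have 2: "bform (br (\<theta> x) y) (br (\<theta> x) y) = - bform y (br x (br (\<theta> x) y))"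
    using bform_adjoint[of "\<theta> x" y "br (\<theta> x) y"] by simp
  have 3: "bform (br x y) (br x y) = - bform y (br (\<theta> x) (br x y))" by (rule bform_adjoint)
  show ?thesis unfolding 2 3 1 by (simp add: bform.add_right bform.diff_right bform.scaleR_right bform.minus_right)
qed

lemma weight_add:
  assumes "\<alpha> \<in> weights" "\<beta> \<in> weights" "\<beta> (coroot \<alpha>) < 0"
  shows "(\<lambda>h. \<alpha> h + \<beta> h) \<in> weights"
proof -
  obtain x where x: "x \<in> rs \<alpha>" "x \<noteq> 0" using assms(1) by (rule weight_vector)
  obtain y where y: "y \<in> rs \<beta>" "y \<noteq> 0" using assms(2) by (rule weight_vector)
  have "br x y \<noteq> 0"
  proof
    assume "br x y = 0"
    then have "bform (br (\<theta> x) y) (br (\<theta> x) y) = bform x x * \<beta> (coroot \<alpha>) * bform y y"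
      using norm_br_theta[OF assms(1) x(1) assms(2) y(1)] by (simp add: bform.zero_left)
    also have "\<dots> < 0" using bform_pos[OF x(2)] bform_pos[OF y(2)] assms(3)
      by (simp add: mult_pos_neg mult_neg_pos)
    finally show False using bform_pos[of "br (\<theta> x) y"] by (cases "br (\<theta> x) y = 0") (simp_all add: bform.zero_left)
  qed
  then show ?thesis
    using weightsI[OF dual_on_add br_root_space[OF x(1) y(1)]] assms(1,2) weights_dual by blast
qed

lemma weight_diff:
  assumes "\<alpha> \<in> weights" "\<beta> \<in> weights" "\<beta> (coroot \<alpha>) > 0"
  shows "(\<lambda>h. \<beta> h - \<alpha> h) \<in> weights"
proof -
  have "(\<lambda>h. - \<alpha> h) (coroot \<beta>) < 0" using coroot_sym[OF assms(1,2)] assms(3) by simp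
  from weight_add[OF assms(2) weight_uminus[OF assms(1)] this] show ?thesis by simp
qed

end

section \<open>Positive systems and the maximal root\<close>

inductive_set generated_module :: "('a::real_vector \<Rightarrow> 'a \<Rightarrow> 'a) \<Rightarrow> 'a set \<Rightarrow> 'a set \<Rightarrow> 'a set"
  for br N V where
  base: "v \<in> V \<Longrightarrow> v \<in> generated_module br N V"
| zero: "0 \<in> generated_module br N V"
| add: "x \<in> generated_module br N V \<Longrightarrow> y \<in> generated_module br N V \<Longrightarrow> x + y \<in> generated_module br N V"
| scale: "x \<in> generated_module br N V \<Longrightarrow> c *\<^sub>R x \<in> generated_module br N V"
| step: "f \<in> N \<Longrightarrow> x \<in> generated_module br N V \<Longrightarrow> br f x \<in> generated_module br N V"

lemma subspace_generated_module: "subspace (generated_module br N V)"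
  unfolding subspace_def
  by (auto intro: generated_module.zero generated_module.add generated_module.scale)

locale simple_cartan_lie_algebra = cartan_lie_algebra br \<theta> a
  for br :: "'a::euclidean_space \<Rightarrow> 'a \<Rightarrow> 'a" and \<theta> a +
  fixes P :: "('a \<Rightarrow> real) set"
  assumes ideal_trivial: "subspace I \<Longrightarrow> (\<And>x y. y \<in> I \<Longrightarrow> br x y \<in> I) \<Longrightarrow> I = {0} \<or> I = UNIV"
    and nonabelian: "\<exists>x y. br x y \<noteq> 0"
    and a_nontrivial: "a \<noteq> {0}"
    and positive: "positive_system (restricted_roots br a) P"
begin

lemma P_weights: "\<alpha> \<in> P \<Longrightarrow> \<alpha> \<in> weights" and P_nonzero: "\<alpha> \<in> P \<Longrightarrow> \<alpha> \<noteq> (\<lambda>_. 0)"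
  using positive by (auto simp: positive_system_def restricted_roots_weights)

lemma P_uminus: "\<alpha> \<in> P \<Longrightarrow> (\<lambda>h. - \<alpha> h) \<notin> P"
  using positive P_weights P_nonzero unfolding positive_system_def restricted_roots_weights by blast

lemma not_P_uminus: "\<alpha> \<in> weights \<Longrightarrow> \<alpha> \<noteq> (\<lambda>_. 0) \<Longrightarrow> \<alpha> \<notin> P \<Longrightarrow> (\<lambda>h. - \<alpha> h) \<in> P"
  using positive unfolding positive_system_def restricted_roots_weights by blast

lemma P_add_nonzero: "\<alpha> \<in> P \<Longrightarrow> \<beta> \<in> P \<Longrightarrow> (\<lambda>h. \<alpha> h + \<beta> h) \<noteq> (\<lambda>_. 0)"
proof
  assume P: "\<alpha> \<in> P" "\<beta> \<in> P" and 0: "(\<lambda>h. \<alpha> h + \<beta> h) = (\<lambda>_. 0)"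
  have "\<beta> h = - \<alpha> h" for h using fun_cong[OF 0, of h] by simp
  then have "\<beta> = (\<lambda>h. - \<alpha> h)" by (rule ext)
  then show False using P P_uminus[of \<alpha>] by simp
qed

lemma P_add: "\<alpha> \<in> P \<Longrightarrow> \<beta> \<in> P \<Longrightarrow> (\<lambda>h. \<alpha> h + \<beta> h) \<in> weights \<Longrightarrow> (\<lambda>h. \<alpha> h + \<beta> h) \<in> P"
  using positive P_add_nonzero unfolding positive_system_def restricted_roots_weights by blast

lemma finite_P: "finite P"
  by (rule finite_subset[OF _ finite_weights]) (use P_weights in blast)

text \<open>Without positive roots there are no roots at all, so \<open>a\<close> is central and
  hence a nonzero ideal. By simplicity it is everything, which contradicts nonabelianness.\<close>

lemma P_nonempty: "P \<noteq> {}"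
proof
  assume P: "P = {}"
  then have "weights \<subseteq> {\<lambda>_. 0}" using not_P_uminus by blast
  have "br h x = 0" if h: "h \<in> a" for h x
  proof -
    obtain c where c: "\<And>\<xi>. c \<xi> \<in> rs \<xi>" "x = (\<Sum>\<xi>\<in>weights. c \<xi>)" using root_space_decomposition[of x] by metis
    have "br h (c \<xi>) = 0" if "\<xi> \<in> weights" for \<xi>
      using root_spaceD[OF c(1) h, of \<xi>] that \<open>weights \<subseteq> {\<lambda>_. 0}\<close> by auto
    then show ?thesis unfolding c(2) by (simp add: br.sum_right)
  qed
  then have "br x h = 0" if "h \<in> a" for h x using that br_antisym[of x h] by simp
  then have "a = {0} \<or> a = UNIV"
    using subspace_0[OF subspace_a] by (intro ideal_trivial[OF subspace_a]) auto
  then have "a = UNIV" using a_nontrivial by blast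
  then show False using nonabelian a_abelian by blast
qed

text \<open>\<open>positive_system\<close> is axiomatic and comes with no linear functional positive
  on P, so this is proved by induction on length. If the sum vanished, evaluation at the coroot of
  the first root \<alpha> would produce some \<beta> negative there; \<alpha> + \<beta> is again
  positive and shortens the list.\<close>

lemma positive_list_sum_nonzero:
  assumes "set \<alpha>s \<subseteq> P" "\<alpha>s \<noteq> []"
  shows "\<exists>h. (\<Sum>\<alpha>\<leftarrow>\<alpha>s. \<alpha> h) \<noteq> 0"
  using assms
proof (induction "length \<alpha>s" arbitrary: \<alpha>s rule: less_induct)
  case less
  then obtain \<alpha> \<beta>s where \<alpha>s: "\<alpha>s = \<alpha> # \<beta>s" by (cases \<alpha>s) auto
  have \<alpha>: "\<alpha> \<in> P" and \<beta>s: "set \<beta>s \<subseteq> P" using less.prems(1) by (auto simp: \<alpha>s)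
  show ?case
  proof (rule ccontr)
    assume "\<nexists>h. (\<Sum>\<alpha>\<leftarrow>\<alpha>s. \<alpha> h) \<noteq> 0"
    then have zero: "\<alpha> h + (\<Sum>\<beta>\<leftarrow>\<beta>s. \<beta> h) = 0" for h by (simp add: \<alpha>s)
    have "\<exists>\<beta>\<in>set \<beta>s. \<beta> (coroot \<alpha>) < 0"
    proof (rule ccontr)
      assume "\<not> (\<exists>\<beta>\<in>set \<beta>s. \<beta> (coroot \<alpha>) < 0)"
      then have "(\<Sum>\<beta>\<leftarrow>\<beta>s. \<beta> (coroot \<alpha>)) \<ge> 0" by (intro sum_list_nonneg) auto
      then show False using zero[of "coroot \<alpha>"] coroot_pos[OF P_weights[OF \<alpha>] P_nonzero[OF \<alpha>]] by simp
    qed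
    then obtain \<beta> where \<beta>: "\<beta> \<in> set \<beta>s" "\<beta> (coroot \<alpha>) < 0" by blast
    have "\<beta> \<in> P" using \<beta>(1) \<beta>s by blast
    then have sum: "(\<lambda>h. \<alpha> h + \<beta> h) \<in> P"
      using P_add[OF \<alpha> \<open>\<beta> \<in> P\<close> weight_add[OF P_weights[OF \<alpha>] P_weights[OF \<open>\<beta> \<in> P\<close>] \<beta>(2)]] by blast
    define \<gamma>s where "\<gamma>s = (\<lambda>h. \<alpha> h + \<beta> h) # remove1 \<beta> \<beta>s"
    have "length \<gamma>s < length \<alpha>s"
      using \<beta>(1) by (simp add: \<gamma>s_def \<alpha>s length_remove1) (metis Suc_pred length_pos_if_in_set lessI)
    moreover have "set \<gamma>s \<subseteq> P"
      using sum \<beta>s set_remove1_subset[of \<beta> \<beta>s] by (auto simp: \<gamma>s_def)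
    moreover have "\<gamma>s \<noteq> []" by (simp add: \<gamma>s_def)
    ultimately obtain h where "(\<Sum>\<gamma>\<leftarrow>\<gamma>s. \<gamma> h) \<noteq> 0" using less.hyps by blast
    then show False
      using zero[of h] sum_list_map_remove1[OF \<beta>(1), of "\<lambda>\<beta>. \<beta> h"] by (simp add: \<gamma>s_def)
  qed
qed

text \<open>If a positive root could always be added, iteration in the finite set \<open>P\<close>
  would return to an earlier root, and the roots added in between would have sum zero.\<close>

lemma maximal_positive_root:
  obtains lam where "lam \<in> P" "\<And>\<beta>. \<beta> \<in> P \<Longrightarrow> (\<lambda>h. lam h + \<beta> h) \<notin> weights"
proof (rule ccontr)
  assume "\<not> thesis"
  with that have no': "\<exists>\<beta>\<in>P. (\<lambda>h. lam h + \<beta> h) \<in> weights" if "lam \<in> P" for lam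
    using that by blast
  have "\<exists>\<beta>\<in>P. (\<lambda>h. lam h + \<beta> h) \<in> P" if "lam \<in> P" for lam
    using no' P_add[OF that] that by blast
  then obtain b where b: "\<And>lam. lam \<in> P \<Longrightarrow> b lam \<in> P" "\<And>lam. lam \<in> P \<Longrightarrow> (\<lambda>h. lam h + b lam h) \<in> P"
    by metis
  obtain lam0 where "lam0 \<in> P" using P_nonempty by blast
  define f where "f n = ((\<lambda>\<eta> h. \<eta> h + b \<eta> h) ^^ n) lam0" for n
  have fP: "f n \<in> P" for n
    by (induction n) (simp_all add: f_def \<open>lam0 \<in> P\<close> b(2))
  have fSuc: "f (Suc n) h = f n h + b (f n) h" for n h by (simp add: f_def)
  have diff: "f (i + j) h = f i h + (\<Sum>\<alpha>\<leftarrow>map (\<lambda>k. b (f k)) [i..<i + j]. \<alpha> h)" for i j h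
    by (induction j) (simp_all add: fSuc)
  have "\<not> inj f" using finite_P fP finite_subset[of "range f" P] finite_imageD[of f UNIV] by auto
  then obtain i j where "i < j" "f i = f j" by (metis injI linorder_neqE_nat)
  then obtain d where d: "j = i + d" "d > 0" by (metis add_diff_cancel_left' less_imp_add_positive)
  have "(\<Sum>\<alpha>\<leftarrow>map (\<lambda>k. b (f k)) [i..<i + d]. \<alpha> h) = 0" for h
    using diff[of i d h] \<open>f i = f j\<close> d(1) by simp
  moreover have "set (map (\<lambda>k. b (f k)) [i..<i + d]) \<subseteq> P" using fP b(1) by auto
  moreover have "map (\<lambda>k. b (f k)) [i..<i + d] \<noteq> []" using d(2) by simp
  ultimately show False using positive_list_sum_nonzero by metis
qed

context
  fixes lam
  assumes lam_P: "lam \<in> P" and lam_max: "\<And>\<beta>. \<beta> \<in> P \<Longrightarrow> (\<lambda>h. lam h + \<beta> h) \<notin> weights"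
begin

lemma lam_weight: "lam \<in> weights" and lam_pos: "lam (coroot lam) > 0"
  using P_weights[OF lam_P] coroot_pos[OF P_weights[OF lam_P] P_nonzero[OF lam_P]] by simp_all

lemma lam_dominant: "\<beta> \<in> P \<Longrightarrow> \<beta> (coroot lam) \<ge> 0"
  using weight_add[OF lam_weight P_weights] lam_max by (meson not_le)

lemma root_space_lam_killed:
  assumes "\<beta> \<in> P" "x \<in> rs \<beta>" "y \<in> rs lam"
  shows "br x y = 0"
proof (rule ccontr)
  assume "br x y \<noteq> 0"
  then have "(\<lambda>h. \<beta> h + lam h) \<in> weights"
    using weightsI[OF dual_on_add br_root_space[OF assms(2,3)]] weights_dual lam_weight P_weights[OF assms(1)] by blast
  with lam_max[OF assms(1)] show False by (simp add: add.commute)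
qed

text \<open>Only maximality under adding a positive root is known of \<open>lam\<close> here. A
  counterexample \<mu> makes \<beta> = lam - \<mu> a positive root orthogonal to \<open>lam\<close>;
  then \<beta> is negatively paired with \<mu> but cannot raise it to \<open>lam\<close>,
  contradicting the norm identity.\<close>

lemma lam_strict:
  assumes \<mu>: "\<mu> \<in> weights" "\<mu> \<noteq> lam"
  shows "\<mu> (coroot lam) < lam (coroot lam)"
proof (rule ccontr)
  assume "\<not> \<mu> (coroot lam) < lam (coroot lam)"
  then have ge: "\<mu> (coroot lam) \<ge> lam (coroot lam)" by simp
  define \<beta> where "\<beta> = (\<lambda>h. lam h - \<mu> h)"
  have diff: "(\<lambda>h. \<mu> h - lam h) \<in> weights" by (rule weight_diff[OF lam_weight \<mu>(1)]) (use ge lam_pos in linarith)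
  have nz: "(\<lambda>h. \<mu> h - lam h) \<noteq> (\<lambda>_. 0)"
  proof
    assume "(\<lambda>h. \<mu> h - lam h) = (\<lambda>_. 0)"
    then have "\<mu> = lam" by (simp add: fun_eq_iff)
    with \<mu>(2) show False by blast
  qed
  have "(\<lambda>h. \<mu> h - lam h) \<notin> P" using lam_max[of "\<lambda>h. \<mu> h - lam h"] \<mu>(1) by auto
  \<comment> \<open>\<mu> - lam is not positive, since adding it to \<open>lam\<close> gives the
    weight \<mu>; so its negative is.\<close>
  from not_P_uminus[OF diff nz this] have \<beta>: "\<beta> \<in> P" by (simp add: \<beta>_def)
  note \<beta>w = P_weights[OF \<beta>]
  have "\<beta> (coroot lam) = 0" using lam_dominant[OF \<beta>] ge by (simp add: \<beta>_def)
  then have lam\<beta>: "lam (coroot \<beta>) = 0" using coroot_sym[OF lam_weight \<beta>w] by simp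
  have "\<mu> (coroot \<beta>) = - \<beta> (coroot \<beta>)" using lam\<beta> by (simp add: \<beta>_def)
  then have neg: "\<mu> (coroot \<beta>) < 0" using coroot_pos[OF \<beta>w P_nonzero[OF \<beta>]] by simp
  obtain x where x: "x \<in> rs \<beta>" "x \<noteq> 0" using \<beta>w by (rule weight_vector)
  obtain w where w: "w \<in> rs \<mu>" "w \<noteq> 0" using \<mu>(1) by (rule weight_vector)
  \<comment> \<open>z lies in the highest root space. Orthogonality of \<beta> and
    \<open>lam\<close> gives [\<theta> x, z] = 0, and the adjoint relation then gives z = 0.\<close>
  define z where "z = br x w"
  have z: "z \<in> rs lam" using br_root_space[OF x(1) w(1)] by (simp add: z_def \<beta>_def)
  have "bform (br (\<theta> x) z) (br (\<theta> x) z) = 0"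
    using norm_br_theta[OF \<beta>w x(1) lam_weight z] root_space_lam_killed[OF \<beta> x(1) z] lam\<beta>
    by (simp add: bform.zero_left)
  then have "br (\<theta> x) z = 0" by (simp add: bform_eq_0_iff)
  then have "bform z z = 0"
    using bform_adjoint[of x w z] by (simp add: z_def bform.zero_right)
  then have "bform (br (\<theta> x) w) (br (\<theta> x) w) = bform x x * \<mu> (coroot \<beta>) * bform w w"
    using norm_br_theta[OF \<beta>w x(1) \<mu>(1) w(1)] by (simp add: z_def)
  also have "\<dots> < 0" using bform_pos[OF x(2)] bform_pos[OF w(2)] neg
    by (simp add: mult_pos_neg mult_neg_pos)
  finally show False using bform_pos[of "br (\<theta> x) w"] by (cases "br (\<theta> x) w = 0") (simp_all add: bform.zero_left)
qed

text \<open>The generated module is an ideal because the positive root spaces annihilate \<open>rs lam\<close>.\<close>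

lemma generated_by_lam: "generated_module br (\<Union>\<xi>\<in>weights - P. rs \<xi>) (rs lam) = UNIV"
proof -
  let ?N = "\<Union>\<xi>\<in>weights - P. rs \<xi>"
  let ?M = "generated_module br ?N (rs lam)"
  have "br e m \<in> ?M" if "m \<in> ?M" for e m
    using that
  proof (induction arbitrary: e rule: generated_module.induct)
    case (base v)
    obtain c where c: "\<And>\<xi>. c \<xi> \<in> rs \<xi>" "e = (\<Sum>\<xi>\<in>weights. c \<xi>)" using root_space_decomposition[of e] by metis
    have "br (c \<xi>) v \<in> ?M" if "\<xi> \<in> weights" for \<xi>
    proof (cases "\<xi> \<in> P")
      case True
      then show ?thesis using root_space_lam_killed[OF True c(1) base] by (simp add: generated_module.zero)
    next
      case False
      with that c(1) have "c \<xi> \<in> ?N" by blast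
      then show ?thesis by (rule generated_module.step[OF _ generated_module.base[OF base]])
    qed
    then have "(\<Sum>\<xi>\<in>weights. br (c \<xi>) v) \<in> ?M" by (rule subspace_sum[OF subspace_generated_module])
    then show ?case by (simp add: c(2) br.sum_left)
  next
    \<comment> \<open>The element e is arbitrary in the induction hypothesis, so Jacobi handles both
      [e, f] acting on x and f acting on [e, x].\<close>
    case (step f x)
    have "br (br e f) x + br f (br e x) \<in> ?M"
      by (intro generated_module.add step.IH generated_module.step[OF step.hyps(1)])
    then show ?case by (simp only: br_br[of e f x])
  qed (simp_all add: br.zero_right br.add_right br.scaleR_right generated_module.zero generated_module.add generated_module.scale)
  then have "?M = {0} \<or> ?M = UNIV" by (intro ideal_trivial subspace_generated_module) auto
  moreover obtain v where "v \<in> rs lam" "v \<noteq> 0" using lam_weight by (rule weight_vector)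
  then have "?M \<noteq> {0}" using generated_module.base[of v "rs lam" br ?N] by blast
  ultimately show ?thesis by blast
qed

text \<open>The root spaces of functionals of the form \<open>lam\<close> minus a sum of positive
  roots span a subspace that contains \<open>rs lam\<close> and is stable under the nonpositive root
  spaces. It is therefore the whole algebra, and each weight must be of this form.\<close>

lemma lam_highest:
  assumes "\<eta> \<in> weights"
  shows "\<exists>m :: ('a \<Rightarrow> real) \<Rightarrow> nat. \<forall>h. lam h - \<eta> h = (\<Sum>\<alpha>\<in>P. real (m \<alpha>) * \<alpha> h)"
proof -
  define X where "X = {\<eta> \<in> dual_on a. \<exists>m :: ('a \<Rightarrow> real) \<Rightarrow> nat. \<forall>h. lam h - \<eta> h = (\<Sum>\<alpha>\<in>P. real (m \<alpha>) * \<alpha> h)}"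
  let ?K = "span (\<Union>\<eta>\<in>X. rs \<eta>)"
  have "x \<in> ?K" if "x \<in> generated_module br (\<Union>\<xi>\<in>weights - P. rs \<xi>) (rs lam)" for x
    using that
  proof (induction rule: generated_module.induct)
    case (base v)
    have "lam \<in> X"
      unfolding X_def using weights_dual[OF lam_weight] by (auto intro!: exI[of _ "\<lambda>_. 0"])
    with base show ?case by (blast intro: span_base)
  next
    case (step f x)
    then obtain \<xi> where \<xi>: "\<xi> \<in> weights" "\<xi> \<notin> P" "f \<in> rs \<xi>" by blast
    have X: "(\<lambda>h. \<xi> h + \<eta> h) \<in> X" if "\<eta> \<in> X" for \<eta>
    proof -
      obtain m :: "('a \<Rightarrow> real) \<Rightarrow> nat" where m: "\<And>h. lam h - \<eta> h = (\<Sum>\<alpha>\<in>P. real (m \<alpha>) * \<alpha> h)"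
        using \<open>\<eta> \<in> X\<close> unfolding X_def by blast
      have "\<exists>m :: ('a \<Rightarrow> real) \<Rightarrow> nat. \<forall>h. lam h - (\<xi> h + \<eta> h) = (\<Sum>\<alpha>\<in>P. real (m \<alpha>) * \<alpha> h)"
      proof (cases "\<xi> = (\<lambda>_. 0)")
        case True
        then show ?thesis using m by auto
      next
        case False
        \<comment> \<open>Applying a root space of \<xi> = -\<nu> subtracts the positive root \<nu>
          once more, so only its multiplicity grows by one.\<close>
        define \<nu> where "\<nu> = (\<lambda>h. - \<xi> h)"
        have \<nu>: "\<nu> \<in> P" unfolding \<nu>_def by (rule not_P_uminus[OF \<xi>(1) False \<xi>(2)])
        have "(\<Sum>\<alpha>\<in>P. real ((m(\<nu> := Suc (m \<nu>))) \<alpha>) * \<alpha> h) = (\<Sum>\<alpha>\<in>P. real (m \<alpha>) * \<alpha> h + (if \<alpha> = \<nu> then \<nu> h else 0))" for h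
          by (rule sum.cong) (auto simp: algebra_simps)
        then have "lam h - (\<xi> h + \<eta> h) = (\<Sum>\<alpha>\<in>P. real ((m(\<nu> := Suc (m \<nu>))) \<alpha>) * \<alpha> h)" for h
          using m[of h] \<nu> finite_P by (simp add: sum.distrib \<nu>_def algebra_simps)
        then show ?thesis by blast
      qed
      moreover have "(\<lambda>h. \<xi> h + \<eta> h) \<in> dual_on a"
        using that weights_dual[OF \<xi>(1)] by (intro dual_on_add) (auto simp: X_def)
      ultimately show ?thesis by (simp add: X_def)
    qed
    show ?case
      using step.IH
    proof (induction rule: span_induct_alt)
      case (step c u v)
      then obtain \<eta> where \<eta>: "\<eta> \<in> X" "u \<in> rs \<eta>" by blast
      have "br f u \<in> ?K" using X[OF \<eta>(1)] br_root_space[OF \<xi>(3) \<eta>(2)] by (blast intro: span_base)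
      then show ?case using step.IH by (simp add: br.add_right br.scaleR_right span_add span_scale)
    qed (simp add: br.zero_right span_zero)
  qed (simp_all add: span_zero span_add span_scale)
  then have "?K = UNIV" unfolding generated_by_lam by blast
  then have "\<eta> \<in> X" by (rule weight_in_spanning_set[OF _ _ assms]) (simp add: X_def)
  then show ?thesis by (simp add: X_def)
qed

text \<open>For uniqueness, a competitor exceeds \<open>lam\<close> by a sum of positive roots,
  which is nonnegative on the coroot of \<open>lam\<close> by dominance; strictness of the maximum
  there forces equality.\<close>

lemma highest_root_eq_lam: "highest_root P = lam"
  unfolding highest_root_def
proof (rule the_equality)
  show "lam \<in> P \<and> (\<forall>\<eta>\<in>P. \<exists>m :: ('a \<Rightarrow> real) \<Rightarrow> nat. \<forall>h. lam h - \<eta> h = (\<Sum>\<alpha>\<in>P. real (m \<alpha>) * \<alpha> h))"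
    using lam_P lam_highest P_weights by blast
  fix \<xi> assume \<xi>: "\<xi> \<in> P \<and> (\<forall>\<eta>\<in>P. \<exists>m :: ('a \<Rightarrow> real) \<Rightarrow> nat. \<forall>h. \<xi> h - \<eta> h = (\<Sum>\<alpha>\<in>P. real (m \<alpha>) * \<alpha> h))"
  then obtain m :: "('a \<Rightarrow> real) \<Rightarrow> nat" where m: "\<And>h. \<xi> h - lam h = (\<Sum>\<alpha>\<in>P. real (m \<alpha>) * \<alpha> h)"
    using lam_P by blast
  have "(\<Sum>\<alpha>\<in>P. real (m \<alpha>) * \<alpha> (coroot lam)) \<ge> 0"
    by (rule sum_nonneg, rule mult_nonneg_nonneg[OF of_nat_0_le_iff lam_dominant])
  then have "\<xi> (coroot lam) \<ge> lam (coroot lam)" using m[of "coroot lam"] by simp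
  then show "\<xi> = lam" using lam_strict[of \<xi>] P_weights \<xi> by force
qed

end

lemma highest_root:
  "highest_root P \<in> P" "\<beta> \<in> P \<Longrightarrow> (\<lambda>h. highest_root P h + \<beta> h) \<notin> weights"
proof -
  obtain lam where lam: "lam \<in> P" "\<And>\<beta>. \<beta> \<in> P \<Longrightarrow> (\<lambda>h. lam h + \<beta> h) \<notin> weights"
    using maximal_positive_root by metis
  have eq: "highest_root P = lam" by (rule highest_root_eq_lam[OF lam(1)]) (rule lam(2))
  show "highest_root P \<in> P" unfolding eq by (rule lam(1))
  show "\<beta> \<in> P \<Longrightarrow> (\<lambda>h. highest_root P h + \<beta> h) \<notin> weights" unfolding eq by (rule lam(2))
qed

end

section \<open>The minimal orbit\<close>

lemma (in euclidean_lie_algebra) nilpotent_cone_Int_group: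
  assumes "g \<in> Int_group br" "v \<in> nilpotent_cone br"
  shows "g v \<in> nilpotent_cone br"
proof -
  obtain n where n: "\<And>y. (br v ^^ n) y = 0" using assms(2) unfolding nilpotent_cone_def by blast
  obtain g' where g': "\<And>y. g (g' y) = y" using Int_group_inverse[OF assms(1)] by metis
  have pow: "(br (g v) ^^ n) (g y) = g ((br v ^^ n) y)" for n y
    by (induction n) (simp_all add: Int_group_br[OF assms(1)])
  have "(br (g v) ^^ n) y = 0" for y
    using pow[of n "g' y"] linear_0[OF linear_Int_group[OF assms(1)]] by (simp add: n g')
  then show ?thesis unfolding nilpotent_cone_def by blast
qed

context complexified_lie_algebra
begin

lemma nilpotent_of_real_form: "of_real_form x \<in> nilpotent_cone adC \<longleftrightarrow> x \<in> nilpotent_cone br"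
proof -
  have pow: "(adC (of_real_form x) ^^ n) v = ((br x ^^ n) (fst v), (br x ^^ n) (snd v))" for n v
    by (induction n) (simp_all add: cbr_of_real_form_left)
  have "(\<forall>v. (adC (of_real_form x) ^^ n) v = 0) \<longleftrightarrow> (\<forall>y. (br x ^^ n) y = 0)" for n
    unfolding pow zero_prod_def by simp
  then show ?thesis by (simp add: nilpotent_cone_def)
qed

lemma range_cbr_of_real_form: "z \<in> range (adC (of_real_form x)) \<longleftrightarrow> fst z \<in> range (br x) \<and> snd z \<in> range (br x)"
proof
  assume "fst z \<in> range (br x) \<and> snd z \<in> range (br x)"
  then obtain u v where "fst z = br x u" "snd z = br x v" by blast
  then have "z = adC (of_real_form x) (u, v)" by (simp add: cbr_of_real_form_left prod_eq_iff)
  then show "z \<in> range (adC (of_real_form x))" by blast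
qed (auto simp: cbr_of_real_form_left)

end

context cartan_lie_algebra
begin

sublocale complexified_lie_algebra br ..

text \<open>For real x the complex ad-range consists of pairs of elements of the real one, so
  regularity can be checked on real and imaginary parts separately.\<close>

lemma neutral_element_complex:
  assumes "x \<in> nilpotent_cone br"
  obtains h where "br h x = 2 *\<^sub>R x" "adC (of_real_form h) (of_real_form x) = 2 *\<^sub>R of_real_form x"
    "\<And>z. adC (of_real_form h) z - 2 *\<^sub>R z \<in> range (adC (of_real_form x)) \<Longrightarrow> z \<in> range (adC (of_real_form x))"
proof -
  obtain f h where h: "h = br x f" "br h x = 2 *\<^sub>R x" 
    by (rule neutral_element[OF assms]) (rule that, assumption+)
  show ?thesis
  proof (rule that[OF h(2)])
    show "adC (of_real_form h) (of_real_form x) = 2 *\<^sub>R of_real_form x"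
      unfolding cbr_of_real_form h(2) by (simp add: of_real_form_def)
    fix z assume "adC (of_real_form h) z - 2 *\<^sub>R z \<in> range (adC (of_real_form x))"
    then have "br h (fst z) - 2 *\<^sub>R fst z \<in> range (br x)" "br h (snd z) - 2 *\<^sub>R snd z \<in> range (br x)"
      unfolding range_cbr_of_real_form cbr_of_real_form_left by (simp_all only: fst_diff snd_diff fst_scaleR snd_scaleR fst_conv snd_conv)
    from this[THEN neutral_element_regular[OF assms h]]
    show "z \<in> range (adC (of_real_form x))" unfolding range_cbr_of_real_form ..
  qed
qed

text \<open>Since [h, x] = 2 x, the element (ln c / 2) h exponentiates to multiplication of x by
  c.\<close>

lemma real_orbit_scale:
  assumes x: "x \<in> nilpotent_cone br" and y: "y \<in> Int_orbit adC (of_real_form x)" and c: "c > 0"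
  shows "c *\<^sub>R y \<in> Int_orbit adC (of_real_form x)"
proof -
  obtain h where h: "adC (of_real_form h) (of_real_form x) = 2 *\<^sub>R of_real_form x"
    using neutral_element_complex[OF x] by metis
  obtain g where g: "g \<in> Int_group adC" "y = g (of_real_form x)" using y unfolding Int_orbit_def by blast
  have "adC ((ln c / 2) *\<^sub>R of_real_form h) (of_real_form x) = ln c *\<^sub>R of_real_form x"
    by (simp add: C.br.scaleR_left h)
  from exp_op_eigenvector[OF C.linear_br this]
  have "exp_op (adC ((ln c / 2) *\<^sub>R of_real_form h)) (of_real_form x) = c *\<^sub>R of_real_form x" using c by simp
  then have "c *\<^sub>R of_real_form x \<in> Int_orbit adC (of_real_form x)"
    using C.Int_orbit_exp[OF C.Int_orbit_refl] by metis
  from C.Int_orbit_group[OF this g(1)] show ?thesis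
    by (simp add: g(2) linear_cmul[OF C.linear_Int_group[OF g(1)]])
qed

end

section \<open>The orbit of the highest root vectors\<close>

context simple_cartan_lie_algebra
begin

abbreviation (input) "hr \<equiv> highest_root P"
abbreviation (input) "H \<equiv> coroot hr"

lemma hr_weight: "hr \<in> weights"
  by (rule P_weights[OF highest_root(1)])

lemma hr_pos: "hr H > 0"
  by (rule lam_pos[OF highest_root])

lemma hr_strict: "\<mu> \<in> weights \<Longrightarrow> \<mu> \<noteq> hr \<Longrightarrow> \<mu> H < hr H"
  by (rule lam_strict[OF highest_root])

lemma H_in_a: "H \<in> a"
  by (rule coroot(1)[OF hr_weight])

lemma weight_le_hr: "\<mu> \<in> weights \<Longrightarrow> \<mu> H \<le> hr H"
  using hr_strict[of \<mu>] by (cases "\<mu> = hr") auto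

lemma root_space_large:
  assumes "\<xi> \<in> dual_on a" "\<xi> H > hr H" "x \<in> rs \<xi>"
  shows "x = 0"
  using weightsI[OF assms(1,3)] weight_le_hr assms(2) by force

lemma hr_root_space_nilpotent:
  assumes x: "x \<in> rs hr"
  shows "x \<in> nilpotent_cone br"
proof -
  have "br x (br x (br x v)) = 0" for v
  proof -
    obtain c where c: "\<And>\<xi>. c \<xi> \<in> rs \<xi>" "v = (\<Sum>\<xi>\<in>weights. c \<xi>)" using root_space_decomposition[of v] by metis
    have "br x (br x (br x (c \<xi>))) = 0" if \<xi>: "\<xi> \<in> weights" for \<xi>
    proof (rule root_space_large)
      show "br x (br x (br x (c \<xi>))) \<in> rs (\<lambda>h. hr h + (hr h + (hr h + \<xi> h)))"
        by (intro br_root_space x c(1))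
      show "(\<lambda>h. hr h + (hr h + (hr h + \<xi> h))) \<in> dual_on a"
        by (intro dual_on_add weights_dual hr_weight \<xi>)
      \<comment> \<open>Every weight is at least -hr(H) on H, so three steps reach at least 2 hr(H),
        past the maximum; two steps could still land on \<open>hr\<close> itself.\<close>
      show "hr H + (hr H + (hr H + \<xi> H)) > hr H"
        using weight_le_hr[OF weight_uminus[OF \<xi>]] hr_pos by simp
    qed
    then show ?thesis by (simp add: c(2) br.sum_right)
  qed
  then have "\<forall>v. (br x ^^ 3) v = 0" by (simp add: numeral_3_eq_3)
  then show ?thesis unfolding nilpotent_cone_def by blast
qed

text \<open>A complex multiple of H, chosen with the complex logarithm of c, acts on x with
  eigenvalue \<open>Ln c\<close>. Negative factors are reached this way, which real multiples of H
  cannot do.\<close>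

lemma hr_orbit_scale:
  assumes "x \<in> rs hr" "c \<noteq> 0"
  shows "cscale c (of_real_form x) \<in> Int_orbit adC (of_real_form x)"
proof -
  let ?u = "cscale (Ln c / of_real (hr H)) (of_real_form H)"
  have "adC ?u (of_real_form x) = cscale (Ln c / of_real (hr H)) (cscale (of_real (hr H)) (of_real_form x))"
    using root_spaceD[OF assms(1) H_in_a] unfolding cbr_cscale_left cbr_of_real_form cscale_of_real
    by (simp add: of_real_form_def)
  also have "\<dots> = cscale (Ln c) (of_real_form x)" using hr_pos by simp
  finally have "adC ?u (of_real_form x) = cscale (Ln c) (of_real_form x)" .
  from exp_op_eigenvector_complex[OF this]
  have "exp_op (adC ?u) (of_real_form x) = cscale c (of_real_form x)" by (simp only: exp_Ln[OF assms(2)])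
  then show ?thesis using C.Int_orbit_exp[OF C.Int_orbit_refl] by metis
qed

lemma br_hr_hr:
  assumes "x \<in> rs hr" "y \<in> rs hr"
  shows "br x y = 0"
  by (rule root_space_lam_killed[OF highest_root highest_root(1) assms])

text \<open>For orthogonal \<open>x\<close>, \<open>z\<close> of equal length in the highest root space, \<open>ad [\<theta> x, z]\<close> generates the
  rotations of the plane spanned by \<open>x\<close> and \<open>z\<close>; over the complex numbers \<open>x \<mp> \<i> z\<close> are eigenvectors.\<close>

lemma hr_orbit_rotate:
  assumes x: "x \<in> rs hr" "x \<noteq> 0" and z: "z \<in> rs hr" and orth: "bform x z = 0" and eq: "bform z z = bform x x"
  shows "of_real_form (cos t *\<^sub>R x + sin t *\<^sub>R z) \<in> Int_orbit adC (of_real_form x)"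
proof -
  define \<kappa> where "\<kappa> = bform x x * hr H"
  have \<kappa>: "\<kappa> > 0" unfolding \<kappa>_def by (rule mult_pos_pos[OF bform_pos[OF x(2)] hr_pos])
  define u where "u = br (\<theta> x) z"
  have xu: "br x u = - \<kappa> *\<^sub>R z"
    unfolding u_def br_br[of x "\<theta> x" z] br_theta_eq_coroot[OF hr_weight x(1)] br_hr_hr[OF x(1) z]
    by (simp add: br.zero_right br.scaleR_left br.minus_left root_spaceD[OF z H_in_a] \<kappa>_def)
  have ux: "br u x = \<kappa> *\<^sub>R z" using xu br_antisym[of u x] by simp
  \<comment> \<open>Orthogonality lets u = [\<theta> x, z] be rewritten as -[\<theta> z, x], so
    [u, z] follows by the computation used for [u, x] with x and z exchanged.\<close>
  have "br x (\<theta> z) + br z (\<theta> x) = 0"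
    using br_theta_polar[OF hr_weight x(1) z] orth by simp
  then have zx: "br z (\<theta> x) = - br x (\<theta> z)" by (simp add: eq_neg_iff_add_eq_0 add.commute)
  have u': "u = - br (\<theta> z) x"
    unfolding u_def br_antisym[of "\<theta> x" z] zx minus_minus by (rule br_antisym)
  have "br z (br (\<theta> z) x) = - \<kappa> *\<^sub>R x"
    unfolding br_br[of z "\<theta> z" x] br_theta_eq_coroot[OF hr_weight z] br_hr_hr[OF z x(1)]
    by (simp add: br.zero_right br.scaleR_left br.minus_left root_spaceD[OF x(1) H_in_a] \<kappa>_def eq)
  then have uz: "br u z = - \<kappa> *\<^sub>R x" using br_antisym[of u z] by (simp add: u' br.minus_left br.minus_right)
  let ?U = "of_real_form ((t / \<kappa>) *\<^sub>R u)"
  have Ux: "br ((t / \<kappa>) *\<^sub>R u) x = t *\<^sub>R z" and Uz: "br ((t / \<kappa>) *\<^sub>R u) z = - t *\<^sub>R x"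
    using ux uz \<kappa> by (simp_all add: br.scaleR_left)
  have e1: "adC ?U (x, - z) = cscale (\<i> * of_real t) (x, - z)"
    by (simp add: cbr_of_real_form_left Ux Uz br.minus_right cscale_def)
  have e2: "adC ?U (x, z) = cscale (- \<i> * of_real t) (x, z)"
    by (simp add: cbr_of_real_form_left Ux Uz cscale_def)
  have lin: "linear (exp_op (adC ?U))" by (rule linear_exp_op[OF C.linear_br])
  have "of_real_form x = (1/2) *\<^sub>R ((x, - z) + (x, z))"
    by (simp add: of_real_form_def flip: scaleR_2)
  then have "exp_op (adC ?U) (of_real_form x) =
      (1/2) *\<^sub>R (cscale (exp (\<i> * of_real t)) (x, - z) + cscale (exp (- \<i> * of_real t)) (x, z))"
    by (simp only: linear_cmul[OF lin] linear_add[OF lin] exp_op_eigenvector_complex[OF e1] exp_op_eigenvector_complex[OF e2])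
  also have "\<dots> = of_real_form (cos t *\<^sub>R x + sin t *\<^sub>R z)"
  proof -
    have 1: "cos t *\<^sub>R x + sin t *\<^sub>R z + (cos t *\<^sub>R x + sin t *\<^sub>R z) = 2 *\<^sub>R (cos t *\<^sub>R x + sin t *\<^sub>R z)"
      by (simp add: scaleR_2)
    show ?thesis
      by (simp add: cscale_def of_real_form_def Re_exp Im_exp 1)
  qed
  finally show ?thesis using C.Int_orbit_exp[OF C.Int_orbit_refl] by metis
qed

text \<open>Gram-Schmidt: split y into p x and an orthogonal w. If w = 0 a complex scaling suffices,
  p being possibly negative; otherwise y is a positive multiple of a rotation of x in the plane of x
  and w.\<close>

lemma hr_root_space_single_orbit:
  assumes x: "x \<in> rs hr" "x \<noteq> 0" and y: "y \<in> rs hr" "y \<noteq> 0"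
  shows "of_real_form y \<in> Int_orbit adC (of_real_form x)"
proof -
  define p where "p = bform x y / bform x x"
  define w where "w = y - p *\<^sub>R x"
  have w: "w \<in> rs hr" unfolding w_def by (intro subspace_diff subspace_scale subspace_root_space x y)
  have xx: "bform x x > 0" by (rule bform_pos[OF x(2)])
  have xw: "bform x w = 0" using xx by (simp add: w_def p_def bform.diff_right bform.scaleR_right)
  have scale: "c *\<^sub>R v \<in> Int_orbit adC (of_real_form x)" if "v \<in> Int_orbit adC (of_real_form x)" "c > 0" for c v
    by (rule real_orbit_scale[OF hr_root_space_nilpotent[OF x(1)] that])
  show ?thesis
  proof (cases "w = 0")
    case True
    then have "y = p *\<^sub>R x" by (simp add: w_def)
    then have "of_real_form y = cscale (of_real p) (of_real_form x)" by (simp add: cscale_of_real of_real_form_def)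
    moreover have "p \<noteq> 0" using \<open>y = p *\<^sub>R x\<close> y(2) by auto
    ultimately show ?thesis using hr_orbit_scale[OF x(1), of "of_real p"] by simp
  next
    case False
    have ww: "bform w w > 0" by (rule bform_pos[OF False])
    \<comment> \<open>The factor s gives w the \<open>bform\<close>-length of x, as the rotation
      requires.\<close>
    define s where "s = sqrt (bform x x / bform w w)"
    have s: "s > 0" "s\<^sup>2 = bform x x / bform w w" using xx ww by (simp_all add: s_def)
    define z where "z = s *\<^sub>R w"
    have z: "z \<in> rs hr" unfolding z_def by (intro subspace_scale subspace_root_space w)
    have xz: "bform x z = 0" by (simp add: z_def bform.scaleR_right xw)
    have "bform z z = s\<^sup>2 * bform w w" by (simp add: z_def bform.scaleR_right bform.scaleR_left power2_eq_square)
    then have zz: "bform z z = bform x x" using ww by (simp add: s(2))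
    define r where "r = sqrt (p\<^sup>2 + (1 / s)\<^sup>2)"
    have "p\<^sup>2 + (1 / s)\<^sup>2 > 0" using s(1) by (intro add_nonneg_pos) auto
    then have r: "r > 0" "r\<^sup>2 = p\<^sup>2 + (1 / s)\<^sup>2" by (simp_all add: r_def)
    have "(p / r)\<^sup>2 + (1 / s / r)\<^sup>2 = (p\<^sup>2 + (1 / s)\<^sup>2) / r\<^sup>2"
      by (simp only: power_divide add_divide_distrib)
    also have "\<dots> = 1" unfolding r(2)[symmetric] using r(1) by simp
    finally obtain t where t: "p / r = cos t" "1 / s / r = sin t" using sincos_total_2pi by metis
    have "y = p *\<^sub>R x + (1 / s) *\<^sub>R z" using s(1) by (simp add: z_def w_def)
    also have "\<dots> = r *\<^sub>R (cos t *\<^sub>R x + sin t *\<^sub>R z)"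
      using r(1) by (simp add: scaleR_add_right flip: t)
    finally have "of_real_form y = r *\<^sub>R of_real_form (cos t *\<^sub>R x + sin t *\<^sub>R z)" by (simp add: of_real_form_def)
    then show ?thesis using scale[OF hr_orbit_rotate[OF x z xz zz] r(1)] by simp
  qed
qed

text \<open>The vectors all of whose conjugates are orthogonal to the highest root space form a
  subspace, and differentiating along exp(t ad u) shows it is an ideal. It misses the highest root
  vectors, so it is zero.\<close>

lemma exists_conjugate_with_hr_component:
  assumes "x \<noteq> 0"
  obtains g e where "g \<in> Int_group br" "e \<in> rs hr" "bform (g x) e \<noteq> 0"
proof (rule ccontr)
  assume "\<not> thesis"
  define D where "D = {y. \<forall>g\<in>Int_group br. \<forall>e\<in>rs hr. bform (g y) e = 0}"
  have "x \<in> D" using \<open>\<not> thesis\<close> that unfolding D_def by blast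
  have "subspace D"
    unfolding D_def subspace_def
    by (auto simp: linear_0[OF linear_Int_group] linear_add[OF linear_Int_group] linear_cmul[OF linear_Int_group]
        bform.zero_left bform.add_left bform.scaleR_left)
  moreover have "br u y \<in> D" if "y \<in> D" for u y
    unfolding D_def
  proof (intro CollectI ballI)
    fix g e assume g: "g \<in> Int_group br" and e: "e \<in> rs hr"
    define L where "L v = bform (g v) e" for v
    have "linear L" unfolding L_def
      by (rule linearI) (simp_all add: linear_add[OF linear_Int_group[OF g]] linear_cmul[OF linear_Int_group[OF g]]
          bform.add_left bform.scaleR_left)
    then have bL: "bounded_linear L" by (simp add: linear_conv_bounded_linear)
    have ad_scale: "(\<lambda>v. t *\<^sub>R br u v) = br (t *\<^sub>R u)" for t by (simp add: br.scaleR_left fun_eq_iff)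
    have zero: "L (exp_op (\<lambda>v. t *\<^sub>R br u v) y) = 0" for t
    proof -
      have "g \<circ> exp_op (br (t *\<^sub>R u)) \<in> Int_group br" by (rule Int_group_compose[OF g exp_ad_in_Int_group])
      with \<open>y \<in> D\<close> e show ?thesis unfolding D_def L_def ad_scale by force
    qed
    have "((\<lambda>t. L (exp_op (\<lambda>v. t *\<^sub>R br u v) y)) has_vector_derivative L (br u (exp_op (\<lambda>v. 0 *\<^sub>R br u v) y))) (at 0)"
      by (rule bounded_linear.has_vector_derivative[OF bL exp_op_vector_derivative[OF linear_br]])
    then have "((\<lambda>t. 0) has_vector_derivative L (br u y)) (at 0)" unfolding zero by simp
    then show "bform (g (br u y)) e = 0"
      using vector_derivative_unique_at[OF _ has_vector_derivative_const] unfolding L_def by blast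
  qed
  ultimately have "D = {0} \<or> D = UNIV" by (rule ideal_trivial)
  then have "D = UNIV" using \<open>x \<in> D\<close> assms by blast
  obtain e where e: "e \<in> rs hr" "e \<noteq> 0" using hr_weight by (rule weight_vector)
  have "e \<in> D" unfolding \<open>D = UNIV\<close> by (rule UNIV_I)
  then have "bform (id e) e = 0" using e(1) Int_id[of br] unfolding D_def by blast
  then show False using e(2) by (simp add: bform_eq_0_iff)
qed

text \<open>Among all weights \<open>hr\<close> alone is maximal on H, so after normalisation by the
  top growth rate the flow of H kills every component of the conjugate but the highest.\<close>

lemma hr_component_in_closure:
  assumes x: "x \<in> nilpotent_cone br" "x \<noteq> 0"
  obtains e where "e \<in> rs hr" "e \<noteq> 0" "of_real_form e \<in> closure (Int_orbit adC (of_real_form x))"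
proof -
  obtain g e where g: "g \<in> Int_group br" and e: "e \<in> rs hr" and ne: "bform (g x) e \<noteq> 0"
    using exists_conjugate_with_hr_component[OF x(2)] by metis
  obtain c where c: "\<And>\<xi>. c \<xi> \<in> rs \<xi>" "g x = (\<Sum>\<xi>\<in>weights. c \<xi>)" using root_space_decomposition[of "g x"] by metis
  have orth: "bform (c \<xi>) e = 0" if "\<xi> \<in> weights - {hr}" for \<xi>
    by (rule bform_root_spaces[OF c(1) e]) (use that weights_dual hr_weight in auto)
  have "bform (g x) e = (\<Sum>\<xi>\<in>weights. bform (c \<xi>) e)" by (simp add: c(2) bform.sum_left)
  also have "\<dots> = bform (c hr) e"
    using orth by (simp add: sum.remove[OF finite_weights hr_weight])
  finally have "c hr \<noteq> 0" using ne by (auto simp: bform.zero_left)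
  \<comment> \<open>The scalar exp(-t hr(H)) compensates the growth of the highest component;
    multiplying by it does not leave the orbit, because orbits of real nilpotent elements are stable
    under positive scaling.\<close>
  define y where "y t = exp (- t * hr H) *\<^sub>R exp_op (br (t *\<^sub>R H)) (g x)" for t :: real
  have lin: "linear (exp_op (br (t *\<^sub>R H)))" for t by (rule linear_exp_op[OF linear_br])
  have "exp_op (br (t *\<^sub>R H)) (c \<xi>) = exp (t * \<xi> H) *\<^sub>R c \<xi>" for t \<xi>
    by (rule exp_op_eigenvector[OF linear_br]) (simp add: br.scaleR_left root_spaceD[OF c(1) H_in_a])
  then have y: "y t = (\<Sum>\<xi>\<in>weights. exp (t * (\<xi> H - hr H)) *\<^sub>R c \<xi>)" for t
    by (simp add: y_def c(2) linear_sum[OF lin] scaleR_sum_right exp_add[symmetric] algebra_simps)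
  have "((\<lambda>t. \<Sum>\<xi>\<in>weights. exp (t * (\<xi> H - hr H)) *\<^sub>R c \<xi>) \<longlongrightarrow> (\<Sum>\<xi>\<in>weights. if \<xi> = hr then c \<xi> else 0)) at_top"
  proof (rule tendsto_sum)
    fix \<xi> assume \<xi>: "\<xi> \<in> weights"
    show "((\<lambda>t. exp (t * (\<xi> H - hr H)) *\<^sub>R c \<xi>) \<longlongrightarrow> (if \<xi> = hr then c \<xi> else 0)) at_top"
    proof (cases "\<xi> = hr")
      case False
      have neg: "\<xi> H - hr H < 0" using hr_strict[OF \<xi> False] by simp
      have "filterlim (\<lambda>t. t * (\<xi> H - hr H)) at_bot at_top"
        by (rule filterlim_tendsto_neg_mult_at_bot[OF tendsto_const neg filterlim_ident, simplified mult.commute])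
      then have "((\<lambda>t. exp (t * (\<xi> H - hr H))) \<longlongrightarrow> 0) at_top"
        by (rule filterlim_compose[OF exp_at_bot])
      from tendsto_scaleR[OF this tendsto_const[of "c \<xi>"]] False show ?thesis by simp
    qed simp
  qed
  then have "(y \<longlongrightarrow> c hr) at_top"
    by (simp add: y[abs_def] finite_weights hr_weight)
  then have lim: "((\<lambda>t. of_real_form (y t)) \<longlongrightarrow> of_real_form (c hr)) at_top"
    by (rule bounded_linear.tendsto[OF bounded_linear_of_real_form])
  have "of_real_form (y t) \<in> Int_orbit adC (of_real_form x)" for t
  proof -
    obtain g' where g': "g' \<in> Int_group adC" "\<And>y. g' (of_real_form y) = of_real_form (g y)"
      using Int_group_of_real_form[OF g] by blast
    have "of_real_form (g x) \<in> Int_orbit adC (of_real_form x)"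
      using C.Int_orbit_group[OF C.Int_orbit_refl g'(1)] by (simp only: g'(2)[symmetric])
    then have "of_real_form (exp_op (br (t *\<^sub>R H)) (g x)) \<in> Int_orbit adC (of_real_form x)"
      unfolding exp_op_of_real_form[symmetric] by (rule C.Int_orbit_exp)
    from real_orbit_scale[OF x(1) this, of "exp (- t * hr H)"] show ?thesis
      by (simp add: y_def of_real_form_def)
  qed
  then have "\<forall>\<^sub>F t in at_top. of_real_form (y t) \<in> closure (Int_orbit adC (of_real_form x))"
    using closure_subset by (intro always_eventually allI) blast
  from Lim_in_closed_set[OF closed_closure this _ lim]
  have "of_real_form (c hr) \<in> closure (Int_orbit adC (of_real_form x))" by simp
  with c(1) \<open>c hr \<noteq> 0\<close> show ?thesis by (rule that)
qed

lemma real_nilpotent_orbit_cases: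
  assumes "orb \<in> real_nilpotent_orbits br - {{0}}"
  obtains x where "x \<in> nilpotent_cone br" "x \<noteq> 0" "orb = Int_orbit adC (of_real_form x)"
proof -
  obtain v where v: "v \<in> nilpotent_cone adC" "orb = Int_orbit adC v"
    using assms unfolding real_nilpotent_orbits_def nilpotent_orbits_def by blast
  obtain x where x: "of_real_form x \<in> orb" using assms unfolding real_nilpotent_orbits_def by blast
  have orb: "orb = Int_orbit adC (of_real_form x)" using C.Int_orbit_eq[OF x[unfolded v(2)]] v(2) by simp
  obtain g where "g \<in> Int_group adC" "of_real_form x = g v" using x unfolding v(2) Int_orbit_def by blast
  then have "x \<in> nilpotent_cone br"
    using C.nilpotent_cone_Int_group[OF _ v(1)] nilpotent_of_real_form by metis
  moreover have "x \<noteq> 0"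
  proof
    assume "x = 0"
    then have "orb = {0}" using C.Int_orbit_0 by (simp add: orb of_real_form_def flip: zero_prod_def)
    with assms show False by simp
  qed
  ultimately show ?thesis using orb by (rule that)
qed

lemma real_nilpotent_orbitI:
  assumes "x \<in> nilpotent_cone br" "x \<noteq> 0"
  shows "Int_orbit adC (of_real_form x) \<in> real_nilpotent_orbits br - {{0}}"
proof -
  have "of_real_form x \<noteq> 0" using assms(2) by (simp add: of_real_form_def zero_prod_def)
  with C.Int_orbit_refl[of "of_real_form x"] have "Int_orbit adC (of_real_form x) \<noteq> {0}" by blast
  moreover have "Int_orbit adC (of_real_form x) \<in> nilpotent_orbits adC"
    using assms(1) nilpotent_of_real_form unfolding nilpotent_orbits_def by blast
  moreover have "Int_orbit adC (of_real_form x) \<inter> range of_real_form \<noteq> {}"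
    using C.Int_orbit_refl by blast
  ultimately show ?thesis unfolding real_nilpotent_orbits_def by blast
qed

lemma complex_dimension_real_orbit:
  assumes "x \<in> nilpotent_cone br"
  shows "complex_dimension (Int_orbit adC (of_real_form x)) = cvec.dim (range (adC (of_real_form x)))"
proof -
  obtain h where "adC (of_real_form h) (of_real_form x) = 2 *\<^sub>R of_real_form x"
    "\<And>z. adC (of_real_form h) z - 2 *\<^sub>R z \<in> range (adC (of_real_form x)) \<Longrightarrow> z \<in> range (adC (of_real_form x))"
    using neutral_element_complex[OF assms] by metis
  then show ?thesis by (rule complex_dimension_orbit)
qed

theorem minimal_real_nilpotent_orbit:
  defines "S \<equiv> real_nilpotent_orbits br - {{0}}"
  obtains M where "M \<in> S" "\<And>orb. closure_minimal S orb \<longleftrightarrow> orb = M"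
    "\<And>orb. dimension_minimal S orb \<longleftrightarrow> orb = M"
    "\<And>orb. orb \<in> real_nilpotent_orbits br \<Longrightarrow> of_real_form ` (rs hr - {0}) \<subseteq> orb \<longleftrightarrow> orb = M"
proof -
  obtain e where e: "e \<in> rs hr" "e \<noteq> 0" using hr_weight by (rule weight_vector)
  note e_nil = hr_root_space_nilpotent[OF e(1)]
  define M where "M = Int_orbit adC (of_real_form e)"
  have MS: "M \<in> S" unfolding M_def S_def by (rule real_nilpotent_orbitI[OF e_nil e(2)])
  have M_sub: "of_real_form ` (rs hr - {0}) \<subseteq> M"
    unfolding M_def using hr_root_space_single_orbit[OF e] by blast
  have in_closure: "of_real_form e \<in> closure orb" and M_closure: "M \<subseteq> closure orb" if orb: "orb \<in> S" for orb
  proof -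
    obtain x where x: "x \<in> nilpotent_cone br" "x \<noteq> 0" "orb = Int_orbit adC (of_real_form x)"
      using real_nilpotent_orbit_cases[OF orb[unfolded S_def]] by metis
    obtain f where f: "f \<in> rs hr" "f \<noteq> 0" "of_real_form f \<in> closure orb"
      using hr_component_in_closure[OF x(1,2)] unfolding x(3) by metis
    have "M = Int_orbit adC (of_real_form f)"
      unfolding M_def using hr_root_space_single_orbit[OF e f(1,2)] by (rule C.Int_orbit_eq[symmetric])
    then show "M \<subseteq> closure orb"
      using C.closure_Int_orbit_group[OF f(3)[unfolded x(3)]] unfolding x(3) Int_orbit_def[of adC "of_real_form f"] by blast
    then show "of_real_form e \<in> closure orb" using C.Int_orbit_refl unfolding M_def by blast
  qed
  have dim_le: "complex_dimension M \<le> complex_dimension orb" if orb: "orb \<in> S" for orb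
  proof -
    obtain x where x: "x \<in> nilpotent_cone br" "orb = Int_orbit adC (of_real_form x)"
      using real_nilpotent_orbit_cases[OF orb[unfolded S_def]] by metis
    show ?thesis
      unfolding M_def x(2) complex_dimension_real_orbit[OF e_nil] complex_dimension_real_orbit[OF x(1)]
      by (rule rank_le_of_closure[OF in_closure[OF orb, unfolded x(2)]])
  qed
  \<comment> \<open>Every orbit in \<open>S\<close> already has e in its closure, so a rank no
    larger than that of e forces it to be the orbit of e.\<close>
  have eq_M: "orb = M" if orb: "orb \<in> S" and le: "complex_dimension orb \<le> complex_dimension M" for orb
  proof -
    obtain x where x: "x \<in> nilpotent_cone br" "orb = Int_orbit adC (of_real_form x)"
      using real_nilpotent_orbit_cases[OF orb[unfolded S_def]] by metis
    obtain h where h: "adC (of_real_form h) (of_real_form e) = 2 *\<^sub>R of_real_form e"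
      "\<And>z. adC (of_real_form h) z - 2 *\<^sub>R z \<in> range (adC (of_real_form e)) \<Longrightarrow> z \<in> range (adC (of_real_form e))"
      using neutral_element_complex[OF e_nil] by metis
    obtain h' where h': "adC (of_real_form h') (of_real_form x) = 2 *\<^sub>R of_real_form x"
      "\<And>z. adC (of_real_form h') z - 2 *\<^sub>R z \<in> range (adC (of_real_form x)) \<Longrightarrow> z \<in> range (adC (of_real_form x))"
      using neutral_element_complex[OF x(1)] by metis
    have own: "of_real_form x \<in> range (adC (of_real_form x))" by (rule in_own_range[OF h'])
    have rank: "cvec.dim (range (adC (of_real_form x))) \<le> cvec.dim (range (adC (of_real_form e)))"
      using le unfolding M_def x(2) complex_dimension_real_orbit[OF e_nil] complex_dimension_real_orbit[OF x(1)] .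
    show ?thesis
      unfolding M_def x(2)
      by (rule orbit_eq_of_closure[OF h(1) _ in_closure[OF orb, unfolded x(2)] own rank]) (rule h(2))
  qed
  show ?thesis
  proof (rule that[OF MS])
    show "closure_minimal S orb \<longleftrightarrow> orb = M" for orb
    proof
      assume min: "closure_minimal S orb"
      then have "orb \<in> S" by (simp add: closure_minimal_def)
      have "M = orb"
        using min MS M_closure[OF \<open>orb \<in> S\<close>] unfolding closure_minimal_def by blast
      then show "orb = M" ..
    next
      assume "orb = M"
      \<comment> \<open>Lying in the closure of M bounds the rank of orb' from above, and equality
        then follows from the rank criterion.\<close>
      moreover have "orb' = M" if orb': "orb' \<in> S" "orb' \<subseteq> closure M" for orb'
      proof -
        obtain x where x: "x \<in> nilpotent_cone br" "orb' = Int_orbit adC (of_real_form x)"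
          using real_nilpotent_orbit_cases[OF orb'(1)[unfolded S_def]] by metis
        have "of_real_form x \<in> closure M" using orb'(2) C.Int_orbit_refl unfolding x(2) by blast
        then have "complex_dimension orb' \<le> complex_dimension M"
          unfolding M_def x(2) complex_dimension_real_orbit[OF e_nil] complex_dimension_real_orbit[OF x(1)]
          by (rule rank_le_of_closure)
        then show ?thesis by (rule eq_M[OF orb'(1)])
      qed
      ultimately show "closure_minimal S orb" using MS by (simp add: closure_minimal_def)
    qed
    show "dimension_minimal S orb \<longleftrightarrow> orb = M" for orb
    proof
      assume "dimension_minimal S orb"
      then show "orb = M" using MS eq_M[of orb] by (simp add: dimension_minimal_def)
    qed (use MS dim_le in \<open>simp add: dimension_minimal_def\<close>)
    show "of_real_form ` (rs hr - {0}) \<subseteq> orb \<longleftrightarrow> orb = M" if "orb \<in> real_nilpotent_orbits br" for orb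
    proof
      assume "of_real_form ` (rs hr - {0}) \<subseteq> orb"
      then have "of_real_form e \<in> orb" using e by blast
      moreover obtain v where "orb = Int_orbit adC v"
        using \<open>orb \<in> real_nilpotent_orbits br\<close> unfolding real_nilpotent_orbits_def nilpotent_orbits_def by blast
      ultimately show "orb = M" unfolding M_def using C.Int_orbit_eq by simp
    qed (use M_sub in simp)
  qed
qed

end

theorem theorem1p1:
  fixes br :: "'a::euclidean_space \<Rightarrow> 'a \<Rightarrow> 'a"
    and k p a :: "'a set"
    and P :: "('a \<Rightarrow> real) set"
  assumes real_simple: "simple_lie_algebra scaleR br"
    and no_complex_structure: "simple_lie_algebra cscale (cbr br)"
    and noncompact: "\<not> compact_type br"
    and cartan: "cartan_decomposition br k p"
    and max_abelian: "maximal_abelian_in br p a"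
    and positive: "positive_system (restricted_roots br a) P"
  shows "(\<forall>orb \<in> real_nilpotent_orbits br.
       (closure_minimal (real_nilpotent_orbits br - {{0}}) orb \<longleftrightarrow>
        dimension_minimal (real_nilpotent_orbits br - {{0}}) orb) \<and>
       (dimension_minimal (real_nilpotent_orbits br - {{0}}) orb \<longleftrightarrow>
        of_real_form ` (root_space br a (highest_root P) - {0}) \<subseteq> orb)) \<and>
     (\<exists>!orb. orb \<in> real_nilpotent_orbits br - {{0}} \<and>
        closure_minimal (real_nilpotent_orbits br - {{0}}) orb)"
proof -
  interpret R: simple_lie_algebra scaleR br by (rule real_simple)
  obtain \<theta> where \<theta>: "cartan_involution br \<theta>" and p: "p = {x. \<theta> x = - x}"
    using cartan unfolding cartan_decomposition_def by blast
  have lie: "euclidean_lie_algebra br"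
    by (rule lie_algebra_imp_euclidean_lie_algebra[OF R.lie_algebra_axioms])
  interpret E: euclidean_lie_algebra br by (rule lie)
  have lin\<theta>: "linear \<theta>" and \<theta>\<theta>: "\<And>x. \<theta> (\<theta> x) = x" using \<theta> by (simp_all add: cartan_involution_def)
  \<comment> \<open>Non-compactness enters here. Every x in p spans an abelian subspace, so a = {0}
    would give p = {0} and \<theta> = id; positivity of -B(x, \<theta> x) then says that the Killing
    form is negative definite.\<close>
  have "a \<noteq> {0}"
  proof
    assume "a = {0}"
    have "p \<subseteq> {0}"
    proof
      fix x assume "x \<in> p"
      then have "span {x} \<subseteq> p"
        unfolding p span_singleton by (auto simp: linear_cmul[OF lin\<theta>])
      moreover have "br u v = 0" if "u \<in> span {x}" "v \<in> span {x}" for u v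
        using that unfolding span_singleton by (auto simp: E.br.scaleR_left E.br.scaleR_right E.br_self)
      ultimately have "abelian_subspace_in br p (span {x})" by (simp add: abelian_subspace_in_def)
      moreover have "a \<subseteq> span {x}" using \<open>a = {0}\<close> by (simp add: span_zero)
      ultimately have "span {x} = {0}" using max_abelian \<open>a = {0}\<close> unfolding maximal_abelian_in_def by metis
      then show "x \<in> {0}" using span_base[of x "{x}"] by blast
    qed
    have "\<theta> x = x" for x
    proof -
      have "x - \<theta> x \<in> p" by (simp add: p linear_diff[OF lin\<theta>] \<theta>\<theta>)
      with \<open>p \<subseteq> {0}\<close> show ?thesis by auto
    qed
    then have "compact_type br" using \<theta> by (simp add: compact_type_def cartan_involution_def)
    with noncompact show False by blast
  qed
  interpret simple_cartan_lie_algebra br \<theta> a P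
  proof (intro simple_cartan_lie_algebra.intro cartan_lie_algebra.intro cartan_lie_algebra_axioms.intro
      simple_cartan_lie_algebra_axioms.intro)
    show "maximal_abelian_in br {x. \<theta> x = - x} a" using max_abelian unfolding p .
    show "I = {0} \<or> I = UNIV" if "subspace I" "\<And>x y. y \<in> I \<Longrightarrow> br x y \<in> I" for I
      using R.ideal_trivial[of I] that by (simp add: subspace_raw_def)
  qed (rule lie \<theta> R.nonabelian \<open>a \<noteq> {0}\<close> positive)+
  obtain M where M: "M \<in> real_nilpotent_orbits br - {{0}}"
    and minimal: "\<And>orb. closure_minimal (real_nilpotent_orbits br - {{0}}) orb \<longleftrightarrow> orb = M"
      "\<And>orb. dimension_minimal (real_nilpotent_orbits br - {{0}}) orb \<longleftrightarrow> orb = M"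
      "\<And>orb. orb \<in> real_nilpotent_orbits br \<Longrightarrow>
        of_real_form ` (root_space br a (highest_root P) - {0}) \<subseteq> orb \<longleftrightarrow> orb = M"
    by (rule minimal_real_nilpotent_orbit) (rule that, assumption+)
  show ?thesis
  proof (intro conjI ballI)
    fix orb assume "orb \<in> real_nilpotent_orbits br"
    then show "closure_minimal (real_nilpotent_orbits br - {{0}}) orb \<longleftrightarrow>
        dimension_minimal (real_nilpotent_orbits br - {{0}}) orb"
      and "dimension_minimal (real_nilpotent_orbits br - {{0}}) orb \<longleftrightarrow>
        of_real_form ` (root_space br a (highest_root P) - {0}) \<subseteq> orb"
      by (simp_all only: minimal)
  next
    show "\<exists>!orb. orb \<in> real_nilpotent_orbits br - {{0}} \<and>
        closure_minimal (real_nilpotent_orbits br - {{0}}) orb"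
      unfolding minimal using M by (intro ex1I[of _ M]) simp_all
  qed
qed

end
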